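(* Let $\Delta$ be a tree (not necessarily pure) connected in codimension $1$, with vertices $x_1,\dots,x_n$, and let $I\subset R=K[x_1,\dots,x_n]$ be its facet ideal. Then $I$ has the alternating sum property.
   Context: A simplicial complex $\Delta$ on a finite vertex set is a collection of subsets containing all singletons and closed under taking subsets; $\dim F=|F|-1$ for a face $F$ (so $\dim\emptyset=-1$). Facets are the maximal faces, $\mathcal F(\Delta)$ is the set of facets. A subcomplex of $\Delta$ is a simplicial complex $\Gamma$ with $\mathcal F(\Gamma)\subseteq\mathcal F(\Delta)$. A chain between facets $F,G$ is a sequence of facets $F=F_0,\dots,F_q=G$ with $F_i\cap F_{i+1}\ne\emptyset$ for all $i$; it is proper if moreover $\dim(F_i\cap F_{i+1})=\dim(F_{i+1})-1$ for all $i$. $\Delta$ is connected if any two facets are joined by a chain, and connected in codimension $1$ if for any two facets $F,G$ with $\dim F\ge\dim G$ there is a proper chain between $F$ and $G$. A facet $F$ is a leaf if it is the only facet of $\Delta$, or there is a facet $G\ne F$ with $F\cap H\subseteq F\cap G$ for every facet $H\ne F$. A tree is a connected simplicial complex every nonempty subcomplex of which has a leaf. $K$ is a field, the vertices of $\Delta$ are identified with the variables of $R$, and the facet ideal is generated by the monomials $x_{i_1}\cdots x_{i_s}$ with $\{x_{i_1},\dots,x_{i_s}\}$ a facet. $b_{i,j}(M)=\dim_K\operatorname{Tor}_i^R(K,M)_j$. Let $I$ be a monomial ideal of $R$ with minimal set of monomial generators $\{f_1,\dots,f_m\}$ and $d=\min\{\deg f_i : i=1,\dots,m\}$. $I$ has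 the alternating sum property if $\sum_{i\ge1}(-1)^i b_{i,i+j}(R/I)=-1$ for $j=d-1$ and $\sum_{i\ge1}(-1)^i b_{i,i+j}(R/I)=0$ for all $j>d-1$. *)

theory Defs
  imports Complex_Main "HOL-Library.Poly_Mapping" "HOL-Library.Function_Algebras"
begin

section \<open>Simplicial complexes and trees\<close>

definition simplicial_complex :: "'v set \<Rightarrow> 'v set set \<Rightarrow> bool" where
  "simplicial_complex V \<Delta> \<longleftrightarrow>
     finite V \<and> \<Delta> \<subseteq> Pow V \<and> (\<forall>v\<in>V. {v} \<in> \<Delta>) \<and> (\<forall>F\<in>\<Delta>. \<forall>G. G \<subseteq> F \<longrightarrow> G \<in> \<Delta>)"

definition face_dim :: "'v set \<Rightarrow> int" where
  "face_dim F = int (card F) - 1"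

definition facets :: "'v set set \<Rightarrow> 'v set set" where
  "facets \<Delta> = {F \<in> \<Delta>. \<forall>G\<in>\<Delta>. F \<subseteq> G \<longrightarrow> F = G}"

text \<open>A subcomplex lives on its own vertex set, the union of its faces.\<close>

definition subcomplex :: "'v set set \<Rightarrow> 'v set set \<Rightarrow> bool" where
  "subcomplex \<Gamma> \<Delta> \<longleftrightarrow> simplicial_complex (\<Union>\<Gamma>) \<Gamma> \<and> facets \<Gamma> \<subseteq> facets \<Delta>"

definition facet_chain ::
  "'v set set \<Rightarrow> 'v set \<Rightarrow> 'v set \<Rightarrow> nat \<Rightarrow> (nat \<Rightarrow> 'v set) \<Rightarrow> bool" where
  "facet_chain \<Delta> F G q C \<longleftrightarrow>
     C 0 = F \<and> C q = G \<and> (\<forall>i\<le>q. C i \<in> facets \<Delta>) \<and> (\<forall>i<q. C i \<inter> C (Suc i) \<noteq> {})"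

definition proper_chain ::
  "'v set set \<Rightarrow> 'v set \<Rightarrow> 'v set \<Rightarrow> nat \<Rightarrow> (nat \<Rightarrow> 'v set) \<Rightarrow> bool" where
  "proper_chain \<Delta> F G q C \<longleftrightarrow>
     facet_chain \<Delta> F G q C \<and>
     (\<forall>i<q. face_dim (C i \<inter> C (Suc i)) = face_dim (C (Suc i)) - 1)"

definition connected_complex :: "'v set set \<Rightarrow> bool" where
  "connected_complex \<Delta> \<longleftrightarrow> (\<forall>F\<in>facets \<Delta>. \<forall>G\<in>facets \<Delta>. \<exists>q C. facet_chain \<Delta> F G q C)"

definition connected_in_codim_1 :: "'v set set \<Rightarrow> bool" where
  "connected_in_codim_1 \<Delta> \<longleftrightarrow>
     (\<forall>F\<in>facets \<Delta>. \<forall>G\<in>facets \<Delta>.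
        face_dim F \<ge> face_dim G \<longrightarrow> (\<exists>q C. proper_chain \<Delta> F G q C))"

definition is_leaf :: "'v set \<Rightarrow> 'v set set \<Rightarrow> bool" where
  "is_leaf F \<Delta> \<longleftrightarrow>
     F \<in> facets \<Delta> \<and>
     (facets \<Delta> = {F} \<or>
      (\<exists>G\<in>facets \<Delta>. G \<noteq> F \<and> (\<forall>H\<in>facets \<Delta>. H \<noteq> F \<longrightarrow> F \<inter> H \<subseteq> F \<inter> G)))"

definition is_tree :: "'v set set \<Rightarrow> bool" where
  "is_tree \<Delta> \<longleftrightarrow>
     connected_complex \<Delta> \<and> (\<forall>\<Gamma>. subcomplex \<Gamma> \<Delta> \<and> \<Gamma> \<noteq> {} \<longrightarrow> (\<exists>F. is_leaf F \<Gamma>))"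


section \<open>The polynomial ring and monomial ideals\<close>

text \<open>The polynomial ring over \<open>'k\<close> whose variables are the elements of \<open>'v\<close>:
  finitely supported families of coefficients indexed by exponent vectors.\<close>

type_synonym ('v, 'k) poly_ring = "('v \<Rightarrow>\<^sub>0 nat) \<Rightarrow>\<^sub>0 'k"

definition monomial :: "('v \<Rightarrow>\<^sub>0 nat) \<Rightarrow> ('v, 'k::comm_ring_1) poly_ring" where
  "monomial t = Poly_Mapping.single t 1"

definition var :: "'v \<Rightarrow> ('v, 'k::comm_ring_1) poly_ring" where
  "var x = monomial (Poly_Mapping.single x 1)"

definition mono_degree :: "('v \<Rightarrow>\<^sub>0 nat) \<Rightarrow> nat" where
  "mono_degree t = (\<Sum>x\<in>Poly_Mapping.keys t. Poly_Mapping.lookup t x)"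

text \<open>The ideal generated by a set is its span in the ring viewed as a module over itself.\<close>

lemma module_ring_self: "module ((*) :: 'a::comm_ring_1 \<Rightarrow> 'a \<Rightarrow> 'a)"
  by unfold_locales (simp_all add: algebra_simps)

definition gen_ideal ::
  "('v, 'k::comm_ring_1) poly_ring set \<Rightarrow> ('v, 'k) poly_ring set" where
  "gen_ideal S = module.span (*) S"

definition facet_ideal :: "'v set set \<Rightarrow> ('v, 'k::comm_ring_1) poly_ring set" where
  "facet_ideal \<Delta> = gen_ideal ((\<lambda>F. \<Prod>x\<in>F. var x) ` facets \<Delta>)"

definition minimal_monomial_generators ::
  "('v \<Rightarrow>\<^sub>0 nat) set \<Rightarrow> ('v, 'k::comm_ring_1) poly_ring set \<Rightarrow> bool" where
  "minimal_monomial_generators G I \<longleftrightarrow>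
     gen_ideal (monomial ` G) = I \<and> (\<forall>H. H \<subset> G \<longrightarrow> gen_ideal (monomial ` H) \<noteq> I)"


section \<open>Graded free resolutions\<close>

text \<open>
  The data of a complex \<open>\<dots> \<rightarrow> F\<^sub>2 \<rightarrow> F\<^sub>1 \<rightarrow> F\<^sub>0 \<rightarrow> R/I\<close> of graded free modules of finite rank.
  The module \<open>F\<^sub>i\<close> has as basis the finite set \<open>basis F i\<close> of (names of) generators, the generator
  \<open>k\<close> having degree \<open>twist F i k\<close>; so \<open>F\<^sub>i\<close> is the direct sum of the \<open>R(- twist F i k)\<close>.
  The map from \<open>F\<^sub>0\<close> to \<open>R/I\<close> sends the generator \<open>k\<close> to the class of \<open>aug F k\<close>, and
  \<open>bdry F i k l\<close> is the entry in row \<open>k\<close> and column \<open>l\<close> of the matrix of the map from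
  \<open>F\<^sub>i\<^sub>+\<^sub>1\<close> to \<open>F\<^sub>i\<close>.
\<close>

record (overloaded) ('v, 'k) free_complex =
  basis :: "nat \<Rightarrow> nat set"
  twist :: "nat \<Rightarrow> nat \<Rightarrow> int"
  aug :: "nat \<Rightarrow> ('v, 'k) poly_ring"
  bdry :: "nat \<Rightarrow> nat \<Rightarrow> nat \<Rightarrow> ('v, 'k) poly_ring"

definition free_mod ::
  "('v, 'k::comm_ring_1) free_complex \<Rightarrow> nat \<Rightarrow> (nat \<Rightarrow> ('v, 'k) poly_ring) set" where
  "free_mod F i = {v. \<forall>k. k \<notin> basis F i \<longrightarrow> v k = 0}"

definition aug_map ::
  "('v, 'k::comm_ring_1) free_complex \<Rightarrow> (nat \<Rightarrow> ('v, 'k) poly_ring) \<Rightarrow> ('v, 'k) poly_ring" where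
  "aug_map F v = (\<Sum>k\<in>basis F 0. aug F k * v k)"

definition bdry_map ::
  "('v, 'k::comm_ring_1) free_complex \<Rightarrow> nat \<Rightarrow>
    (nat \<Rightarrow> ('v, 'k) poly_ring) \<Rightarrow> (nat \<Rightarrow> ('v, 'k) poly_ring)" where
  "bdry_map F i v =
     (\<lambda>k. if k \<in> basis F i then (\<Sum>l\<in>basis F (Suc i). bdry F i k l * v l) else 0)"

definition homogeneous :: "int \<Rightarrow> ('v, 'k::zero) poly_ring \<Rightarrow> bool" where
  "homogeneous a p \<longleftrightarrow> (\<forall>t\<in>Poly_Mapping.keys p. int (mono_degree t) = a)"

text \<open>\<open>F\<close> is a graded free resolution of \<open>R/I\<close>: all maps are homogeneous of degree 0 and the
  augmented complex is exact. Elements of \<open>R/I\<close> are handled through representatives in \<open>R\<close>.\<close>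

definition graded_free_resolution ::
  "('v, 'k::comm_ring_1) free_complex \<Rightarrow> ('v, 'k) poly_ring set \<Rightarrow> bool" where
  "graded_free_resolution F I \<longleftrightarrow>
     (\<forall>i. finite (basis F i)) \<and>
     (\<forall>k\<in>basis F 0. homogeneous (twist F 0 k) (aug F k)) \<and>
     (\<forall>i. \<forall>k\<in>basis F i. \<forall>l\<in>basis F (Suc i).
        homogeneous (twist F (Suc i) l - twist F i k) (bdry F i k l)) \<and>
     (\<forall>p. \<exists>v\<in>free_mod F 0. p - aug_map F v \<in> I) \<and>
     {v \<in> free_mod F 0. aug_map F v \<in> I} = bdry_map F 0 ` free_mod F 1 \<and>
     (\<forall>i. {v \<in> free_mod F (Suc i). bdry_map F i v = 0}
           = bdry_map F (Suc i) ` free_mod F (Suc (Suc i)))"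


section \<open>Tor and graded Betti numbers\<close>

text \<open>
  Here \<open>K = R/(x\<^sub>1,\<dots>,x\<^sub>n)\<close>. Tensoring \<open>F\<close> with \<open>K\<close> turns \<open>F\<^sub>i\<close> into the \<open>K\<close>-vector space
  with the same basis, and replaces the matrix entries by their constant coefficients.
  The basis element \<open>k\<close> spans a line in degree \<open>twist F i k\<close>.
\<close>

definition tensor_mod ::
  "('v, 'k::field) free_complex \<Rightarrow> nat \<Rightarrow> int \<Rightarrow> (nat \<Rightarrow> 'k) set" where
  "tensor_mod F i j = {v. \<forall>k. \<not> (k \<in> basis F i \<and> twist F i k = j) \<longrightarrow> v k = 0}"

definition tensor_bdry ::
  "('v, 'k::field) free_complex \<Rightarrow> nat \<Rightarrow> (nat \<Rightarrow> 'k) \<Rightarrow> (nat \<Rightarrow> 'k)" where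
  "tensor_bdry F i v =
     (\<lambda>k. if k \<in> basis F i
          then (\<Sum>l\<in>basis F (Suc i). Poly_Mapping.lookup (bdry F i k l) 0 * v l) else 0)"

definition tor_cycles ::
  "('v, 'k::field) free_complex \<Rightarrow> nat \<Rightarrow> int \<Rightarrow> (nat \<Rightarrow> 'k) set" where
  "tor_cycles F i j =
     {v \<in> tensor_mod F i j. case i of 0 \<Rightarrow> True | Suc h \<Rightarrow> tensor_bdry F h v = 0}"

definition tor_boundaries ::
  "('v, 'k::field) free_complex \<Rightarrow> nat \<Rightarrow> int \<Rightarrow> (nat \<Rightarrow> 'k) set" where
  "tor_boundaries F i j = tensor_bdry F i ` tensor_mod F (Suc i) j"

lemma vector_space_coords: "vector_space (\<lambda>(c::'k::field) v (k::nat). c * v k)"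
  by unfold_locales (simp_all add: fun_eq_iff algebra_simps)

definition vec_dim :: "(nat \<Rightarrow> 'k::field) set \<Rightarrow> nat" where
  "vec_dim = vector_space.dim (\<lambda>c v k. c * v k)"

text \<open>The dimension of the degree \<open>j\<close> part of the homology of \<open>K \<otimes> F\<close> in position \<open>i\<close>;
  all spaces are finite-dimensional and boundaries are cycles, so the dimension of the quotient
  is the difference of dimensions.\<close>

definition tor_dim :: "('v, 'k::field) free_complex \<Rightarrow> nat \<Rightarrow> int \<Rightarrow> nat" where
  "tor_dim F i j = vec_dim (tor_cycles F i j) - vec_dim (tor_boundaries F i j)"

text \<open>The graded Betti number \<open>b\<^sub>i\<^sub>,\<^sub>j(R/I)\<close>. As usual for Tor, a resolution is chosen; graded free
  resolutions of finite rank exist for homogeneous ideals when there are finitely many variables,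
  and the result does not depend on the choice.\<close>

definition betti :: "('v, 'k::field) poly_ring set \<Rightarrow> nat \<Rightarrow> int \<Rightarrow> nat" where
  "betti I i j = tor_dim (SOME F. graded_free_resolution F I) i j"


section \<open>The alternating sum property\<close>

text \<open>The sum of \<open>(-1)\<^sup>i b\<^sub>i\<^sub>,\<^sub>i\<^sub>+\<^sub>j(R/I)\<close> over all \<open>i \<ge> 1\<close> has finitely many nonzero terms and
  equals \<open>c\<close>.\<close>

definition alternating_betti_sum ::
  "('v, 'k::field) poly_ring set \<Rightarrow> int \<Rightarrow> int \<Rightarrow> bool" where
  "alternating_betti_sum I j c \<longleftrightarrow>
     finite {i. 1 \<le> i \<and> betti I i (int i + j) \<noteq> 0} \<and>
     (\<Sum>i | 1 \<le> i \<and> betti I i (int i + j) \<noteq> 0. (- 1) ^ i * int (betti I i (int i + j))) = c"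

definition alternating_sum_property :: "('v, 'k::field) poly_ring set \<Rightarrow> bool" where
  "alternating_sum_property I \<longleftrightarrow>
     (\<exists>G d. finite G \<and> G \<noteq> {} \<and> minimal_monomial_generators G I \<and>
        d = int (Min (mono_degree ` G)) \<and>
        alternating_betti_sum I (d - 1) (- 1) \<and>
        (\<forall>j > d - 1. alternating_betti_sum I j 0))"

end

theory Submission
  imports Defs
begin

text \<open>
  For a family \<open>S\<close> of vertex sets let \<open>I(S)\<close> be the ideal generated by the squarefree monomials
  \<open>x\<^sup>B\<close> with \<open>B \<in> S\<close>; the facet ideal is \<open>I(S)\<close> for \<open>S\<close> the set of facets. Betti numbers are
  computed by adding one generator \<open>f = x\<^sup>A\<close> at a time: multiplication by \<open>f\<close> is an injection
  \<open>R/(I(S) : f) \<rightarrow> R/I(S)\<close> of degree \<open>|A|\<close> with cokernel \<open>R/(I(S) + (f))\<close>, so lifting it to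
  resolutions and taking the mapping cone resolves the cokernel.

  Suppose that \<open>A\<close> has a free vertex \<open>x\<close>, one that lies in no member of \<open>S\<close>. Then the colon ideal
  of \<open>f\<close> is also the colon ideal of \<open>f/x\<close>, so the lift of \<open>f\<close> can be chosen as \<open>x\<close> times a lift of
  \<open>f/x\<close>. It vanishes after tensoring with \<open>K\<close>, and Tor of the cone is a direct sum:
  \<open>b\<^sub>i\<^sub>,\<^sub>j(R/I(S \<union> {A})) = b\<^sub>i\<^sub>,\<^sub>j(R/I(S)) + b\<^sub>i\<^sub>-\<^sub>1\<^sub>,\<^sub>j\<^sub>-\<^sub>|\<^sub>A\<^sub>|(R/(I(S) : f))\<close> (lemma \<open>betti_insert\<close>).
  If moreover some \<open>G \<in> S\<close> has \<open>G - A = {y}\<close>, then the variable \<open>y\<close> lies in the colon ideal. Applying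
  the same formula to the generator \<open>y\<close> shows that the generators without \<open>y\<close> contribute each of
  their Betti numbers twice, in neighbouring homological positions of one strand, so that the
  alternating sums of the colon ideal vanish (lemma
  \<open>alternating_vanishing_of_variable\<close>). Hence adding \<open>A\<close> does not change any alternating sum. Only the very first generator, a facet of smallest dimension, contributes: \<open>-1\<close> in the
  strand of its degree minus one.

  It remains to build the tree up from a smallest facet \<open>F0\<close> in this way, or to take it down. A
  tree with at least two facets has at least two leaves, so there is a leaf \<open>F \<noteq> F0\<close>; it has a free
  vertex; and the first step of a proper chain from \<open>F\<close> to \<open>F0\<close> leads to a facet \<open>G\<close> with
  \<open>|G - F| = 1\<close>. Removing \<open>F\<close> preserves all hypotheses, because proper chains can be rerouted around
  a leaf (lemma \<open>codim1_path_avoids_leaf\<close>).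

  Betti numbers are defined through an arbitrary graded free resolution. The cones provide
  resolutions of finite length for all ideals \<open>I(S)\<close>, and the comparison theorem for resolutions
  (\<open>tor_dim_unique\<close>) makes the choice irrelevant.
\<close>

section \<open>Monomials, degrees and constant coefficients\<close>

lemma keys_add_nat: "Poly_Mapping.keys (s + t) = Poly_Mapping.keys s \<union> Poly_Mapping.keys t"
  for s t :: "'v \<Rightarrow>\<^sub>0 nat"
  by (auto simp: in_keys_iff lookup_add)

lemma exponent_add_eq_0: "s + t = 0 \<longleftrightarrow> s = 0 \<and> t = 0" for s t :: "'v \<Rightarrow>\<^sub>0 nat"
  by (metis keys_eq_empty keys_add_nat Un_empty)

lemma mono_degree_UNIV: "mono_degree t = (\<Sum>x\<in>UNIV. Poly_Mapping.lookup t x)"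
  for t :: "'v::finite \<Rightarrow>\<^sub>0 nat"
  unfolding mono_degree_def by (rule sum.mono_neutral_left) (auto simp: in_keys_iff)

lemma mono_degree_add: "mono_degree (s + t) = mono_degree s + mono_degree t"
  for s t :: "'v::finite \<Rightarrow>\<^sub>0 nat"
  by (simp add: mono_degree_UNIV lookup_add sum.distrib)

lemma mono_degree_0 [simp]: "mono_degree 0 = 0"
  by (simp add: mono_degree_def)

lemma lookup_monomial_mult_add:
  "Poly_Mapping.lookup (monomial s * p) (s + t) = Poly_Mapping.lookup p t"
  for p :: "('v, 'k::comm_ring_1) poly_ring"
  by (simp add: monomial_def lookup_mult lookup_single when_mult)

lemma keys_monomial_mult:
  "Poly_Mapping.keys (monomial s * p) = (+) s ` Poly_Mapping.keys p"
  for p :: "('v, 'k::comm_ring_1) poly_ring"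
proof
  show "Poly_Mapping.keys (monomial s * p) \<subseteq> (+) s ` Poly_Mapping.keys p"
    using keys_mult[of "monomial s" p] by (auto simp: monomial_def)
  show "(+) s ` Poly_Mapping.keys p \<subseteq> Poly_Mapping.keys (monomial s * p)"
    by (auto simp: in_keys_iff lookup_monomial_mult_add)
qed

lemma homogeneous_mult:
  "homogeneous a p \<Longrightarrow> homogeneous b q \<Longrightarrow> homogeneous (a + b) (p * q)"
  for p q :: "('v::finite, 'k::comm_ring_1) poly_ring"
  unfolding homogeneous_def using keys_mult[of p q]
  by (fastforce simp: mono_degree_add)

lemma homogeneous_0 [simp]: "homogeneous a 0"
  by (simp add: homogeneous_def)

lemma homogeneous_1 [simp]: "homogeneous 0 1"
  by (simp add: homogeneous_def)

lemma homogeneous_monomial: "homogeneous (int (mono_degree s)) (monomial s)"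
  by (simp add: homogeneous_def monomial_def)

lemma homogeneous_uminus: "homogeneous a p \<Longrightarrow> homogeneous a (- p)"
  for p :: "('v, 'k::comm_ring_1) poly_ring"
  by (simp add: homogeneous_def in_keys_iff)

lemma homogeneous_add: "homogeneous a p \<Longrightarrow> homogeneous a q \<Longrightarrow> homogeneous a (p + q)"
  for p q :: "('v, 'k::comm_ring_1) poly_ring"
  using keys_add[of p q] by (auto simp: homogeneous_def)

lemma homogeneous_diff: "homogeneous a p \<Longrightarrow> homogeneous a q \<Longrightarrow> homogeneous a (p - q)"
  for p q :: "('v, 'k::comm_ring_1) poly_ring"
  using homogeneous_add[of a p "- q"] by (simp add: homogeneous_uminus)

lemma homogeneous_sum:
  "(\<And>i. i \<in> A \<Longrightarrow> homogeneous a (f i)) \<Longrightarrow> homogeneous a (sum f A)"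
  for f :: "'i \<Rightarrow> ('v, 'k::comm_ring_1) poly_ring"
  using keys_sum[of f A] by (auto simp: homogeneous_def)

definition hom_part :: "int \<Rightarrow> ('v, 'k::zero) poly_ring \<Rightarrow> ('v, 'k) poly_ring" where
  "hom_part a p = Poly_Mapping.mapp (\<lambda>t c. c when int (mono_degree t) = a) p"

lemma lookup_hom_part:
  "Poly_Mapping.lookup (hom_part a p) t = (Poly_Mapping.lookup p t when int (mono_degree t) = a)"
  by (auto simp: hom_part_def lookup_mapp when_def in_keys_iff)

lemma keys_hom_part:
  "Poly_Mapping.keys (hom_part a p) = {t \<in> Poly_Mapping.keys p. int (mono_degree t) = a}"
  by (auto simp: in_keys_iff lookup_hom_part)

lemma homogeneous_hom_part [simp]: "homogeneous a (hom_part a p)"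
  by (simp add: homogeneous_def keys_hom_part)

lemma hom_part_homogeneous: "homogeneous a p \<Longrightarrow> hom_part a p = p"
  by (intro poly_mapping_eqI)
    (auto simp: lookup_hom_part when_def homogeneous_def in_keys_iff)

lemma hom_part_eq_0: "(\<And>t. t \<in> Poly_Mapping.keys p \<Longrightarrow> int (mono_degree t) \<noteq> a) \<Longrightarrow> hom_part a p = 0"
  by (intro poly_mapping_eqI) (auto simp: lookup_hom_part when_def in_keys_iff)

lemma hom_part_add: "hom_part a (p + q) = hom_part a p + hom_part a q"
  for p q :: "('v, 'k::comm_ring_1) poly_ring"
  by (intro poly_mapping_eqI) (simp add: lookup_hom_part lookup_add when_add_distrib)

lemma hom_part_diff: "hom_part a (p - q) = hom_part a p - hom_part a q"
  for p q :: "('v, 'k::comm_ring_1) poly_ring"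
  by (intro poly_mapping_eqI) (simp add: lookup_hom_part lookup_minus when_diff_distrib)

lemma hom_part_sum: "hom_part a (sum f A) = (\<Sum>i\<in>A. hom_part a (f i))"
  for f :: "'i \<Rightarrow> ('v, 'k::comm_ring_1) poly_ring"
  by (intro poly_mapping_eqI) (simp add: lookup_hom_part lookup_sum when_def)

lemma hom_part_mult:
  fixes p q :: "('v::finite, 'k::comm_ring_1) poly_ring"
  assumes p: "homogeneous a p"
  shows "hom_part (a + b) (p * q) = p * hom_part b q"
proof -
  \<comment> \<open>The terms of \<open>r\<close> have degrees other than \<open>b\<close> and do not contribute.\<close>
  define r where "r = q - hom_part b q"
  have r: "int (mono_degree t) \<noteq> b" if "t \<in> Poly_Mapping.keys r" for t
    using that by (auto simp: r_def in_keys_iff lookup_minus lookup_hom_part)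
  have "hom_part (a + b) (p * q) = hom_part (a + b) (p * hom_part b q) + hom_part (a + b) (p * r)"
    by (simp add: r_def flip: hom_part_add distrib_left)
  also have "hom_part (a + b) (p * r) = 0"
  proof (rule hom_part_eq_0)
    fix t assume "t \<in> Poly_Mapping.keys (p * r)"
    then obtain u v where uv: "t = u + v" "u \<in> Poly_Mapping.keys p" "v \<in> Poly_Mapping.keys r"
      using keys_mult[of p r] by auto
    then have "int (mono_degree t) = a + int (mono_degree v)"
      using p by (simp add: homogeneous_def mono_degree_add)
    with r[OF uv(3)] show "int (mono_degree t) \<noteq> a + b" by simp
  qed
  also have "hom_part (a + b) (p * hom_part b q) = p * hom_part b q"
    by (rule hom_part_homogeneous) (simp add: homogeneous_mult p)
  finally show ?thesis by simp
qed

text \<open>The ring map \<open>R \<rightarrow> K\<close> along which resolutions are tensored.\<close>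

definition const_coeff :: "('v, 'k::comm_ring_1) poly_ring \<Rightarrow> 'k" where
  "const_coeff p = Poly_Mapping.lookup p 0"

lemma const_coeff_mult: "const_coeff (p * q) = const_coeff p * const_coeff q"
  for p q :: "('v, 'k::comm_ring_1) poly_ring"
proof -
  define c where "c = const_coeff p"
  \<comment> \<open>Exponents are natural numbers, so the constant term of \<open>r * q\<close> vanishes along with that of \<open>r\<close>.\<close>
  define r where "r = p - Poly_Mapping.single 0 c"
  have "0 \<notin> Poly_Mapping.keys r"
    by (simp add: r_def c_def const_coeff_def in_keys_iff lookup_minus)
  then have "0 \<notin> Poly_Mapping.keys (r * q)"
    using keys_mult[of r q] by (force simp: exponent_add_eq_0 dest: sym)
  moreover have "Poly_Mapping.single 0 c * q = Poly_Mapping.map ((*) c) q"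
    by (simp add: mult_map_scale_conv_mult)
  moreover have "p * q = Poly_Mapping.single 0 c * q + r * q"
    by (simp add: r_def algebra_simps)
  ultimately show ?thesis
    by (simp add: const_coeff_def lookup_add in_keys_iff c_def map.rep_eq when_def)
qed

lemma const_coeff_sum: "const_coeff (sum f A) = (\<Sum>i\<in>A. const_coeff (f i))"
  for f :: "'i \<Rightarrow> ('v, 'k::comm_ring_1) poly_ring"
  by (simp add: const_coeff_def lookup_sum)

lemma const_coeff_simps [simp]:
  "const_coeff 0 = 0" "const_coeff 1 = 1"
  "const_coeff (p + q) = const_coeff p + const_coeff q"
  "const_coeff (p - q) = const_coeff p - const_coeff q"
  "const_coeff (- p) = - const_coeff p"
  for p q :: "('v, 'k::comm_ring_1) poly_ring"
  by (simp_all add: const_coeff_def lookup_add lookup_minus)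

lemma const_coeff_homogeneous:
  "homogeneous a p \<Longrightarrow> a \<noteq> 0 \<Longrightarrow> const_coeff p = 0"
  by (force simp: homogeneous_def const_coeff_def in_keys_iff)

section \<open>Squarefree monomial ideals\<close>

definition sqfree_exp :: "'v set \<Rightarrow> ('v \<Rightarrow>\<^sub>0 nat)" where
  "sqfree_exp A = (\<Sum>x\<in>A. Poly_Mapping.single x 1)"

definition sqfree_monomial :: "'v set \<Rightarrow> ('v, 'k::comm_ring_1) poly_ring" where
  "sqfree_monomial A = monomial (sqfree_exp A)"

text \<open>A polynomial lies in a monomial ideal iff each of its terms is divisible by a generator.
  This description makes colon ideals and graded components immediate; that it is the ideal
  generated by the monomials is \<open>gen_ideal_sqfree_monomials\<close>.\<close>

definition sqfree_ideal :: "'v set set \<Rightarrow> ('v, 'k::comm_ring_1) poly_ring set" where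
  "sqfree_ideal S = {p. \<forall>t\<in>Poly_Mapping.keys p. \<exists>A\<in>S. A \<subseteq> Poly_Mapping.keys t}"

lemma lookup_sqfree_exp: "Poly_Mapping.lookup (sqfree_exp A) x = (if x \<in> A then 1 else 0)"
  for A :: "'v::finite set"
  by (simp add: sqfree_exp_def lookup_sum lookup_single when_def)

lemma keys_sqfree_exp [simp]: "Poly_Mapping.keys (sqfree_exp A) = A" for A :: "'v::finite set"
  by (auto simp: in_keys_iff lookup_sqfree_exp split: if_splits)

lemma mono_degree_sqfree_exp: "mono_degree (sqfree_exp A) = card A" for A :: "'v::finite set"
  by (simp add: mono_degree_def lookup_sqfree_exp)

lemma homogeneous_sqfree_monomial: "homogeneous (int (card A)) (sqfree_monomial A)"
  for A :: "'v::finite set"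
  using homogeneous_monomial[of "sqfree_exp A"]
  by (simp add: sqfree_monomial_def mono_degree_sqfree_exp)

lemma sqfree_monomial_Un:
  "A \<inter> B = {} \<Longrightarrow> sqfree_monomial (A \<union> B) = sqfree_monomial A * sqfree_monomial B"
  for A B :: "'v::finite set"
  by (simp add: sqfree_monomial_def monomial_def mult_single sqfree_exp_def sum.union_disjoint)

lemma sqfree_monomial_prod:
  "(sqfree_monomial A :: ('v::finite, 'k::comm_ring_1) poly_ring) = (\<Prod>x\<in>A. var x)"
proof (induction A rule: infinite_finite_induct)
  case empty
  show ?case by (simp add: sqfree_monomial_def sqfree_exp_def monomial_def)
next
  case (insert x A)
  have "(sqfree_monomial (insert x A) :: ('v, 'k) poly_ring)
      = sqfree_monomial {x} * sqfree_monomial A"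
    using sqfree_monomial_Un[of "{x}" A] insert.hyps by simp
  also have "sqfree_monomial {x} = (var x :: ('v, 'k) poly_ring)"
    by (simp add: sqfree_monomial_def sqfree_exp_def var_def)
  finally show ?case using insert by simp
qed simp

lemma const_coeff_sqfree_monomial: "A \<noteq> {} \<Longrightarrow> const_coeff (sqfree_monomial A) = 0"
  for A :: "'v::finite set"
  by (rule const_coeff_homogeneous[OF homogeneous_sqfree_monomial]) (simp add: card_gt_0_iff)

lemma sqfree_ideal_closed:
  fixes p q :: "('v, 'k::comm_ring_1) poly_ring"
  shows sqfree_ideal_0: "0 \<in> sqfree_ideal S"
    and sqfree_ideal_add: "p \<in> sqfree_ideal S \<Longrightarrow> q \<in> sqfree_ideal S \<Longrightarrow> p + q \<in> sqfree_ideal S"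
    and sqfree_ideal_mult: "p \<in> sqfree_ideal S \<Longrightarrow> q * p \<in> sqfree_ideal S"
    and sqfree_ideal_hom_part: "p \<in> sqfree_ideal S \<Longrightarrow> hom_part a p \<in> sqfree_ideal S"
proof -
  show "0 \<in> sqfree_ideal S" by (simp add: sqfree_ideal_def)
  show "p \<in> sqfree_ideal S \<Longrightarrow> q \<in> sqfree_ideal S \<Longrightarrow> p + q \<in> sqfree_ideal S"
    using keys_add[of p q] by (auto simp: sqfree_ideal_def)
  show "q * p \<in> sqfree_ideal S" if p: "p \<in> sqfree_ideal S"
    unfolding sqfree_ideal_def
  proof (clarify)
    fix t assume "t \<in> Poly_Mapping.keys (q * p)"
    then obtain u v where uv: "t = u + v" "v \<in> Poly_Mapping.keys p"
      using keys_mult[of q p] by auto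
    then obtain A where "A \<in> S" "A \<subseteq> Poly_Mapping.keys v"
      using p by (auto simp: sqfree_ideal_def)
    then show "\<exists>A\<in>S. A \<subseteq> Poly_Mapping.keys t"
      by (auto simp: uv(1) keys_add_nat)
  qed
  show "p \<in> sqfree_ideal S \<Longrightarrow> hom_part a p \<in> sqfree_ideal S"
    by (auto simp: sqfree_ideal_def keys_hom_part)
qed

lemma sqfree_ideal_empty: "sqfree_ideal {} = {0}"
  by (auto simp: sqfree_ideal_def poly_mapping_eq_iff in_keys_iff fun_eq_iff)

lemma exponent_split:
  fixes t :: "'v::finite \<Rightarrow>\<^sub>0 nat"
  assumes "A \<subseteq> Poly_Mapping.keys t"
  obtains r where "t = sqfree_exp A + r"
proof
  show "t = sqfree_exp A + (t - sqfree_exp A)"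
    using assms
    by (intro poly_mapping_eqI) (auto simp: lookup_add lookup_minus lookup_sqfree_exp in_keys_iff)
qed

lemma poly_eq_sum_terms:
  "p = (\<Sum>t\<in>Poly_Mapping.keys p. Poly_Mapping.single t (Poly_Mapping.lookup p t))"
  by (rule poly_mapping_eqI) (auto simp: lookup_sum lookup_single when_def in_keys_iff)

lemma sqfree_monomial_in_ideal: "A \<in> S \<Longrightarrow> sqfree_monomial A \<in> sqfree_ideal S"
  for A :: "'v::finite set"
  by (auto simp: sqfree_ideal_def sqfree_monomial_def monomial_def)

lemma gen_ideal_sqfree_monomials:
  "gen_ideal (sqfree_monomial ` S) = (sqfree_ideal S :: ('v::finite, 'k::comm_ring_1) poly_ring set)"
proof -
  interpret M: module "(*) :: ('v, 'k) poly_ring \<Rightarrow> _" by (rule module_ring_self)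
  show ?thesis unfolding gen_ideal_def
  proof
    show "M.span (sqfree_monomial ` S) \<subseteq> (sqfree_ideal S :: ('v, 'k) poly_ring set)"
    proof (rule M.span_minimal)
      show "sqfree_monomial ` S \<subseteq> (sqfree_ideal S :: ('v, 'k) poly_ring set)"
        using sqfree_monomial_in_ideal by blast
      show "M.subspace (sqfree_ideal S :: ('v, 'k) poly_ring set)"
        unfolding M.subspace_def using sqfree_ideal_closed by blast
    qed
  next
    show "(sqfree_ideal S :: ('v, 'k) poly_ring set) \<subseteq> M.span (sqfree_monomial ` S)"
    proof
      fix p :: "('v, 'k) poly_ring" assume p: "p \<in> sqfree_ideal S"
      have "Poly_Mapping.single t (Poly_Mapping.lookup p t) \<in> M.span (sqfree_monomial ` S)"
        if t: "t \<in> Poly_Mapping.keys p" for t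
      proof -
        obtain A where A: "A \<in> S" "A \<subseteq> Poly_Mapping.keys t"
          using p t by (auto simp: sqfree_ideal_def)
        obtain r where "t = sqfree_exp A + r"
          using exponent_split[OF A(2)] .
        then have "Poly_Mapping.single t (Poly_Mapping.lookup p t)
            = Poly_Mapping.single r (Poly_Mapping.lookup p t) * sqfree_monomial A"
          by (simp add: sqfree_monomial_def monomial_def mult_single add.commute)
        with A(1) show ?thesis
          by (metis M.span_base M.span_scale imageI)
      qed
      then show "p \<in> M.span (sqfree_monomial ` S)"
        by (subst poly_eq_sum_terms) (rule M.span_sum)
    qed
  qed
qed

lemma sqfree_ideal_insert:
  "p \<in> sqfree_ideal (insert A S) \<longleftrightarrow> (\<exists>q. p - q * sqfree_monomial A \<in> sqfree_ideal S)"
  for p :: "('v::finite, 'k::comm_ring_1) poly_ring"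
proof -
  interpret M: module "(*) :: ('v, 'k) poly_ring \<Rightarrow> _" by (rule module_ring_self)
  show ?thesis
    using M.span_insert[of "sqfree_monomial A" "sqfree_monomial ` S"]
    by (simp flip: gen_ideal_sqfree_monomials add: gen_ideal_def)
qed

lemma sqfree_ideal_colon:
  "sqfree_monomial A * p \<in> sqfree_ideal S \<longleftrightarrow> p \<in> sqfree_ideal ((\<lambda>B. B - A) ` S)"
  for p :: "('v::finite, 'k::comm_ring_1) poly_ring"
  by (simp add: sqfree_ideal_def sqfree_monomial_def keys_monomial_mult keys_add_nat Diff_subset_conv)

section \<open>Dimensions of coordinate spaces\<close>

abbreviation coord_scale :: "'k::field \<Rightarrow> (nat \<Rightarrow> 'k) \<Rightarrow> (nat \<Rightarrow> 'k)" where
  "coord_scale \<equiv> (\<lambda>c v k. c * v k)"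

text \<open>Vectors are finitely supported in all applications, but the ambient space \<open>nat \<Rightarrow> K\<close> is
  infinite-dimensional, so finiteness is carried by \<open>fin_space\<close> below.\<close>

interpretation coord: vector_space "coord_scale :: 'k::field \<Rightarrow> _"
  rewrites "vector_space.dim coord_scale = vec_dim"
  by (rule vector_space_coords) (simp add: vec_dim_def)

definition coord_linear :: "((nat \<Rightarrow> 'k::field) \<Rightarrow> (nat \<Rightarrow> 'k)) \<Rightarrow> bool" where
  "coord_linear T \<longleftrightarrow> (\<forall>u v. T (u + v) = T u + T v) \<and> (\<forall>c v. T (\<lambda>k. c * v k) = (\<lambda>k. c * T v k))"

lemma coord_linear_0: "coord_linear T \<Longrightarrow> T 0 = 0"
proof -
  assume "coord_linear T"
  then have "T (\<lambda>k. 0 * (0::nat \<Rightarrow> 'a) k) = (\<lambda>k. 0 * T 0 k)" unfolding coord_linear_def by blast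
  then show "T 0 = 0" by (simp add: zero_fun_def)
qed

lemma coord_linear_imp_linear: "coord_linear T \<Longrightarrow> Vector_Spaces.linear coord_scale coord_scale T"
  by (intro Vector_Spaces.linear.intro module_hom.intro module_hom_axioms.intro
      vector_space_coords module_hom_axioms.intro coord.module_axioms)
    (auto simp: coord_linear_def)

definition fin_space :: "(nat \<Rightarrow> 'k::field) set \<Rightarrow> bool" where
  "fin_space Z \<longleftrightarrow> coord.subspace Z \<and> (\<exists>W. finite W \<and> Z \<subseteq> coord.span W)"

lemma coord_subspace_iff:
  "coord.subspace Z \<longleftrightarrow> 0 \<in> Z \<and> (\<forall>u\<in>Z. \<forall>v\<in>Z. u + v \<in> Z) \<and> (\<forall>c. \<forall>v\<in>Z. (\<lambda>k. c * v k) \<in> Z)"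
  by (auto simp: coord.subspace_def)

lemma fin_space_subset: "fin_space Z \<Longrightarrow> coord.subspace Y \<Longrightarrow> Y \<subseteq> Z \<Longrightarrow> fin_space Y"
  by (auto simp: fin_space_def)

lemma fin_space_uminus: "fin_space Z \<Longrightarrow> v \<in> Z \<Longrightarrow> - v \<in> Z"
  by (auto simp: fin_space_def coord.subspace_neg[of Z v, simplified] dest!: coord.subspace_neg)

lemma fin_space_diff: "fin_space Z \<Longrightarrow> u \<in> Z \<Longrightarrow> v \<in> Z \<Longrightarrow> u - v \<in> Z"
  by (auto simp: fin_space_def dest: coord.subspace_diff)

lemma fin_space_add: "fin_space Z \<Longrightarrow> u \<in> Z \<Longrightarrow> v \<in> Z \<Longrightarrow> u + v \<in> Z"
  by (auto simp: fin_space_def dest: coord.subspace_add)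

text \<open>A basis of the kernel is extended to a basis of \<open>Z\<close>; the added vectors map to a basis of
  the image.\<close>

lemma rank_nullity:
  assumes Z: "fin_space Z" and T: "coord_linear T"
  shows "vec_dim Z = vec_dim (T ` Z) + vec_dim {z \<in> Z. T z = 0}"
proof -
  interpret T: Vector_Spaces.linear coord_scale coord_scale T
    by (rule coord_linear_imp_linear[OF T])
  define K where "K = {z \<in> Z. T z = 0}"
  have subZ: "coord.subspace Z" using Z by (simp add: fin_space_def)
  obtain W where W: "finite W" "Z \<subseteq> coord.span W" using Z by (auto simp: fin_space_def)
  obtain b0 where b0: "b0 \<subseteq> K" "coord.independent b0" "K \<subseteq> coord.span b0" "card b0 = vec_dim K"
    using coord.basis_exists[of K] by metis
  have "b0 \<subseteq> Z" using b0(1) by (auto simp: K_def)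
  then obtain b where b: "b0 \<subseteq> b" "b \<subseteq> Z" "coord.independent b" "Z \<subseteq> coord.span b"
    using coord.maximal_independent_subset_extend[of b0 Z] b0(2) by metis
  have finb: "finite b"
    using coord.independent_span_bound[OF W(1) b(3)] b(2) W(2) by auto
  define c where "c = b - b0"
  have finc: "finite c" "finite b0" using finb b(1) finite_subset by (auto simp: c_def)
  have indc: "coord.independent c"
    using b(3) coord.dependent_mono by (auto simp: c_def)
  have meet: "x = 0" if x: "x \<in> coord.span c" "x \<in> coord.span b0" for x
  proof -
    obtain u where u: "x = (\<Sum>v\<in>c. coord_scale (u v) v)"
      using x(1) by (auto simp: coord.span_finite finc)
    obtain w where w: "x = (\<Sum>v\<in>b0. coord_scale (w v) v)"
      using x(2) by (auto simp: coord.span_finite finc)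
    \<comment> \<open>The two expansions of \<open>x\<close> combine into a linear relation on the basis \<open>b\<close>.\<close>
    define r where "r v = (if v \<in> b0 then - w v else u v)" for v
    have "(\<Sum>v\<in>b. coord_scale (r v) v) = (\<Sum>v\<in>c. coord_scale (r v) v) + (\<Sum>v\<in>b0. coord_scale (r v) v)"
      unfolding c_def by (rule sum.subset_diff[OF b(1) finb])
    also have "(\<Sum>v\<in>c. coord_scale (r v) v) = x"
      unfolding u by (rule sum.cong) (auto simp: r_def c_def)
    also have "(\<Sum>v\<in>b0. coord_scale (r v) v) = - x"
      unfolding w sum_negf[symmetric] by (rule sum.cong) (auto simp: r_def fun_eq_iff)
    finally have "(\<Sum>v\<in>b. coord_scale (r v) v) = 0" by (simp add: fun_eq_iff)
    then have "r v = 0" if "v \<in> b" for v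
      using coord.independentD[OF b(3) finb order_refl _ that] by blast
    then have "u v = 0" if "v \<in> c" for v
      using that by (force simp: r_def c_def split: if_splits)
    then show "x = 0" unfolding u by (intro sum.neutral) (auto simp: fun_eq_iff)
  qed
  have spanc: "coord.span c \<subseteq> Z"
    using b(2) by (intro coord.span_minimal subZ) (auto simp: c_def)
  have inj: "inj_on T (coord.span c)"
  proof (rule inj_onI)
    fix x y assume xy: "x \<in> coord.span c" "y \<in> coord.span c" "T x = T y"
    then have "x - y \<in> coord.span c" by (intro coord.span_diff)
    moreover from this have "x - y \<in> K" using spanc xy by (auto simp: K_def T.diff)
    ultimately have "x - y = 0" using meet b0(3) by blast
    then show "x = y" by simp
  qed
  have "vec_dim (T ` Z) = card (T ` c)"
  proof (rule coord.dim_unique)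
    show "T ` c \<subseteq> T ` Z" using b(2) by (auto simp: c_def)
    show "coord.independent (T ` c)"
      by (rule T.independent_inj_on_image[OF indc inj])
    show "T ` Z \<subseteq> coord.span (T ` c)"
    proof -
      have "T ` Z \<subseteq> T ` coord.span b" using b(4) by blast
      also have "\<dots> = coord.span (T ` b)" by (simp add: T.span_image)
      also have "\<dots> \<subseteq> coord.span (T ` c)"
      proof (rule coord.span_minimal)
        show "T ` b \<subseteq> coord.span (T ` c)"
        proof clarify
          fix v assume "v \<in> b"
          show "T v \<in> coord.span (T ` c)"
          proof (cases "v \<in> b0")
            case True
            then have "T v = 0" using b0(1) by (auto simp: K_def)
            then show ?thesis by (simp add: coord.span_zero)
          next
            case False
            then show ?thesis using \<open>v \<in> b\<close> by (auto intro: coord.span_base simp: c_def)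
          qed
        qed
      qed (rule coord.subspace_span)
      finally show ?thesis .
    qed
  qed simp
  also have "card (T ` c) = card c"
    using inj coord.span_superset[of c] by (intro card_image) (rule inj_on_subset)
  finally have "vec_dim (T ` Z) = card c" .
  moreover have "vec_dim Z = card b"
    using coord.dim_unique[OF b(2,4,3)] by simp
  moreover have "card b = card c + card b0"
    using b(1) finc by (simp add: c_def card_Diff_subset card_mono finb)
  ultimately show ?thesis using b0(4) by (simp add: K_def)
qed

lemma vec_dim_0 [simp]: "vec_dim {0} = 0"
  by (rule coord.dim_unique[of "{}"]) (auto simp: coord.independent_empty)

lemma vec_dim_inj_image:
  assumes "fin_space Z" "coord_linear T" "\<And>z. z \<in> Z \<Longrightarrow> T z = 0 \<Longrightarrow> z = 0"
  shows "vec_dim (T ` Z) = vec_dim Z"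
proof -
  have "0 \<in> Z" using assms(1) by (simp add: fin_space_def coord.subspace_0)
  then have "{z \<in> Z. T z = 0} = {0}"
    using assms(3) coord_linear_0[OF assms(2)] by auto
  then show ?thesis using rank_nullity[OF assms(1,2)] by simp
qed

lemma vec_dim_mono:
  assumes "fin_space Z" "fin_space Y" "Y \<subseteq> Z"
  shows "vec_dim Y \<le> vec_dim Z"
proof -
  obtain b where b: "b \<subseteq> Z" "coord.independent b" "Z \<subseteq> coord.span b" "card b = vec_dim Z"
    using coord.basis_exists[of Z] by metis
  have "finite b"
    using assms(1) b coord.independent_span_bound[of _ b] unfolding fin_space_def by blast
  then show ?thesis using coord.dim_le_card[of Y b] b assms(3) by auto
qed

text \<open>Free modules have bases of natural numbers. Putting one basis on the even and the other on
  the odd numbers realises direct sums, both here and in the mapping cones below.\<close>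

definition evens :: "(nat \<Rightarrow> 'a) \<Rightarrow> (nat \<Rightarrow> 'a)" where "evens v k = v (2 * k)"
definition odds :: "(nat \<Rightarrow> 'a) \<Rightarrow> (nat \<Rightarrow> 'a)" where "odds v k = v (2 * k + 1)"
definition interleave :: "(nat \<Rightarrow> 'a) \<Rightarrow> (nat \<Rightarrow> 'a) \<Rightarrow> (nat \<Rightarrow> 'a)" where
  "interleave u w k = (if even k then u (k div 2) else w (k div 2))"

lemma interleave_simps [simp]:
  "evens (interleave u w) = u" "odds (interleave u w) = w" "interleave (evens v) (odds v) = v"
  by (auto simp: evens_def odds_def interleave_def fun_eq_iff)

lemma interleave_at [simp]:
  "interleave u w (2 * k) = u k" "interleave u w (Suc (2 * k)) = w k"
  by (auto simp: interleave_def)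

lemma evens_odds_simps [simp]:
  fixes u v :: "nat \<Rightarrow> 'a::comm_ring_1"
  shows "evens (0 :: nat \<Rightarrow> 'a) = 0" "odds (0 :: nat \<Rightarrow> 'a) = 0"
    "evens (u + v) = evens u + evens v" "odds (u + v) = odds u + odds v"
    "evens (\<lambda>k. c * v k) = (\<lambda>k. c * evens v k)" "odds (\<lambda>k. c * v k) = (\<lambda>k. c * odds v k)"
  by (auto simp: evens_def odds_def fun_eq_iff)

lemma coord_linear_evens: "coord_linear evens"
  by (auto simp: coord_linear_def evens_def odds_def fun_eq_iff)

lemma coord_linear_interleave_0: "coord_linear (\<lambda>u. interleave u 0)" "coord_linear (interleave 0)"
  by (auto simp: coord_linear_def interleave_def fun_eq_iff)

definition dsum :: "(nat \<Rightarrow> 'a) set \<Rightarrow> (nat \<Rightarrow> 'a) set \<Rightarrow> (nat \<Rightarrow> 'a) set" where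
  "dsum A B = {v. evens v \<in> A \<and> odds v \<in> B}"

lemma fin_space_dsum:
  assumes "fin_space A" "fin_space B"
  shows "fin_space (dsum A B)"
proof -
  obtain V W where V: "finite V" "A \<subseteq> coord.span V" and W: "finite W" "B \<subseteq> coord.span W"
    using assms by (auto simp: fin_space_def)
  let ?L = "\<lambda>u. interleave u (0::nat \<Rightarrow> 'a)" and ?R = "interleave (0::nat \<Rightarrow> 'a)"
  interpret L: Vector_Spaces.linear coord_scale coord_scale ?L
    by (rule coord_linear_imp_linear[OF coord_linear_interleave_0(1)])
  interpret R: Vector_Spaces.linear coord_scale coord_scale ?R
    by (rule coord_linear_imp_linear[OF coord_linear_interleave_0(2)])
  have "dsum A B \<subseteq> coord.span (?L ` V \<union> ?R ` W)"
  proof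
    fix v assume "v \<in> dsum A B"
    then have "?L (evens v) \<in> coord.span (?L ` V)" "?R (odds v) \<in> coord.span (?R ` W)"
      using V(2) W(2) by (auto simp: dsum_def L.span_image R.span_image)
    then have "?L (evens v) + ?R (odds v) \<in> coord.span (?L ` V \<union> ?R ` W)"
      using coord.span_mono[of "?L ` V" "?L ` V \<union> ?R ` W"] coord.span_mono[of "?R ` W" "?L ` V \<union> ?R ` W"]
      by (intro coord.span_add) auto
    moreover have "?L (evens v) + ?R (odds v) = v"
      by (auto simp: fun_eq_iff interleave_def evens_def odds_def)
    ultimately show "v \<in> coord.span (?L ` V \<union> ?R ` W)" by simp
  qed
  moreover have "coord.subspace (dsum A B)"
    using assms by (auto simp: fin_space_def coord_subspace_iff dsum_def)
  moreover have "finite (?L ` V \<union> ?R ` W)" using V(1) W(1) by simp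
  ultimately show ?thesis unfolding fin_space_def by blast
qed

lemma vec_dim_dsum:
  assumes A: "fin_space A" and B: "fin_space B"
  shows "vec_dim (dsum A B) = vec_dim A + vec_dim B"
proof -
  have 0: "0 \<in> A" "0 \<in> B" using A B by (auto simp: fin_space_def coord.subspace_0)
  have "evens ` dsum A B = A"
  proof
    show "A \<subseteq> evens ` dsum A B"
    proof
      fix u assume "u \<in> A"
      then have "u = evens (interleave u 0)" "interleave u 0 \<in> dsum A B"
        using 0 by (auto simp: dsum_def)
      then show "u \<in> evens ` dsum A B" by blast
    qed
  qed (auto simp: dsum_def)
  moreover have "{v \<in> dsum A B. evens v = 0} = interleave 0 ` B"
  proof
    show "{v \<in> dsum A B. evens v = 0} \<subseteq> interleave 0 ` B"
    proof
      fix v assume "v \<in> {v \<in> dsum A B. evens v = 0}"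
      then have "v = interleave 0 (odds v)" "odds v \<in> B"
        using interleave_simps(3)[of v] by (auto simp: dsum_def)
      then show "v \<in> interleave 0 ` B" by blast
    qed
  qed (use 0 in \<open>auto simp: dsum_def\<close>)
  moreover have "vec_dim (interleave 0 ` B) = vec_dim B"
  proof (rule vec_dim_inj_image[OF B coord_linear_interleave_0(2)])
    fix w :: "nat \<Rightarrow> 'a" assume "interleave 0 w = 0"
    then have "odds (interleave 0 w) = odds 0" by (rule arg_cong)
    then show "w = 0" by simp
  qed
  ultimately show ?thesis
    using rank_nullity[OF fin_space_dsum[OF A B] coord_linear_evens] by simp
qed

text \<open>Linear maps that are inverse to each other modulo \<open>B\<close> and \<open>B'\<close> identify the quotients
  \<open>Z/B\<close> and \<open>Z'/B'\<close>. The dimension formula comes from the map \<open>(z, b) \<mapsto> T z + b\<close> of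
  \<open>Z \<oplus> B'\<close> onto \<open>Z'\<close>, whose kernel is a copy of \<open>B\<close>.\<close>

lemma vec_dim_quotient_iso:
  assumes Z: "fin_space Z" "fin_space B" "B \<subseteq> Z" and Z': "fin_space Z'" "fin_space B'" "B' \<subseteq> Z'"
    and T: "coord_linear T" "T ` Z \<subseteq> Z'" "T ` B \<subseteq> B'"
    and S: "coord_linear S" "S ` Z' \<subseteq> Z" "S ` B' \<subseteq> B"
    and ST: "\<And>z. z \<in> Z \<Longrightarrow> S (T z) - z \<in> B" and TS: "\<And>z. z \<in> Z' \<Longrightarrow> T (S z) - z \<in> B'"
  shows "vec_dim Z + vec_dim B' = vec_dim Z' + vec_dim B"
proof -
  define L where "L v = T (evens v) + odds v" for v
  have L: "coord_linear L"
    unfolding coord_linear_def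
  proof (intro conjI allI)
    fix u v
    have "T (evens (u + v)) = T (evens u) + T (evens v)" "odds (u + v) = odds u + odds v"
      using T(1) by (simp_all add: coord_linear_def)
    then show "L (u + v) = L u + L v" by (simp add: L_def)
  next
    fix c v
    have "T (evens (coord_scale c v)) = coord_scale c (T (evens v))"
      "odds (coord_scale c v) = coord_scale c (odds v)"
      using T(1) by (simp_all add: coord_linear_def)
    then show "L (coord_scale c v) = coord_scale c (L v)"
      by (simp add: L_def fun_eq_iff algebra_simps)
  qed
  let ?U = "dsum Z B'" and ?K = "{v \<in> dsum Z B'. L v = 0}"
  have U: "fin_space ?U" by (rule fin_space_dsum[OF Z(1) Z'(2)])
  have image: "L ` ?U = Z'"
  proof
    show "L ` ?U \<subseteq> Z'"
    proof clarify
      fix v assume "v \<in> ?U"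
      then have "T (evens v) \<in> Z'" "odds v \<in> Z'" using T(2) Z'(3) by (auto simp: dsum_def)
      then show "L v \<in> Z'" using fin_space_add[OF Z'(1)] by (simp add: L_def)
    qed
    show "Z' \<subseteq> L ` ?U"
    proof
      fix z assume z: "z \<in> Z'"
      have "- (T (S z) - z) \<in> B'" using TS[OF z] by (rule fin_space_uminus[OF Z'(2)])
      then have "interleave (S z) (z - T (S z)) \<in> ?U" using z S(2) by (auto simp: dsum_def)
      moreover have "z = L (interleave (S z) (z - T (S z)))" by (simp add: L_def)
      ultimately show "z \<in> L ` ?U" by blast
    qed
  qed
  have "coord.subspace ?K"
    using L U by (auto simp: fin_space_def coord_subspace_iff coord_linear_def coord_linear_0[OF L] zero_fun_def[symmetric])
  then have K: "fin_space ?K" by (rule fin_space_subset[OF U]) auto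
  have "evens ` ?K = B"
  proof
    show "evens ` ?K \<subseteq> B"
    proof clarify
      fix v assume v: "v \<in> ?U" "L v = 0"
      then have "T (evens v) = - odds v" by (simp add: L_def eq_neg_iff_add_eq_0)
      then have "T (evens v) \<in> B'" using v(1) fin_space_uminus[OF Z'(2)] by (simp add: dsum_def)
      then have 1: "S (T (evens v)) \<in> B" using S(3) by blast
      have "S (T (evens v)) - evens v \<in> B" using v(1) ST by (simp add: dsum_def)
      from fin_space_diff[OF Z(2) 1 this] show "evens v \<in> B" by simp
    qed
    show "B \<subseteq> evens ` ?K"
    proof
      fix b assume b: "b \<in> B"
      then have "T b \<in> B'" using T(3) by blast
      then have "interleave b (- T b) \<in> ?K"
        using b Z(3) fin_space_uminus[OF Z'(2)] by (auto simp: dsum_def L_def)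
      moreover have "b = evens (interleave b (- T b))" by simp
      ultimately show "b \<in> evens ` ?K" by blast
    qed
  qed
  moreover have "vec_dim (evens ` ?K) = vec_dim ?K"
  proof (rule vec_dim_inj_image[OF K coord_linear_evens])
    fix v assume v: "v \<in> ?K" "evens v = 0"
    then have "odds v = 0" by (simp add: L_def coord_linear_0[OF T(1)])
    with v(2) show "v = 0" by (metis coord_linear_0 coord_linear_interleave_0(1) interleave_simps(3))
  qed
  ultimately show ?thesis
    using rank_nullity[OF U L] vec_dim_dsum[OF Z(1) Z'(2)] image by simp
qed

section \<open>Lifting through a graded free resolution\<close>

text \<open>The kernel and the image at position \<open>i\<close> of the augmented complex. Vectors are not required
  to be supported on the basis; their coordinates off the basis are ignored. This saves the
  restriction to \<open>free_mod\<close> in all constructions below.\<close>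

definition cycle ::
  "('v, 'k::comm_ring_1) free_complex \<Rightarrow> ('v, 'k) poly_ring set \<Rightarrow> nat \<Rightarrow>
    (nat \<Rightarrow> ('v, 'k) poly_ring) \<Rightarrow> bool" where
  "cycle F I i w = (case i of
      0 \<Rightarrow> (\<Sum>k\<in>basis F 0. aug F k * w k) \<in> I
    | Suc h \<Rightarrow> (\<forall>k\<in>basis F h. (\<Sum>m\<in>basis F (Suc h). bdry F h k m * w m) = 0))"

definition boundary ::
  "('v, 'k::comm_ring_1) free_complex \<Rightarrow> nat \<Rightarrow> (nat \<Rightarrow> ('v, 'k) poly_ring) \<Rightarrow> bool" where
  "boundary F i w \<longleftrightarrow>
     (\<exists>v. \<forall>k\<in>basis F i. w k = (\<Sum>m\<in>basis F (Suc i). bdry F i k m * v m))"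

lemma restricted_exactness:
  fixes F :: "('v, 'k::comm_ring_1) free_complex"
  assumes P: "\<And>w. P w \<longleftrightarrow> P (\<lambda>k. if k \<in> basis F i then w k else 0)"
  shows "{v \<in> free_mod F i. P v} = bdry_map F i ` free_mod F (Suc i) \<longleftrightarrow>
     (\<forall>w. P w \<longleftrightarrow> boundary F i w)"
proof -
  let ?r = "\<lambda>w k. if k \<in> basis F i then w k else (0 :: ('v, 'k) poly_ring)"
  have im: "?r w \<in> bdry_map F i ` free_mod F (Suc i) \<longleftrightarrow> boundary F i w" for w
  proof
    assume "?r w \<in> bdry_map F i ` free_mod F (Suc i)"
    then obtain v where "?r w = bdry_map F i v" by blast
    then have "w k = (\<Sum>m\<in>basis F (Suc i). bdry F i k m * v m)" if "k \<in> basis F i" for k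
      using that by (auto simp: bdry_map_def fun_eq_iff split: if_splits)
    then show "boundary F i w" by (auto simp: boundary_def)
  next
    assume "boundary F i w"
    then obtain v where v: "\<forall>k\<in>basis F i. w k = (\<Sum>m\<in>basis F (Suc i). bdry F i k m * v m)"
      by (auto simp: boundary_def)
    define v' where "v' = (\<lambda>k. if k \<in> basis F (Suc i) then v k else 0)"
    have "v' \<in> free_mod F (Suc i)" by (simp add: v'_def free_mod_def)
    moreover have "?r w = bdry_map F i v'"
      using v by (auto simp: bdry_map_def fun_eq_iff v'_def intro!: sum.cong)
    ultimately show "?r w \<in> bdry_map F i ` free_mod F (Suc i)" by blast
  qed
  have r: "?r w \<in> free_mod F i" for w by (simp add: free_mod_def)
  have fix_r: "?r w = w" if "w \<in> free_mod F i" for w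
    using that by (auto simp: free_mod_def fun_eq_iff)
  have sub: "bdry_map F i ` free_mod F (Suc i) \<subseteq> free_mod F i"
    by (auto simp: bdry_map_def free_mod_def)
  show ?thesis
  proof
    assume eq: "{v \<in> free_mod F i. P v} = bdry_map F i ` free_mod F (Suc i)"
    show "\<forall>w. P w \<longleftrightarrow> boundary F i w"
    proof
      fix w
      have "P w \<longleftrightarrow> ?r w \<in> {v \<in> free_mod F i. P v}" using P[of w] r by simp
      then show "P w \<longleftrightarrow> boundary F i w" unfolding eq im .
    qed
  next
    assume R: "\<forall>w. P w \<longleftrightarrow> boundary F i w"
    show "{v \<in> free_mod F i. P v} = bdry_map F i ` free_mod F (Suc i)"
    proof (rule set_eqI)
      fix w
      show "w \<in> {v \<in> free_mod F i. P v} \<longleftrightarrow> w \<in> bdry_map F i ` free_mod F (Suc i)"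
      proof (cases "w \<in> free_mod F i")
        case True
        then show ?thesis using R im[of w] fix_r[OF True] by simp
      next
        case False
        then show ?thesis using sub by blast
      qed
    qed
  qed
qed

lemma cycle_restrict: "cycle F I i w \<longleftrightarrow> cycle F I i (\<lambda>k. if k \<in> basis F i then w k else 0)"
  by (auto simp: cycle_def split: nat.split cong: sum.cong)

lemma graded_free_resolution_iff:
  "graded_free_resolution F I \<longleftrightarrow>
     (\<forall>i. finite (basis F i)) \<and>
     (\<forall>k\<in>basis F 0. homogeneous (twist F 0 k) (aug F k)) \<and>
     (\<forall>i. \<forall>k\<in>basis F i. \<forall>l\<in>basis F (Suc i).
        homogeneous (twist F (Suc i) l - twist F i k) (bdry F i k l)) \<and>
     (\<forall>p. \<exists>v. p - (\<Sum>k\<in>basis F 0. aug F k * v k) \<in> I) \<and>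
     (\<forall>i w. cycle F I i w \<longleftrightarrow> boundary F i w)"
proof -
  have surj: "(\<exists>v\<in>free_mod F 0. p - aug_map F v \<in> I) \<longleftrightarrow>
      (\<exists>v. p - (\<Sum>k\<in>basis F 0. aug F k * v k) \<in> I)" for p
  proof
    assume "\<exists>v. p - (\<Sum>k\<in>basis F 0. aug F k * v k) \<in> I"
    then obtain v where "p - (\<Sum>k\<in>basis F 0. aug F k * v k) \<in> I" by blast
    then have "p - aug_map F (\<lambda>k. if k \<in> basis F 0 then v k else 0) \<in> I"
      by (simp add: aug_map_def cong: sum.cong)
    moreover have "(\<lambda>k. if k \<in> basis F 0 then v k else 0) \<in> free_mod F 0"
      by (simp add: free_mod_def)
    ultimately show "\<exists>v\<in>free_mod F 0. p - aug_map F v \<in> I" by blast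
  qed (auto simp: aug_map_def)
  have 0: "{v \<in> free_mod F 0. aug_map F v \<in> I} = bdry_map F 0 ` free_mod F 1 \<longleftrightarrow>
      (\<forall>w. cycle F I 0 w \<longleftrightarrow> boundary F 0 w)"
    using restricted_exactness[of "cycle F I 0" F 0, OF cycle_restrict]
    by (simp add: cycle_def aug_map_def)
  have "bdry_map F i v = 0 \<longleftrightarrow> cycle F I (Suc i) v" for i v
    by (auto simp: bdry_map_def cycle_def fun_eq_iff)
  then have Suc: "{v \<in> free_mod F (Suc i). bdry_map F i v = 0}
        = bdry_map F (Suc i) ` free_mod F (Suc (Suc i)) \<longleftrightarrow>
      (\<forall>w. cycle F I (Suc i) w \<longleftrightarrow> boundary F (Suc i) w)" for i
    using restricted_exactness[of "cycle F I (Suc i)" F "Suc i", OF cycle_restrict] by simp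
  have "(\<forall>i. E i) \<longleftrightarrow> E 0 \<and> (\<forall>i. E (Suc i))" for E :: "nat \<Rightarrow> bool"
    by (metis not0_implies_Suc)
  from this[of "\<lambda>i. \<forall>w. cycle F I i w \<longleftrightarrow> boundary F i w"] show ?thesis
    unfolding graded_free_resolution_def surj 0 Suc by (simp only:)
qed

lemma resolutionD:
  assumes "graded_free_resolution F I"
  shows resolution_finite: "finite (basis F i)"
    and resolution_aug_homogeneous: "k \<in> basis F 0 \<Longrightarrow> homogeneous (twist F 0 k) (aug F k)"
    and resolution_bdry_homogeneous: "k \<in> basis F i \<Longrightarrow> l \<in> basis F (Suc i) \<Longrightarrow>
        homogeneous (twist F (Suc i) l - twist F i k) (bdry F i k l)"
    and resolution_surj: "\<exists>v. p - (\<Sum>k\<in>basis F 0. aug F k * v k) \<in> I"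
    and resolution_exact: "cycle F I i w \<longleftrightarrow> boundary F i w"
  using assms by (auto simp: graded_free_resolution_iff)

lemma bdry_column_boundary:
  assumes "finite (basis F (Suc i))" "l \<in> basis F (Suc i)"
  shows "boundary F i (\<lambda>k. bdry F i k l)"
  unfolding boundary_def using assms
  by (intro exI[of _ "\<lambda>m. if m = l then 1 else 0"]) (simp add: if_distrib cong: if_cong)

lemma resolution_bdry_bdry:
  assumes "graded_free_resolution F I" "k \<in> basis F i" "l \<in> basis F (Suc (Suc i))"
  shows "(\<Sum>m\<in>basis F (Suc i). bdry F i k m * bdry F (Suc i) m l) = 0"
proof -
  have "cycle F I (Suc i) (\<lambda>k. bdry F (Suc i) k l)"
    using assms bdry_column_boundary resolution_exact resolution_finite by blast
  with assms(2) show ?thesis by (simp add: cycle_def)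
qed

lemma resolution_aug_bdry:
  assumes "graded_free_resolution F I" "l \<in> basis F (Suc 0)"
  shows "(\<Sum>m\<in>basis F 0. aug F m * bdry F 0 m l) \<in> I"
proof -
  have "cycle F I 0 (\<lambda>k. bdry F 0 k l)"
    using assms bdry_column_boundary resolution_exact resolution_finite by blast
  then show ?thesis by (simp add: cycle_def)
qed

text \<open>Graded linear systems with homogeneous right hand side have homogeneous solutions: keep in
  each unknown only the component of the right degree.\<close>

lemma homogeneous_solution:
  fixes M :: "nat \<Rightarrow> ('v::finite, 'k::comm_ring_1) poly_ring"
  assumes M: "\<And>m. m \<in> B \<Longrightarrow> homogeneous (b m - a) (M m)"
    and w: "homogeneous (t - a) w" and eq: "w = (\<Sum>m\<in>B. M m * v m)"
  shows "w = (\<Sum>m\<in>B. M m * hom_part (t - b m) (v m))"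
proof -
  have "w = hom_part (t - a) w" using w by (simp add: hom_part_homogeneous)
  also have "\<dots> = (\<Sum>m\<in>B. hom_part (t - a) (M m * v m))" by (simp add: eq hom_part_sum)
  also have "\<dots> = (\<Sum>m\<in>B. M m * hom_part (t - b m) (v m))"
  proof (rule sum.cong[OF refl])
    fix m assume "m \<in> B"
    from hom_part_mult[OF M[OF this], of "t - b m" "v m"]
    show "hom_part (t - a) (M m * v m) = M m * hom_part (t - b m) (v m)" by simp
  qed
  finally show ?thesis .
qed

lemma lift_homogeneous_cycle:
  fixes F :: "('v::finite, 'k::comm_ring_1) free_complex"
  assumes F: "graded_free_resolution F I"
    and w: "\<And>k. k \<in> basis F i \<Longrightarrow> homogeneous (t - twist F i k) (w k)"
    and "cycle F I i w"
  shows "\<exists>v. (\<forall>m\<in>basis F (Suc i). homogeneous (t - twist F (Suc i) m) (v m)) \<and>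
     (\<forall>k\<in>basis F i. w k = (\<Sum>m\<in>basis F (Suc i). bdry F i k m * v m))"
proof -
  obtain v where v: "\<forall>k\<in>basis F i. w k = (\<Sum>m\<in>basis F (Suc i). bdry F i k m * v m)"
    using assms(3) resolution_exact[OF F] by (auto simp: boundary_def)
  have "w k = (\<Sum>m\<in>basis F (Suc i). bdry F i k m * hom_part (t - twist F (Suc i) m) (v m))"
    if k: "k \<in> basis F i" for k
    using resolution_bdry_homogeneous[OF F k] w[OF k] v k
    by (intro homogeneous_solution[where a = "twist F i k"]) auto
  then show ?thesis
    by (intro exI[of _ "\<lambda>m. hom_part (t - twist F (Suc i) m) (v m)"]) simp
qed

lemma lift_homogeneous_cycles:
  fixes F :: "('v::finite, 'k::comm_ring_1) free_complex"
  assumes F: "graded_free_resolution F I"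
    and w: "\<And>k l. k \<in> basis F i \<Longrightarrow> l \<in> X \<Longrightarrow> homogeneous (t l - twist F i k) (w k l)"
    and cyc: "\<And>l. l \<in> X \<Longrightarrow> cycle F I i (\<lambda>k. w k l)"
  shows "\<exists>h. (\<forall>m\<in>basis F (Suc i). \<forall>l\<in>X. homogeneous (t l - twist F (Suc i) m) (h m l)) \<and>
     (\<forall>k\<in>basis F i. \<forall>l\<in>X. (\<Sum>m\<in>basis F (Suc i). bdry F i k m * h m l) = w k l)"
proof -
  have "\<forall>l\<in>X. \<exists>v. (\<forall>m\<in>basis F (Suc i). homogeneous (t l - twist F (Suc i) m) (v m)) \<and>
     (\<forall>k\<in>basis F i. w k l = (\<Sum>m\<in>basis F (Suc i). bdry F i k m * v m))"
    using lift_homogeneous_cycle[OF F w cyc] by blast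
  then obtain v where "\<forall>l\<in>X. (\<forall>m\<in>basis F (Suc i). homogeneous (t l - twist F (Suc i) m) (v l m)) \<and>
     (\<forall>k\<in>basis F i. w k l = (\<Sum>m\<in>basis F (Suc i). bdry F i k m * v l m))"
    by (auto simp: bchoice_iff)
  then show ?thesis by (intro exI[of _ "\<lambda>m l. v l m"]) auto
qed

lemma sum_mult_assoc:
  fixes f :: "nat \<Rightarrow> 'a::comm_ring_1"
  shows "(\<Sum>m\<in>B. f m * (\<Sum>j\<in>X. g m j * d j)) = (\<Sum>j\<in>X. (\<Sum>m\<in>B. f m * g m j) * d j)"
  unfolding sum_distrib_left sum_distrib_right
  by (subst sum.swap) (simp add: mult.assoc)

lemma sum_delta_left:
  fixes f :: "nat \<Rightarrow> 'a::comm_ring_1"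
  assumes "finite A" "k \<in> A"
  shows "(\<Sum>l\<in>A. (if k = l then 1 else 0) * f l) = f k"
proof -
  have "(\<Sum>l\<in>A. (if k = l then 1 else 0) * f l) = (\<Sum>l\<in>A. if k = l then f l else 0)"
    by (rule sum.cong) auto
  with assms show ?thesis by simp
qed

lemma sum_delta_right:
  fixes f :: "nat \<Rightarrow> 'a::comm_ring_1"
  assumes "finite A" "l \<in> A"
  shows "(\<Sum>m\<in>A. f m * (if m = l then 1 else 0)) = f l"
  using sum_delta_left[OF assms, of f] by (simp add: mult.commute eq_commute)

text \<open>The one inductive construction behind both chain maps and homotopies. Given are modules with
  bases \<open>X i\<close> and maps \<open>\<delta>\<close> forming a complex, and maps \<open>\<theta> i\<close> from it into the resolution. The maps
  \<open>h i\<close> raise the position by one and satisfy \<open>d h\<^sub>0 = \<theta>\<^sub>0\<close> and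
  \<open>d h\<^sub>i\<^sub>+\<^sub>1 = \<theta>\<^sub>i\<^sub>+\<^sub>1 + s h\<^sub>i \<delta>\<^sub>i\<close>. Each right hand side is a cycle by the commutation hypothesis, hence a
  boundary. With \<open>s = -1\<close> this contracts a chain map \<open>\<theta>\<close> that induces zero; with \<open>s = 1\<close>, \<open>\<theta>\<^sub>i = 0\<close> for \<open>i > 0\<close> and the
  source complex shifted by one, it extends a map given in position \<open>0\<close> to a chain map.\<close>

lemma exact_lift:
  fixes F :: "('v::finite, 'k::comm_ring_1) free_complex"
    and \<delta> \<theta> :: "nat \<Rightarrow> nat \<Rightarrow> nat \<Rightarrow> ('v, 'k) poly_ring"
  assumes F: "graded_free_resolution F I"
    and \<theta>: "\<And>i k l. k \<in> basis F i \<Longrightarrow> l \<in> X i \<Longrightarrow> homogeneous (t i l - twist F i k) (\<theta> i k l)"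
    and \<delta>: "\<And>i k l. k \<in> X i \<Longrightarrow> l \<in> X (Suc i) \<Longrightarrow> homogeneous (t (Suc i) l - t i k) (\<delta> i k l)"
    and s: "homogeneous 0 s"
    and start: "\<And>l. l \<in> X 0 \<Longrightarrow> (\<Sum>k\<in>basis F 0. aug F k * \<theta> 0 k l) \<in> I"
    and comm: "\<And>i k l. k \<in> basis F i \<Longrightarrow> l \<in> X (Suc i) \<Longrightarrow>
       (\<Sum>m\<in>basis F (Suc i). bdry F i k m * \<theta> (Suc i) m l) + s * (\<Sum>j\<in>X i. \<theta> i k j * \<delta> i j l) = 0"
    and \<delta>\<delta>: "\<And>i k l. k \<in> X i \<Longrightarrow> l \<in> X (Suc (Suc i)) \<Longrightarrow>
       (\<Sum>m\<in>X (Suc i). \<delta> i k m * \<delta> (Suc i) m l) = 0"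
  shows "\<exists>h. (\<forall>i. \<forall>k\<in>basis F (Suc i). \<forall>l\<in>X i. homogeneous (t i l - twist F (Suc i) k) (h i k l)) \<and>
     (\<forall>k\<in>basis F 0. \<forall>l\<in>X 0. (\<Sum>m\<in>basis F (Suc 0). bdry F 0 k m * h 0 m l) = \<theta> 0 k l) \<and>
     (\<forall>i. \<forall>k\<in>basis F (Suc i). \<forall>l\<in>X (Suc i).
        (\<Sum>m\<in>basis F (Suc (Suc i)). bdry F (Suc i) k m * h (Suc i) m l)
          = \<theta> (Suc i) k l + s * (\<Sum>j\<in>X i. h i k j * \<delta> i j l))"
proof -
  define hom where "hom i h \<longleftrightarrow> (\<forall>k\<in>basis F (Suc i). \<forall>l\<in>X i.
      homogeneous (t i l - twist F (Suc i) k) (h k l))"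
    for i and h :: "nat \<Rightarrow> nat \<Rightarrow> ('v, 'k) poly_ring"
  define rhs where "rhs i h k l = \<theta> (Suc i) k l + s * (\<Sum>j\<in>X i. h k j * \<delta> i j l)" for i h k l
  define P where "P i h \<longleftrightarrow> hom i h \<and> (\<forall>l\<in>X (Suc i). cycle F I (Suc i) (\<lambda>k. rhs i h k l)) \<and>
      (i = 0 \<longrightarrow> (\<forall>k\<in>basis F 0. \<forall>l\<in>X 0. (\<Sum>m\<in>basis F (Suc 0). bdry F 0 k m * h m l) = \<theta> 0 k l))"
    for i h
  define Q where "Q i h h' \<longleftrightarrow> (\<forall>k\<in>basis F (Suc i). \<forall>l\<in>X (Suc i).
      (\<Sum>m\<in>basis F (Suc (Suc i)). bdry F (Suc i) k m * h' m l) = rhs i h k l)" for i h h'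
  have hom_rhs: "homogeneous (t (Suc i) l - twist F (Suc i) k) (rhs i h k l)"
    if "hom i h" "k \<in> basis F (Suc i)" "l \<in> X (Suc i)" for i h k l
  proof -
    have "homogeneous (t (Suc i) l - twist F (Suc i) k) (h k j * \<delta> i j l)" if "j \<in> X i" for j
      using homogeneous_mult[of "t i j - twist F (Suc i) k" "h k j" "t (Suc i) l - t i j" "\<delta> i j l"]
        \<delta>[OF that \<open>l \<in> X (Suc i)\<close>] \<open>hom i h\<close> that \<open>k \<in> basis F (Suc i)\<close>
      by (simp add: hom_def)
    then have "homogeneous (t (Suc i) l - twist F (Suc i) k) (\<Sum>j\<in>X i. h k j * \<delta> i j l)"
      by (rule homogeneous_sum)
    from homogeneous_mult[OF s this] show ?thesis
      unfolding rhs_def using \<theta> that by (simp add: homogeneous_add)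
  qed
  have bdry_rhs: "(\<Sum>m\<in>basis F (Suc i). bdry F i k m * rhs i h m l)
       = (\<Sum>m\<in>basis F (Suc i). bdry F i k m * \<theta> (Suc i) m l) + s * (\<Sum>j\<in>X i. \<alpha> j * \<delta> i j l)"
    if "\<And>j. j \<in> X i \<Longrightarrow> (\<Sum>m\<in>basis F (Suc i). bdry F i k m * h m j) = \<alpha> j" for i h k l \<alpha>
  proof -
    have "(\<Sum>m\<in>basis F (Suc i). bdry F i k m * rhs i h m l)
       = (\<Sum>m\<in>basis F (Suc i). bdry F i k m * \<theta> (Suc i) m l)
         + s * (\<Sum>m\<in>basis F (Suc i). bdry F i k m * (\<Sum>j\<in>X i. h m j * \<delta> i j l))"
      by (simp add: rhs_def distrib_left sum.distrib sum_distrib_left mult.left_commute)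
    also have "(\<Sum>m\<in>basis F (Suc i). bdry F i k m * (\<Sum>j\<in>X i. h m j * \<delta> i j l))
       = (\<Sum>j\<in>X i. \<alpha> j * \<delta> i j l)"
      unfolding sum_mult_assoc using that by simp
    finally show ?thesis .
  qed
  have "\<exists>h. \<forall>i. P i (h i) \<and> Q i (h i) (h (Suc i))"
  proof (rule dependent_nat_choice)
    have "\<exists>h. hom 0 h \<and>
        (\<forall>k\<in>basis F 0. \<forall>l\<in>X 0. (\<Sum>m\<in>basis F (Suc 0). bdry F 0 k m * h m l) = \<theta> 0 k l)"
      unfolding hom_def
      by (rule lift_homogeneous_cycles[OF F \<theta>]) (auto simp: cycle_def start)
    then obtain h where h: "hom 0 h"
      "\<And>k l. k\<in>basis F 0 \<Longrightarrow> l\<in>X 0 \<Longrightarrow> (\<Sum>m\<in>basis F (Suc 0). bdry F 0 k m * h m l) = \<theta> 0 k l"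
      by blast
    have "cycle F I (Suc 0) (\<lambda>k. rhs 0 h k l)" if "l \<in> X (Suc 0)" for l
      using bdry_rhs[OF h(2)] comm that by (simp add: cycle_def)
    with h show "\<exists>h. P 0 h" by (auto simp: P_def)
  next
    fix h i assume "P i h"
    then have h: "hom i h" "\<And>l. l\<in>X (Suc i) \<Longrightarrow> cycle F I (Suc i) (\<lambda>k. rhs i h k l)"
      by (auto simp: P_def)
    have "\<exists>h'. hom (Suc i) h' \<and> Q i h h'"
      unfolding hom_def[of "Suc i"] Q_def
      by (rule lift_homogeneous_cycles[OF F hom_rhs[OF h(1)] h(2)])
    then obtain h' where h': "hom (Suc i) h'" "Q i h h'" by blast
    \<comment> \<open>The invariant for the next step: the new right hand side is again a cycle, since the
      terms with two consecutive \<open>\<delta>\<close> vanish.\<close>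
    have "cycle F I (Suc (Suc i)) (\<lambda>k. rhs (Suc i) h' k l)" if l: "l \<in> X (Suc (Suc i))" for l
    proof -
      have "(\<Sum>m\<in>basis F (Suc (Suc i)). bdry F (Suc i) k m * rhs (Suc i) h' m l) = 0"
        if k: "k \<in> basis F (Suc i)" for k
      proof -
        have "(\<Sum>j\<in>X (Suc i). (\<Sum>m\<in>X i. h k m * \<delta> i m j) * \<delta> (Suc i) j l)
            = (\<Sum>m\<in>X i. h k m * (\<Sum>j\<in>X (Suc i). \<delta> i m j * \<delta> (Suc i) j l))"
          by (rule sum_mult_assoc[symmetric])
        also have "\<dots> = 0" using \<delta>\<delta> l by simp
        finally have "(\<Sum>j\<in>X (Suc i). rhs i h k j * \<delta> (Suc i) j l)
            = (\<Sum>j\<in>X (Suc i). \<theta> (Suc i) k j * \<delta> (Suc i) j l)"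
          by (simp add: rhs_def distrib_right sum.distrib mult.assoc flip: sum_distrib_left)
        then show ?thesis
          using bdry_rhs[of "Suc i" k h' "rhs i h k" l] h'(2) k comm[OF k l] by (simp add: Q_def)
      qed
      then show ?thesis by (simp add: cycle_def)
    qed
    with h' show "\<exists>h'. P (Suc i) h' \<and> Q i h h'" by (auto simp: P_def)
  qed
  then obtain h where "\<And>i. P i (h i)" "\<And>i. Q i (h i) (h (Suc i))" by blast
  then show ?thesis by (intro exI[of _ h]) (auto simp: P_def Q_def hom_def rhs_def)
qed

section \<open>Chain maps and the independence of Tor from the resolution\<close>

definition graded_ideal :: "('v, 'k::comm_ring_1) poly_ring set \<Rightarrow> bool" where
  "graded_ideal I \<longleftrightarrow> 0 \<in> I \<and> (\<forall>p\<in>I. \<forall>q\<in>I. p + q \<in> I) \<and> (\<forall>p\<in>I. \<forall>q. q * p \<in> I) \<and>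
     (\<forall>p\<in>I. \<forall>a. hom_part a p \<in> I)"

lemma graded_idealD:
  assumes "graded_ideal I"
  shows "0 \<in> I" "p \<in> I \<Longrightarrow> q \<in> I \<Longrightarrow> p + q \<in> I" "p \<in> I \<Longrightarrow> r * p \<in> I" "p \<in> I \<Longrightarrow> hom_part a p \<in> I"
    "p \<in> I \<Longrightarrow> - p \<in> I" "p \<in> I \<Longrightarrow> q \<in> I \<Longrightarrow> p - q \<in> I" "p \<in> I \<Longrightarrow> p * r \<in> I"
    "(\<And>x. x \<in> A \<Longrightarrow> f x \<in> I) \<Longrightarrow> sum f A \<in> I"
proof -
  show 0: "0 \<in> I" and add: "p \<in> I \<Longrightarrow> q \<in> I \<Longrightarrow> p + q \<in> I" and m: "p \<in> I \<Longrightarrow> r * p \<in> I"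
    and "p \<in> I \<Longrightarrow> hom_part a p \<in> I" for p q r
    using assms by (auto simp: graded_ideal_def)
  show neg: "p \<in> I \<Longrightarrow> - p \<in> I" for p using m[of p "-1"] by simp
  show "p \<in> I \<Longrightarrow> q \<in> I \<Longrightarrow> p - q \<in> I" using add[of p "- q"] neg[of q] by simp
  show "p \<in> I \<Longrightarrow> p * r \<in> I" using m[of p r] by (simp add: mult.commute)
  show "(\<And>x. x \<in> A \<Longrightarrow> f x \<in> I) \<Longrightarrow> sum f A \<in> I"
    by (induction A rule: infinite_finite_induct) (auto simp: 0 add)
qed

lemma graded_ideal_sum_mult:
  "graded_ideal I \<Longrightarrow> (\<And>m. m \<in> A \<Longrightarrow> f m \<in> I) \<Longrightarrow> (\<Sum>m\<in>A. f m * d m) \<in> I"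
  by (rule graded_idealD(8)) (auto intro: graded_idealD(7))

text \<open>\<open>\<phi>\<close> is a chain map \<open>P \<rightarrow> F\<close> of degree \<open>e\<close> that lifts multiplication by \<open>g\<close> on the modules
  resolved by \<open>P\<close> and \<open>F\<close>, the latter being \<open>R/J\<close>.\<close>

definition chain_map ::
  "('v, 'k::comm_ring_1) free_complex \<Rightarrow> ('v, 'k) free_complex \<Rightarrow> ('v, 'k) poly_ring set \<Rightarrow>
     ('v, 'k) poly_ring \<Rightarrow> int \<Rightarrow> (nat \<Rightarrow> nat \<Rightarrow> nat \<Rightarrow> ('v, 'k) poly_ring) \<Rightarrow> bool" where
  "chain_map P F J g e \<phi> \<longleftrightarrow>
     (\<forall>i. \<forall>k\<in>basis F i. \<forall>l\<in>basis P i. homogeneous (twist P i l + e - twist F i k) (\<phi> i k l)) \<and>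
     (\<forall>l\<in>basis P 0. g * aug P l - (\<Sum>k\<in>basis F 0. aug F k * \<phi> 0 k l) \<in> J) \<and>
     (\<forall>i. \<forall>k\<in>basis F i. \<forall>l\<in>basis P (Suc i).
        (\<Sum>m\<in>basis F (Suc i). bdry F i k m * \<phi> (Suc i) m l)
          = (\<Sum>m\<in>basis P i. \<phi> i k m * bdry P i m l))"

text \<open>Multiplication by \<open>g\<close> is lifted in position \<open>0\<close> by surjectivity of the augmentation of \<open>F\<close>,
  and from there by \<open>exact_lift\<close>. The hypothesis on \<open>Q\<close> says that \<open>g\<close> induces a map \<open>R/Q \<rightarrow> R/J\<close>.\<close>

lemma chain_map_exists:
  fixes F P :: "('v::finite, 'k::comm_ring_1) free_complex"
  assumes F: "graded_free_resolution F J" and P: "graded_free_resolution P Q"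
    and J: "graded_ideal J" and g: "homogeneous e g" and gQ: "\<And>q. q \<in> Q \<Longrightarrow> g * q \<in> J"
  shows "\<exists>\<phi>. chain_map P F J g e \<phi>"
proof -
  have "\<exists>v. (\<forall>k\<in>basis F 0. homogeneous (twist P 0 l + e - twist F 0 k) (v k)) \<and>
      g * aug P l - (\<Sum>k\<in>basis F 0. aug F k * v k) \<in> J" if l: "l \<in> basis P 0" for l
  proof -
    let ?t = "twist P 0 l + e"
    obtain v where v: "g * aug P l - (\<Sum>k\<in>basis F 0. aug F k * v k) \<in> J"
      using resolution_surj[OF F] by blast
    have g_hom: "homogeneous ?t (g * aug P l)"
      using homogeneous_mult[OF g resolution_aug_homogeneous[OF P l]] by (simp add: add.commute)
    have "hom_part ?t (g * aug P l - (\<Sum>k\<in>basis F 0. aug F k * v k))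
        = g * aug P l - (\<Sum>k\<in>basis F 0. aug F k * hom_part (?t - twist F 0 k) (v k))"
      unfolding hom_part_diff hom_part_sum hom_part_homogeneous[OF g_hom]
    proof (intro arg_cong2[where f = "(-)"] sum.cong refl)
      fix k assume "k \<in> basis F 0"
      from hom_part_mult[OF resolution_aug_homogeneous[OF F this], of "?t - twist F 0 k" "v k"]
      show "hom_part ?t (aug F k * v k) = aug F k * hom_part (?t - twist F 0 k) (v k)" by simp
    qed
    then have "g * aug P l - (\<Sum>k\<in>basis F 0. aug F k * hom_part (?t - twist F 0 k) (v k)) \<in> J"
      using graded_idealD(4)[OF J v, of ?t] by simp
    then show ?thesis
      by (intro exI[of _ "\<lambda>k. hom_part (?t - twist F 0 k) (v k)"]) simp
  qed
  then have "\<forall>l\<in>basis P 0. \<exists>v. (\<forall>k\<in>basis F 0. homogeneous (twist P 0 l + e - twist F 0 k) (v k)) \<and>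
      g * aug P l - (\<Sum>k\<in>basis F 0. aug F k * v k) \<in> J" by blast
  then obtain v where v: "\<forall>l\<in>basis P 0. (\<forall>k\<in>basis F 0. homogeneous (twist P 0 l + e - twist F 0 k) (v l k)) \<and>
      g * aug P l - (\<Sum>k\<in>basis F 0. aug F k * v l k) \<in> J"
    by (auto simp: bchoice_iff)
  define \<phi>0 where "\<phi>0 k l = v l k" for k l
  have \<phi>0: "homogeneous (twist P 0 l + e - twist F 0 k) (\<phi>0 k l)"
    if "l \<in> basis P 0" "k \<in> basis F 0" for k l using v that by (simp add: \<phi>0_def)
  have aug_\<phi>0: "g * aug P l - (\<Sum>k\<in>basis F 0. aug F k * \<phi>0 k l) \<in> J" if "l \<in> basis P 0" for l
    using v that by (simp add: \<phi>0_def)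
  let ?X = "\<lambda>i. basis P (Suc i)" and ?t = "\<lambda>i l. twist P (Suc i) l + e" and ?\<delta> = "\<lambda>i. bdry P (Suc i)"
  define \<theta> where "\<theta> i k l = (if i = 0 then \<Sum>m\<in>basis P 0. \<phi>0 k m * bdry P 0 m l else 0)"
    for i :: nat and k l
  have "\<exists>h. (\<forall>i. \<forall>k\<in>basis F (Suc i). \<forall>l\<in>?X i. homogeneous (?t i l - twist F (Suc i) k) (h i k l)) \<and>
     (\<forall>k\<in>basis F 0. \<forall>l\<in>?X 0. (\<Sum>m\<in>basis F (Suc 0). bdry F 0 k m * h 0 m l) = \<theta> 0 k l) \<and>
     (\<forall>i. \<forall>k\<in>basis F (Suc i). \<forall>l\<in>?X (Suc i).
        (\<Sum>m\<in>basis F (Suc (Suc i)). bdry F (Suc i) k m * h (Suc i) m l)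
          = \<theta> (Suc i) k l + 1 * (\<Sum>j\<in>?X i. h i k j * ?\<delta> i j l))"
  proof (rule exact_lift[OF F])
    fix i k l assume kl: "k \<in> basis F i" "l \<in> ?X i"
    show "homogeneous (?t i l - twist F i k) (\<theta> i k l)"
    proof (cases "i = 0")
      case True
      have "homogeneous (?t 0 l - twist F 0 k) (\<phi>0 k m * bdry P 0 m l)" if m: "m \<in> basis P 0" for m
        using homogeneous_mult[OF \<phi>0[OF m, of k] resolution_bdry_homogeneous[OF P m, of l]] kl True
        by (simp add: algebra_simps)
      then show ?thesis using True by (simp add: \<theta>_def homogeneous_sum)
    qed (simp add: \<theta>_def)
  next
    fix i k l assume "k \<in> ?X i" "l \<in> ?X (Suc i)"
    then show "homogeneous (?t (Suc i) l - ?t i k) (?\<delta> i k l)"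
      using resolution_bdry_homogeneous[OF P] by simp
  next
    fix l assume l: "l \<in> ?X 0"
    have "(\<Sum>k\<in>basis F 0. aug F k * \<theta> 0 k l)
        = (\<Sum>m\<in>basis P 0. (\<Sum>k\<in>basis F 0. aug F k * \<phi>0 k m) * bdry P 0 m l)"
      by (simp add: \<theta>_def sum_mult_assoc)
    also have "\<dots> = g * (\<Sum>m\<in>basis P 0. aug P m * bdry P 0 m l)
        - (\<Sum>m\<in>basis P 0. (g * aug P m - (\<Sum>k\<in>basis F 0. aug F k * \<phi>0 k m)) * bdry P 0 m l)"
      by (simp add: left_diff_distrib sum_subtractf sum_distrib_left mult.assoc)
    also have "\<dots> \<in> J"
      by (rule graded_idealD(6)[OF J gQ[OF resolution_aug_bdry[OF P l]]
            graded_ideal_sum_mult[OF J aug_\<phi>0]])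
    finally show "(\<Sum>k\<in>basis F 0. aug F k * \<theta> 0 k l) \<in> J" .
  next
    fix i k l assume kl: "k \<in> basis F i" "l \<in> ?X (Suc i)"
    have "(\<Sum>j\<in>basis P (Suc 0). (\<Sum>m\<in>basis P 0. \<phi>0 k m * bdry P 0 m j) * bdry P (Suc 0) j l) = 0"
      if "i = 0"
      unfolding sum_mult_assoc[symmetric]
      using resolution_bdry_bdry[OF P] kl that by (intro sum.neutral) simp
    then show "(\<Sum>m\<in>basis F (Suc i). bdry F i k m * \<theta> (Suc i) m l)
        + 1 * (\<Sum>j\<in>?X i. \<theta> i k j * ?\<delta> i j l) = 0"
      by (cases "i = 0") (simp_all add: \<theta>_def)
  qed (use resolution_bdry_bdry[OF P] in auto)
  then obtain h where
    h: "\<And>i k l. k\<in>basis F (Suc i) \<Longrightarrow> l\<in>?X i \<Longrightarrow> homogeneous (?t i l - twist F (Suc i) k) (h i k l)"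
    and h0: "\<And>k l. k\<in>basis F 0 \<Longrightarrow> l\<in>?X 0 \<Longrightarrow> (\<Sum>m\<in>basis F (Suc 0). bdry F 0 k m * h 0 m l) = \<theta> 0 k l"
    and hS: "\<And>i k l. k\<in>basis F (Suc i) \<Longrightarrow> l\<in>?X (Suc i) \<Longrightarrow>
        (\<Sum>m\<in>basis F (Suc (Suc i)). bdry F (Suc i) k m * h (Suc i) m l)
          = \<theta> (Suc i) k l + 1 * (\<Sum>j\<in>?X i. h i k j * ?\<delta> i j l)"
    by blast
  define \<phi> where "\<phi> i = (case i of 0 \<Rightarrow> \<phi>0 | Suc i \<Rightarrow> h i)" for i
  have "chain_map P F J g e \<phi>"
    unfolding chain_map_def
  proof (intro conjI allI ballI)
    fix i k l assume "k \<in> basis F i" "l \<in> basis P i"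
    then show "homogeneous (twist P i l + e - twist F i k) (\<phi> i k l)"
      using \<phi>0 h by (auto simp: \<phi>_def split: nat.split)
  next
    fix l assume "l \<in> basis P 0"
    then show "g * aug P l - (\<Sum>k\<in>basis F 0. aug F k * \<phi> 0 k l) \<in> J"
      using aug_\<phi>0 by (simp add: \<phi>_def)
  next
    fix i k l assume "k \<in> basis F i" "l \<in> basis P (Suc i)"
    then show "(\<Sum>m\<in>basis F (Suc i). bdry F i k m * \<phi> (Suc i) m l)
        = (\<Sum>m\<in>basis P i. \<phi> i k m * bdry P i m l)"
      using h0 hS by (cases i) (auto simp: \<phi>_def \<theta>_def)
  qed
  then show ?thesis by blast
qed

text \<open>The composite of the two chain maps minus the identity induces zero on \<open>R/I\<close>, so \<open>exact_lift\<close>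
  with \<open>s = -1\<close> contracts it.\<close>

lemma chain_map_homotopy:
  fixes F G :: "('v::finite, 'k::comm_ring_1) free_complex"
  assumes F: "graded_free_resolution F I" and G: "graded_free_resolution G I" and I: "graded_ideal I"
    and \<phi>: "chain_map F G I 1 0 \<phi>" and \<psi>: "chain_map G F I 1 0 \<psi>"
  shows "\<exists>h. (\<forall>i. \<forall>k\<in>basis F (Suc i). \<forall>l\<in>basis F i.
       homogeneous (twist F i l - twist F (Suc i) k) (h i k l)) \<and>
     (\<forall>k\<in>basis F 0. \<forall>l\<in>basis F 0. (\<Sum>m\<in>basis F (Suc 0). bdry F 0 k m * h 0 m l)
        = (\<Sum>m\<in>basis G 0. \<psi> 0 k m * \<phi> 0 m l) - (if k = l then 1 else 0)) \<and>
     (\<forall>i. \<forall>k\<in>basis F (Suc i). \<forall>l\<in>basis F (Suc i).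
        (\<Sum>m\<in>basis F (Suc (Suc i)). bdry F (Suc i) k m * h (Suc i) m l)
          = ((\<Sum>m\<in>basis G (Suc i). \<psi> (Suc i) k m * \<phi> (Suc i) m l) - (if k = l then 1 else 0))
            + (- 1) * (\<Sum>j\<in>basis F i. h i k j * bdry F i j l))"
proof (rule exact_lift[OF F, where \<theta> = "\<lambda>i k l. (\<Sum>m\<in>basis G i. \<psi> i k m * \<phi> i m l) - (if k = l then 1 else 0)"])
  note \<phi>_hom = \<phi>[unfolded chain_map_def, THEN conjunct1, rule_format]
  note \<psi>_hom = \<psi>[unfolded chain_map_def, THEN conjunct1, rule_format]
  note \<phi>_comm = \<phi>[unfolded chain_map_def, THEN conjunct2, THEN conjunct2, rule_format]
  note \<psi>_comm = \<psi>[unfolded chain_map_def, THEN conjunct2, THEN conjunct2, rule_format]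
  note \<phi>_aug = \<phi>[unfolded chain_map_def, THEN conjunct2, THEN conjunct1, rule_format]
  note \<psi>_aug = \<psi>[unfolded chain_map_def, THEN conjunct2, THEN conjunct1, rule_format]
  {
    fix i k l assume kl: "k \<in> basis F i" "l \<in> basis F i"
    have "homogeneous (twist F i l - twist F i k) (\<psi> i k m * \<phi> i m l)" if m: "m \<in> basis G i" for m
      using homogeneous_mult[OF \<psi>_hom[OF kl(1) m] \<phi>_hom[OF m kl(2)]] by simp
    moreover have "homogeneous (twist F i l - twist F i k) (if k = l then 1 else 0)" by simp
    ultimately show "homogeneous (twist F i l - twist F i k)
        ((\<Sum>m\<in>basis G i. \<psi> i k m * \<phi> i m l) - (if k = l then 1 else 0))"
      by (intro homogeneous_diff homogeneous_sum)
  next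
    show "homogeneous 0 (- 1 :: ('v, 'k) poly_ring)" by (intro homogeneous_uminus) simp
  next
    fix l assume l: "l \<in> basis F 0"
    have fin: "finite (basis F 0)" by (rule resolution_finite[OF F])
    have "(\<Sum>k\<in>basis F 0. aug F k * ((\<Sum>m\<in>basis G 0. \<psi> 0 k m * \<phi> 0 m l) - (if k = l then 1 else 0)))
        = (\<Sum>m\<in>basis G 0. (\<Sum>k\<in>basis F 0. aug F k * \<psi> 0 k m) * \<phi> 0 m l)
          - (\<Sum>k\<in>basis F 0. aug F k * (if k = l then 1 else 0))"
      unfolding right_diff_distrib sum_subtractf sum_mult_assoc ..
    also have "(\<Sum>k\<in>basis F 0. aug F k * (if k = l then 1 else 0)) = aug F l"
      by (rule sum_delta_right[OF fin l])
    also have "(\<Sum>m\<in>basis G 0. (\<Sum>k\<in>basis F 0. aug F k * \<psi> 0 k m) * \<phi> 0 m l) - aug F l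
        = - (\<Sum>m\<in>basis G 0. (1 * aug G m - (\<Sum>k\<in>basis F 0. aug F k * \<psi> 0 k m)) * \<phi> 0 m l)
          - (1 * aug F l - (\<Sum>m\<in>basis G 0. aug G m * \<phi> 0 m l))"
      by (simp add: left_diff_distrib sum_subtractf)
    also have "\<dots> \<in> I"
      by (rule graded_idealD(6)[OF I graded_idealD(5)[OF I graded_ideal_sum_mult[OF I \<psi>_aug]]
            \<phi>_aug[OF l]])
    finally show "(\<Sum>k\<in>basis F 0. aug F k * ((\<Sum>m\<in>basis G 0. \<psi> 0 k m * \<phi> 0 m l)
        - (if k = l then 1 else 0))) \<in> I" .
  next
    fix i k l assume kl: "k \<in> basis F i" "l \<in> basis F (Suc i)"
    have fin: "finite (basis F i)" "finite (basis F (Suc i))" by (rule resolution_finite[OF F])+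
    have "(\<Sum>m\<in>basis F (Suc i). bdry F i k m * (\<Sum>j\<in>basis G (Suc i). \<psi> (Suc i) m j * \<phi> (Suc i) j l))
        = (\<Sum>j\<in>basis G (Suc i). (\<Sum>m\<in>basis G i. \<psi> i k m * bdry G i m j) * \<phi> (Suc i) j l)"
      unfolding sum_mult_assoc using \<psi>_comm kl by simp
    also have "\<dots> = (\<Sum>m\<in>basis G i. \<psi> i k m * (\<Sum>j\<in>basis F i. \<phi> i m j * bdry F i j l))"
      unfolding sum_mult_assoc[symmetric] using \<phi>_comm kl by simp
    also have "\<dots> = (\<Sum>j\<in>basis F i. (\<Sum>m\<in>basis G i. \<psi> i k m * \<phi> i m j) * bdry F i j l)"
      by (rule sum_mult_assoc)
    finally have 1: "(\<Sum>m\<in>basis F (Suc i). bdry F i k m * (\<Sum>j\<in>basis G (Suc i). \<psi> (Suc i) m j * \<phi> (Suc i) j l))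
        = (\<Sum>j\<in>basis F i. (\<Sum>m\<in>basis G i. \<psi> i k m * \<phi> i m j) * bdry F i j l)" .
    have 2: "(\<Sum>m\<in>basis F (Suc i). bdry F i k m * (if m = l then 1 else 0)) = bdry F i k l"
      by (rule sum_delta_right[OF fin(2) kl(2)])
    have 3: "(\<Sum>j\<in>basis F i. (if k = j then 1 else 0) * bdry F i j l) = bdry F i k l"
      by (rule sum_delta_left[OF fin(1) kl(1)])
    show "(\<Sum>m\<in>basis F (Suc i). bdry F i k m * ((\<Sum>j\<in>basis G (Suc i). \<psi> (Suc i) m j * \<phi> (Suc i) j l)
          - (if m = l then 1 else 0)))
        + - 1 * (\<Sum>j\<in>basis F i. ((\<Sum>m\<in>basis G i. \<psi> i k m * \<phi> i m j) - (if k = j then 1 else 0))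
            * bdry F i j l) = 0"
      unfolding right_diff_distrib left_diff_distrib sum_subtractf 1 2 3 by simp
  }
qed (use F resolution_bdry_homogeneous resolution_bdry_bdry in blast)+

definition mat_app :: "nat set \<Rightarrow> nat set \<Rightarrow> (nat \<Rightarrow> nat \<Rightarrow> 'k::field) \<Rightarrow> (nat \<Rightarrow> 'k) \<Rightarrow> (nat \<Rightarrow> 'k)" where
  "mat_app A B M v = (\<lambda>k. if k \<in> A then \<Sum>l\<in>B. M k l * v l else 0)"

lemma coord_linear_mat_app: "coord_linear (mat_app A B M)"
  by (auto simp: coord_linear_def mat_app_def fun_eq_iff distrib_left sum.distrib sum_distrib_left
      mult.left_commute)

lemma tensor_bdry_mat_app:
  "tensor_bdry F i = mat_app (basis F i) (basis F (Suc i)) (\<lambda>k l. const_coeff (bdry F i k l))"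
  by (auto simp: tensor_bdry_def mat_app_def const_coeff_def fun_eq_iff)

lemma mat_app_degree:
  fixes M :: "nat \<Rightarrow> nat \<Rightarrow> ('v, 'k::field) poly_ring"
  assumes "v \<in> tensor_mod F i j"
    and "\<And>k l. k \<in> basis G h \<Longrightarrow> l \<in> basis F i \<Longrightarrow> homogeneous (twist F i l - twist G h k) (M k l)"
  shows "mat_app (basis G h) (basis F i) (\<lambda>k l. const_coeff (M k l)) v \<in> tensor_mod G h j"
proof -
  have "const_coeff (M k l) * v l = 0"
    if "k \<in> basis G h" "l \<in> basis F i" "twist G h k \<noteq> j" for k l
    using assms that const_coeff_homogeneous[OF assms(2)[OF that(1,2)]]
    by (cases "twist F i l = j") (auto simp: tensor_mod_def)
  then show ?thesis unfolding tensor_mod_def mat_app_def by (auto intro!: sum.neutral)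
qed

lemma sum_fun_apply: "(\<Sum>l\<in>A. f l) k = (\<Sum>l\<in>A. f l k)" for f :: "'a \<Rightarrow> 'b \<Rightarrow> 'c::comm_monoid_add"
  by (induction A rule: infinite_finite_induct) auto

lemma fin_space_tensor_mod:
  assumes "finite (basis F i)"
  shows "fin_space (tensor_mod F i j)"
proof -
  have "tensor_mod F i j \<subseteq> coord.span ((\<lambda>l k. if k = l then 1 else 0) ` basis F i)"
  proof
    fix v :: "nat \<Rightarrow> 'b" assume v: "v \<in> tensor_mod F i j"
    have "v = (\<Sum>l\<in>basis F i. coord_scale (v l) (\<lambda>k. if k = l then 1 else 0))"
    proof
      fix k
      have "(\<Sum>l\<in>basis F i. coord_scale (v l) (\<lambda>k. if k = l then 1 else 0)) k
          = (\<Sum>l\<in>basis F i. v l * (if k = l then 1 else 0))"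
        by (rule sum_fun_apply)
      also have "\<dots> = (\<Sum>l\<in>basis F i. if k = l then v l else 0)"
        by (rule sum.cong) auto
      also have "\<dots> = v k" using v assms by (auto simp: tensor_mod_def)
      finally show "v k = (\<Sum>l\<in>basis F i. coord_scale (v l) (\<lambda>k. if k = l then 1 else 0)) k" ..
    qed
    also have "\<dots> \<in> coord.span ((\<lambda>l k. if k = l then 1 else 0) ` basis F i)"
      by (intro coord.span_sum coord.span_scale coord.span_base) auto
    finally show "v \<in> coord.span ((\<lambda>l k. if k = l then 1 else 0) ` basis F i)" .
  qed
  moreover have "coord.subspace (tensor_mod F i j)"
    by (auto simp: coord_subspace_iff tensor_mod_def)
  ultimately show ?thesis using assms unfolding fin_space_def by blast
qed

lemma tensor_bdry_degree:
  fixes F :: "('v, 'k::field) free_complex"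
  assumes "graded_free_resolution F I" "v \<in> tensor_mod F (Suc i) j"
  shows "tensor_bdry F i v \<in> tensor_mod F i j"
  unfolding tensor_bdry_mat_app
  by (rule mat_app_degree[OF assms(2)]) (rule resolution_bdry_homogeneous[OF assms(1)])

lemma tensor_bdry_bdry:
  fixes F :: "('v, 'k::field) free_complex"
  assumes F: "graded_free_resolution F I"
  shows "tensor_bdry F i (tensor_bdry F (Suc i) v) = 0"
proof
  fix k
  have "(\<Sum>m\<in>basis F (Suc i). const_coeff (bdry F i k m) *
      (\<Sum>l\<in>basis F (Suc (Suc i)). const_coeff (bdry F (Suc i) m l) * v l)) = 0" if "k \<in> basis F i"
  proof -
    have "(\<Sum>m\<in>basis F (Suc i). const_coeff (bdry F i k m) * const_coeff (bdry F (Suc i) m l)) = 0"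
      if "l \<in> basis F (Suc (Suc i))" for l
      using resolution_bdry_bdry[OF F \<open>k \<in> basis F i\<close> that]
      by (metis (no_types, lifting) const_coeff_mult const_coeff_simps(1) const_coeff_sum sum.cong)
    then show ?thesis unfolding sum_mult_assoc by simp
  qed
  then show "tensor_bdry F i (tensor_bdry F (Suc i) v) k = 0 k"
    by (simp add: tensor_bdry_mat_app mat_app_def cong: sum.cong)
qed

lemma tor_spaces:
  fixes F :: "('v, 'k::field) free_complex"
  assumes F: "graded_free_resolution F I"
  shows fin_space_tor_cycles: "fin_space (tor_cycles F i j)"
    and fin_space_tor_boundaries: "fin_space (tor_boundaries F i j)"
    and tor_boundaries_subset: "tor_boundaries F i j \<subseteq> tor_cycles F i j"
proof -
  have lin: "coord_linear (tensor_bdry F i)" for i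
    unfolding tensor_bdry_mat_app by (rule coord_linear_mat_app)
  have tens: "fin_space (tensor_mod F i j)" for i
    by (rule fin_space_tensor_mod[OF resolution_finite[OF F]])
  then have sub: "coord.subspace (tensor_mod F i j)" for i by (simp add: fin_space_def)
  show "fin_space (tor_cycles F i j)"
  proof (rule fin_space_subset[OF tens])
    show "coord.subspace (tor_cycles F i j)"
      using sub[of i] lin coord_linear_0[OF lin]
      by (auto simp: tor_cycles_def coord_subspace_iff coord_linear_def zero_fun_def[symmetric] split: nat.split)
  qed (auto simp: tor_cycles_def)
  have boundaries: "tor_boundaries F i j \<subseteq> tensor_mod F i j"
    using tensor_bdry_degree[OF F] by (auto simp: tor_boundaries_def)
  interpret d: Vector_Spaces.linear coord_scale coord_scale "tensor_bdry F i"
    by (rule coord_linear_imp_linear[OF lin])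
  show "fin_space (tor_boundaries F i j)"
    unfolding tor_boundaries_def
    by (rule fin_space_subset[OF tens d.subspace_image[OF sub]])
      (use boundaries in \<open>simp add: tor_boundaries_def\<close>)
  show "tor_boundaries F i j \<subseteq> tor_cycles F i j"
    using boundaries tensor_bdry_bdry[OF F]
    by (auto simp: tor_boundaries_def tor_cycles_def split: nat.split)
qed

lemma tor_dim_eq:
  assumes "graded_free_resolution F I"
  shows "tor_dim F i j + vec_dim (tor_boundaries F i j) = vec_dim (tor_cycles F i j)"
  using vec_dim_mono[OF fin_space_tor_cycles[OF assms] fin_space_tor_boundaries[OF assms]
      tor_boundaries_subset[OF assms]]
  by (simp add: tor_dim_def)

text \<open>The map that a chain map induces on the complexes tensored with \<open>K\<close>.\<close>

definition tensor_chain :: "('v, 'k::field) free_complex \<Rightarrow> ('v, 'k) free_complex \<Rightarrow>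
    (nat \<Rightarrow> nat \<Rightarrow> nat \<Rightarrow> ('v, 'k) poly_ring) \<Rightarrow> nat \<Rightarrow> (nat \<Rightarrow> 'k) \<Rightarrow> (nat \<Rightarrow> 'k)" where
  "tensor_chain P F \<phi> i = mat_app (basis F i) (basis P i) (\<lambda>k l. const_coeff (\<phi> i k l))"

lemma coord_linear_tensor_chain: "coord_linear (tensor_chain P F \<phi> i)"
  by (simp add: tensor_chain_def coord_linear_mat_app)

lemma tensor_chain_degree:
  fixes F P :: "('v, 'k::field) free_complex"
  assumes "chain_map P F I 1 0 \<phi>" "v \<in> tensor_mod P i j"
  shows "tensor_chain P F \<phi> i v \<in> tensor_mod F i j"
  unfolding tensor_chain_def
  by (rule mat_app_degree[OF assms(2)]) (use assms(1) in \<open>auto simp: chain_map_def\<close>)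

lemma tensor_chain_bdry:
  fixes F P :: "('v, 'k::field) free_complex"
  assumes \<phi>: "chain_map P F I 1 0 \<phi>"
  shows "tensor_bdry F i (tensor_chain P F \<phi> (Suc i) v) = tensor_chain P F \<phi> i (tensor_bdry P i v)"
proof
  fix k
  show "tensor_bdry F i (tensor_chain P F \<phi> (Suc i) v) k = tensor_chain P F \<phi> i (tensor_bdry P i v) k"
  proof (cases "k \<in> basis F i")
    case True
    have "(\<Sum>m\<in>basis F (Suc i). const_coeff (bdry F i k m) * const_coeff (\<phi> (Suc i) m l))
        = (\<Sum>m\<in>basis P i. const_coeff (\<phi> i k m) * const_coeff (bdry P i m l))"
      if "l \<in> basis P (Suc i)" for l
    proof -
      have "const_coeff (\<Sum>m\<in>basis F (Suc i). bdry F i k m * \<phi> (Suc i) m l)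
          = const_coeff (\<Sum>m\<in>basis P i. \<phi> i k m * bdry P i m l)"
        using \<phi> True that by (simp add: chain_map_def)
      then show ?thesis by (simp add: const_coeff_sum const_coeff_mult)
    qed
    then have "(\<Sum>m\<in>basis F (Suc i). const_coeff (bdry F i k m) *
          (\<Sum>l\<in>basis P (Suc i). const_coeff (\<phi> (Suc i) m l) * v l))
        = (\<Sum>m\<in>basis P i. const_coeff (\<phi> i k m) * (\<Sum>l\<in>basis P (Suc i). const_coeff (bdry P i m l) * v l))"
      unfolding sum_mult_assoc by simp
    with True show ?thesis
      by (simp add: tensor_bdry_mat_app tensor_chain_def mat_app_def cong: sum.cong)
  qed (simp add: tensor_bdry_mat_app tensor_chain_def mat_app_def)
qed

lemma tensor_chain_cycles_boundaries:
  fixes F P :: "('v, 'k::field) free_complex"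
  assumes \<phi>: "chain_map P F I 1 0 \<phi>"
  shows "tensor_chain P F \<phi> i ` tor_cycles P i j \<subseteq> tor_cycles F i j"
    and "tensor_chain P F \<phi> i ` tor_boundaries P i j \<subseteq> tor_boundaries F i j"
proof -
  show "tensor_chain P F \<phi> i ` tor_cycles P i j \<subseteq> tor_cycles F i j"
    using tensor_chain_degree[OF \<phi>] tensor_chain_bdry[OF \<phi>]
    by (cases i) (auto simp: tor_cycles_def coord_linear_0[OF coord_linear_tensor_chain])
  show "tensor_chain P F \<phi> i ` tor_boundaries P i j \<subseteq> tor_boundaries F i j"
  proof
    fix x assume "x \<in> tensor_chain P F \<phi> i ` tor_boundaries P i j"
    then obtain v where v: "v \<in> tensor_mod P (Suc i) j" "x = tensor_chain P F \<phi> i (tensor_bdry P i v)"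
      by (auto simp: tor_boundaries_def)
    then have "x = tensor_bdry F i (tensor_chain P F \<phi> (Suc i) v)" by (simp add: tensor_chain_bdry[OF \<phi>])
    then show "x \<in> tor_boundaries F i j"
      using tensor_chain_degree[OF \<phi> v(1)] by (auto simp: tor_boundaries_def)
  qed
qed

text \<open>Tensored with \<open>K\<close>, the homotopy formula reads \<open>\<psi> \<phi> z - z = d h z + h d z\<close>, and the last term
  vanishes on cycles.\<close>

lemma tensor_chain_inverse:
  fixes F G :: "('v::finite, 'k::field) free_complex"
  assumes F: "graded_free_resolution F I" and G: "graded_free_resolution G I" and I: "graded_ideal I"
    and \<phi>: "chain_map F G I 1 0 \<phi>" and \<psi>: "chain_map G F I 1 0 \<psi>" and z: "z \<in> tor_cycles F i j"
  shows "tensor_chain G F \<psi> i (tensor_chain F G \<phi> i z) - z \<in> tor_boundaries F i j"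
proof -
  obtain h where hom: "\<And>i k l. k\<in>basis F (Suc i) \<Longrightarrow> l\<in>basis F i \<Longrightarrow>
       homogeneous (twist F i l - twist F (Suc i) k) (h i k l)"
    and h0: "\<And>k l. k\<in>basis F 0 \<Longrightarrow> l\<in>basis F 0 \<Longrightarrow>
       (\<Sum>m\<in>basis F (Suc 0). bdry F 0 k m * h 0 m l)
        = (\<Sum>m\<in>basis G 0. \<psi> 0 k m * \<phi> 0 m l) - (if k = l then 1 else 0)"
    and hS: "\<And>i k l. k\<in>basis F (Suc i) \<Longrightarrow> l\<in>basis F (Suc i) \<Longrightarrow>
        (\<Sum>m\<in>basis F (Suc (Suc i)). bdry F (Suc i) k m * h (Suc i) m l)
          = ((\<Sum>m\<in>basis G (Suc i). \<psi> (Suc i) k m * \<phi> (Suc i) m l) - (if k = l then 1 else 0))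
            + (- 1) * (\<Sum>j\<in>basis F i. h i k j * bdry F i j l)"
    using chain_map_homotopy[OF F G I \<phi> \<psi>] by blast
  have fin: "finite (basis F i)" by (rule resolution_finite[OF F])
  have z': "z \<in> tensor_mod F i j" using z by (simp add: tor_cycles_def)
  define y where "y = mat_app (basis F (Suc i)) (basis F i) (\<lambda>k l. const_coeff (h i k l)) z"
  have y: "y \<in> tensor_mod F (Suc i) j"
    unfolding y_def by (rule mat_app_degree[OF z' hom])
  have "tensor_chain G F \<psi> i (tensor_chain F G \<phi> i z) - z = tensor_bdry F i y"
  proof
    fix k
    show "(tensor_chain G F \<psi> i (tensor_chain F G \<phi> i z) - z) k = tensor_bdry F i y k"
    proof (cases "k \<in> basis F i")
      case k: True
      define e where "e l = (case i of 0 \<Rightarrow> 0 | Suc n \<Rightarrow>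
          (\<Sum>m\<in>basis F n. const_coeff (h n k m) * const_coeff (bdry F n m l)))" for l
      have entry: "(\<Sum>m\<in>basis F (Suc i). const_coeff (bdry F i k m) * const_coeff (h i m l))
          = (\<Sum>m\<in>basis G i. const_coeff (\<psi> i k m) * const_coeff (\<phi> i m l)) - (if k = l then 1 else 0) - e l"
        if l: "l \<in> basis F i" for l
      proof (cases i)
        case 0
        from arg_cong[OF h0[OF k[unfolded 0] l[unfolded 0]], of const_coeff] show ?thesis
          by (simp add: 0 e_def const_coeff_sum const_coeff_mult)
      next
        case (Suc n)
        from arg_cong[OF hS[OF k[unfolded Suc] l[unfolded Suc]], of const_coeff] show ?thesis
          by (simp add: Suc e_def const_coeff_sum const_coeff_mult)
      qed
      have e0: "(\<Sum>l\<in>basis F i. e l * z l) = 0"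
      proof (cases i)
        case (Suc n)
        have "(\<Sum>l\<in>basis F i. e l * z l)
            = (\<Sum>m\<in>basis F n. const_coeff (h n k m) * (\<Sum>l\<in>basis F i. const_coeff (bdry F n m l) * z l))"
          unfolding sum_mult_assoc by (simp add: e_def Suc)
        also have "\<dots> = (\<Sum>m\<in>basis F n. const_coeff (h n k m) * tensor_bdry F n z m)"
          by (simp add: tensor_bdry_mat_app mat_app_def Suc)
        also have "\<dots> = 0" using z by (simp add: tor_cycles_def Suc)
        finally show ?thesis .
      qed (simp add: e_def)
      have "tensor_bdry F i y k = (\<Sum>m\<in>basis F (Suc i). const_coeff (bdry F i k m) *
          (\<Sum>l\<in>basis F i. const_coeff (h i m l) * z l))"
        using k by (simp add: tensor_bdry_mat_app mat_app_def y_def cong: sum.cong)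
      also have "\<dots> = (\<Sum>l\<in>basis F i. ((\<Sum>m\<in>basis G i. const_coeff (\<psi> i k m) * const_coeff (\<phi> i m l))
          - (if k = l then 1 else 0) - e l) * z l)"
        unfolding sum_mult_assoc using entry by simp
      also have "\<dots> = (\<Sum>l\<in>basis F i. (\<Sum>m\<in>basis G i. const_coeff (\<psi> i k m) * const_coeff (\<phi> i m l)) * z l)
          - (\<Sum>l\<in>basis F i. (if k = l then 1 else 0) * z l) - (\<Sum>l\<in>basis F i. e l * z l)"
        by (simp only: left_diff_distrib sum_subtractf)
      also have "(\<Sum>l\<in>basis F i. (if k = l then 1 else 0) * z l) = z k"
        by (rule sum_delta_left[OF fin k])
      finally show ?thesis
        unfolding e0 sum_mult_assoc[symmetric]
        using k by (simp add: tensor_chain_def mat_app_def cong: sum.cong)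
    next
      case False
      then show ?thesis
        using z' by (simp add: tensor_chain_def tensor_bdry_mat_app mat_app_def tensor_mod_def)
    qed
  qed
  then show ?thesis using y by (auto simp: tor_boundaries_def)
qed

theorem tor_dim_unique:
  fixes F G :: "('v::finite, 'k::field) free_complex"
  assumes F: "graded_free_resolution F I" and G: "graded_free_resolution G I" and I: "graded_ideal I"
  shows "tor_dim F i j = tor_dim G i j"
proof -
  obtain \<phi> where \<phi>: "chain_map F G I 1 0 \<phi>"
    using chain_map_exists[OF G F I homogeneous_1] by auto
  obtain \<psi> where \<psi>: "chain_map G F I 1 0 \<psi>"
    using chain_map_exists[OF F G I homogeneous_1] by auto
  have "vec_dim (tor_cycles F i j) + vec_dim (tor_boundaries G i j)
      = vec_dim (tor_cycles G i j) + vec_dim (tor_boundaries F i j)"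
    by (rule vec_dim_quotient_iso[
        OF fin_space_tor_cycles[OF F] fin_space_tor_boundaries[OF F] tor_boundaries_subset[OF F]
          fin_space_tor_cycles[OF G] fin_space_tor_boundaries[OF G] tor_boundaries_subset[OF G]
          coord_linear_tensor_chain tensor_chain_cycles_boundaries[OF \<phi>]
          coord_linear_tensor_chain tensor_chain_cycles_boundaries[OF \<psi>]
          tensor_chain_inverse[OF F G I \<phi> \<psi>] tensor_chain_inverse[OF G F I \<psi> \<phi>]])
  then show ?thesis using tor_dim_eq[OF F, of i j] tor_dim_eq[OF G, of i j] by simp
qed

lemma betti_eq_tor_dim:
  fixes F :: "('v::finite, 'k::field) free_complex"
  assumes "graded_free_resolution F I" "graded_ideal I"
  shows "betti I i j = tor_dim F i j"
  unfolding betti_def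
  by (rule tor_dim_unique[OF _ assms]) (rule someI[where P = "\<lambda>F. graded_free_resolution F I", OF assms(1)])

section \<open>Mapping cones\<close>

text \<open>The mapping cone of \<open>\<phi> : P(-d) \<rightarrow> F\<close>. Even basis names come from \<open>F\<close>; odd ones come from \<open>P\<close>
  moved up by one position, with the sign that makes consecutive maps compose to zero. There are
  no odd names in position \<open>0\<close>, so \<open>i - 1\<close> is read for positive \<open>i\<close> only.\<close>

definition cone ::
  "('v, 'k::comm_ring_1) free_complex \<Rightarrow> ('v, 'k) free_complex \<Rightarrow>
    (nat \<Rightarrow> nat \<Rightarrow> nat \<Rightarrow> ('v, 'k) poly_ring) \<Rightarrow> int \<Rightarrow> ('v, 'k) free_complex" where
  "cone F P \<phi> d = \<lparr>
     basis = (\<lambda>i. (\<lambda>k. 2 * k) ` basis F i \<union> (case i of 0 \<Rightarrow> {} | Suc h \<Rightarrow> (\<lambda>k. Suc (2 * k)) ` basis P h)),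
     twist = (\<lambda>i k. if even k then twist F i (k div 2) else twist P (i - 1) (k div 2) + d),
     aug = (\<lambda>k. aug F (k div 2)),
     bdry = (\<lambda>i k l. if even l then if even k then bdry F i (k div 2) (l div 2) else 0
                     else if even k then \<phi> i (k div 2) (l div 2)
                     else - bdry P (i - 1) (k div 2) (l div 2))\<rparr>"

lemma cone_simps [simp]:
  "basis (cone F P \<phi> d) 0 = (\<lambda>k. 2 * k) ` basis F 0"
  "basis (cone F P \<phi> d) (Suc h) = (\<lambda>k. 2 * k) ` basis F (Suc h) \<union> (\<lambda>k. Suc (2 * k)) ` basis P h"
  "twist (cone F P \<phi> d) i (2 * k) = twist F i k"
  "twist (cone F P \<phi> d) (Suc h) (Suc (2 * k)) = twist P h k + d"
  "aug (cone F P \<phi> d) (2 * k) = aug F k"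
  "bdry (cone F P \<phi> d) i (2 * k) (2 * l) = bdry F i k l"
  "bdry (cone F P \<phi> d) i (Suc (2 * k)) (2 * l) = 0"
  "bdry (cone F P \<phi> d) i (2 * k) (Suc (2 * l)) = \<phi> i k l"
  "bdry (cone F P \<phi> d) (Suc h) (Suc (2 * k)) (Suc (2 * l)) = - bdry P h k l"
  by (auto simp: cone_def)

lemma inj_double: "inj_on (\<lambda>k::nat. 2 * k) A" "inj_on (\<lambda>k::nat. Suc (2 * k)) A"
  by (auto simp: inj_on_def)

lemma sum_cone_basis:
  "sum g (basis (cone F P \<phi> d) 0) = (\<Sum>k\<in>basis F 0. g (2 * k))"
  "finite (basis F (Suc h)) \<Longrightarrow> finite (basis P h) \<Longrightarrow>
     sum g (basis (cone F P \<phi> d) (Suc h))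
       = (\<Sum>k\<in>basis F (Suc h). g (2 * k)) + (\<Sum>k\<in>basis P h. g (Suc (2 * k)))"
proof -
  have "(\<lambda>k::nat. 2 * k) ` X \<inter> (\<lambda>k. Suc (2 * k)) ` Y = {}" for X Y
    by (auto, presburger)
  then show "finite (basis F (Suc h)) \<Longrightarrow> finite (basis P h) \<Longrightarrow>
     sum g (basis (cone F P \<phi> d) (Suc h))
       = (\<Sum>k\<in>basis F (Suc h). g (2 * k)) + (\<Sum>k\<in>basis P h. g (Suc (2 * k)))"
    by (simp add: sum.union_disjoint sum.reindex[OF inj_double(1)] sum.reindex[OF inj_double(2)])
qed (simp add: sum.reindex[OF inj_double(1)])

definition apply_bdry :: "('v, 'k::comm_ring_1) free_complex \<Rightarrow> nat \<Rightarrow>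
    (nat \<Rightarrow> ('v, 'k) poly_ring) \<Rightarrow> nat \<Rightarrow> ('v, 'k) poly_ring" where
  "apply_bdry F i v k = (\<Sum>m\<in>basis F (Suc i). bdry F i k m * v m)"

definition apply_chain :: "('v, 'k::comm_ring_1) free_complex \<Rightarrow>
    (nat \<Rightarrow> nat \<Rightarrow> nat \<Rightarrow> ('v, 'k) poly_ring) \<Rightarrow> nat \<Rightarrow>
    (nat \<Rightarrow> ('v, 'k) poly_ring) \<Rightarrow> nat \<Rightarrow> ('v, 'k) poly_ring" where
  "apply_chain P \<phi> i v k = (\<Sum>m\<in>basis P i. \<phi> i k m * v m)"

lemma apply_linear:
  "apply_bdry F i (\<lambda>m. u m + v m) k = apply_bdry F i u k + apply_bdry F i v k"
  "apply_bdry F i (\<lambda>m. - v m) k = - apply_bdry F i v k"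
  "apply_chain P \<phi> i (\<lambda>m. - v m) k = - apply_chain P \<phi> i v k"
  by (simp_all add: apply_bdry_def apply_chain_def distrib_left sum.distrib sum_negf)

lemma apply_cong:
  "(\<And>m. m \<in> basis F (Suc i) \<Longrightarrow> u m = v m) \<Longrightarrow> apply_bdry F i u k = apply_bdry F i v k"
  "(\<And>m. m \<in> basis P i \<Longrightarrow> u m = v m) \<Longrightarrow> apply_chain P \<phi> i u k = apply_chain P \<phi> i v k"
  by (simp_all add: apply_bdry_def apply_chain_def)

lemma apply_bdry_bdry:
  assumes "graded_free_resolution F I" "k \<in> basis F i"
  shows "apply_bdry F i (apply_bdry F (Suc i) v) k = 0"
  unfolding apply_bdry_def sum_mult_assoc using resolution_bdry_bdry[OF assms] by simp

lemma apply_bdry_chain: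
  assumes "chain_map P F J f d \<phi>" "k \<in> basis F i"
  shows "apply_bdry F i (apply_chain P \<phi> (Suc i) v) k = apply_chain P \<phi> i (apply_bdry P i v) k"
  unfolding apply_bdry_def apply_chain_def sum_mult_assoc
  using assms by (simp add: chain_map_def)

lemma aug_apply_bdry:
  assumes F: "graded_free_resolution F I"
  shows "(\<Sum>k\<in>basis F 0. aug F k * apply_bdry F 0 v k) \<in> I"
proof -
  have "boundary F 0 (apply_bdry F 0 v)" by (auto simp: boundary_def apply_bdry_def)
  then show ?thesis by (simp add: cycle_def flip: resolution_exact[OF F])
qed

lemma aug_apply_chain:
  assumes \<phi>: "chain_map P F J f d \<phi>" and J: "graded_ideal J"
  shows "f * (\<Sum>m\<in>basis P 0. aug P m * v m)
      - (\<Sum>k\<in>basis F 0. aug F k * apply_chain P \<phi> 0 v k) \<in> J"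
proof -
  have "f * (\<Sum>m\<in>basis P 0. aug P m * v m) - (\<Sum>k\<in>basis F 0. aug F k * apply_chain P \<phi> 0 v k)
      = (\<Sum>m\<in>basis P 0. (f * aug P m - (\<Sum>k\<in>basis F 0. aug F k * \<phi> 0 k m)) * v m)"
    unfolding apply_chain_def sum_mult_assoc
    by (simp add: left_diff_distrib sum_subtractf sum_distrib_left mult.assoc)
  also have "\<dots> \<in> J"
    using \<phi> by (intro graded_ideal_sum_mult[OF J]) (simp add: chain_map_def)
  finally show ?thesis .
qed

lemma cycle_apply: "cycle F I (Suc i) w \<longleftrightarrow> (\<forall>k\<in>basis F i. apply_bdry F i w k = 0)"
  by (simp add: cycle_def apply_bdry_def)

lemma boundary_apply: "boundary F i w \<longleftrightarrow> (\<exists>v. \<forall>k\<in>basis F i. w k = apply_bdry F i v k)"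
  by (simp add: boundary_def apply_bdry_def)

lemma apply_bdry_cone:
  assumes "finite (basis F (Suc i))" "finite (basis P i)"
  shows "apply_bdry (cone F P \<phi> d) i v (2 * k) = apply_bdry F i (evens v) k + apply_chain P \<phi> i (odds v) k"
    and "i = Suc h \<Longrightarrow> apply_bdry (cone F P \<phi> d) i v (Suc (2 * k)) = - apply_bdry P h (odds v) k"
  using assms
  by (simp_all add: apply_bdry_def apply_chain_def sum_cone_basis evens_def odds_def sum_negf
      del: cone_simps(1,2))

lemma cycle_cone:
  assumes "\<And>i. finite (basis F i)" "\<And>i. finite (basis P i)"
  shows "cycle (cone F P \<phi> d) I 0 w \<longleftrightarrow> cycle F I 0 (evens w)"
    and "cycle (cone F P \<phi> d) I (Suc i) w \<longleftrightarrow>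
      (\<forall>k\<in>basis F i. apply_bdry F i (evens w) k + apply_chain P \<phi> i (odds w) k = 0) \<and>
      (\<forall>h. i = Suc h \<longrightarrow> (\<forall>k\<in>basis P h. apply_bdry P h (odds w) k = 0))"
proof -
  show "cycle (cone F P \<phi> d) I 0 w \<longleftrightarrow> cycle F I 0 (evens w)"
    by (simp add: cycle_def sum_cone_basis evens_def del: cone_simps(1))
  show "cycle (cone F P \<phi> d) I (Suc i) w \<longleftrightarrow>
      (\<forall>k\<in>basis F i. apply_bdry F i (evens w) k + apply_chain P \<phi> i (odds w) k = 0) \<and>
      (\<forall>h. i = Suc h \<longrightarrow> (\<forall>k\<in>basis P h. apply_bdry P h (odds w) k = 0))"
    unfolding cycle_apply
    by (cases i) (simp_all add: assms apply_bdry_cone ball_Un)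
qed

lemma ex_interleave: "(\<exists>v. R (evens v) (odds v)) \<longleftrightarrow> (\<exists>a b. R a b)"
proof
  assume "\<exists>a b. R a b"
  then obtain a b where "R (evens (interleave a b)) (odds (interleave a b))" by auto
  then show "\<exists>v. R (evens v) (odds v)" by blast
qed blast

lemma boundary_cone:
  assumes "\<And>i. finite (basis F i)" "\<And>i. finite (basis P i)"
  shows "boundary (cone F P \<phi> d) i w \<longleftrightarrow>
    (\<exists>a b. (\<forall>k\<in>basis F i. evens w k = apply_bdry F i a k + apply_chain P \<phi> i b k) \<and>
      (\<forall>h. i = Suc h \<longrightarrow> (\<forall>k\<in>basis P h. odds w k = - apply_bdry P h b k)))"
proof -
  have eq: "(\<forall>k\<in>basis (cone F P \<phi> d) i. w k = apply_bdry (cone F P \<phi> d) i v k) \<longleftrightarrow>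
      (\<forall>k\<in>basis F i. evens w k = apply_bdry F i (evens v) k + apply_chain P \<phi> i (odds v) k) \<and>
      (\<forall>h. i = Suc h \<longrightarrow> (\<forall>k\<in>basis P h. odds w k = - apply_bdry P h (odds v) k))" for v
    by (cases i) (simp_all add: assms apply_bdry_cone ball_Un evens_def[of w] odds_def[of w])
  show ?thesis
    unfolding boundary_apply eq by (rule ex_interleave)
qed

text \<open>The cone of a lift of \<open>f : R/(J : f) \<rightarrow> R/J\<close> resolves \<open>R/(J + (f))\<close>. The proof is the usual
  diagram chase: the \<open>P\<close>-part of a cycle of the cone is a cycle of \<open>P\<close>, which in the lowest position
  is where \<open>Q\<close> being the colon ideal enters. Subtracting the boundary that corrects it leaves a
  cycle of \<open>F\<close>.\<close>

theorem cone_resolution: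
  fixes F P :: "('v::finite, 'k::comm_ring_1) free_complex"
  assumes F: "graded_free_resolution F J" and P: "graded_free_resolution P Q"
    and J: "graded_ideal J" and \<phi>: "chain_map P F J f d \<phi>"
    and Q: "\<And>q. q \<in> Q \<longleftrightarrow> f * q \<in> J" and I: "\<And>p. p \<in> I \<longleftrightarrow> (\<exists>q. p - q * f \<in> J)"
  shows "graded_free_resolution (cone F P \<phi> d) I"
proof -
  have fin: "finite (basis F i)" "finite (basis P i)" for i
    by (rule resolution_finite[OF F] resolution_finite[OF P])+
  have JI: "p \<in> J \<Longrightarrow> p \<in> I" for p
    unfolding I by (intro exI[of _ 0]) simp
  show ?thesis
    unfolding graded_free_resolution_iff
  proof (intro conjI allI ballI)
    fix i show "finite (basis (cone F P \<phi> d) i)" by (cases i) (simp_all add: fin)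
  next
    fix k assume "k \<in> basis (cone F P \<phi> d) 0"
    then show "homogeneous (twist (cone F P \<phi> d) 0 k) (aug (cone F P \<phi> d) k)"
      using resolution_aug_homogeneous[OF F] by auto
  next
    fix i k l assume k: "k \<in> basis (cone F P \<phi> d) i" and l: "l \<in> basis (cone F P \<phi> d) (Suc i)"
    have \<phi>_hom: "homogeneous (twist P i l + d - twist F i k) (\<phi> i k l)"
      if "k \<in> basis F i" "l \<in> basis P i" for k l
      using \<phi> that by (simp add: chain_map_def)
    show "homogeneous (twist (cone F P \<phi> d) (Suc i) l - twist (cone F P \<phi> d) i k) (bdry (cone F P \<phi> d) i k l)"
    proof (cases i)
      case 0
      then show ?thesis
        using k l \<phi>_hom resolution_bdry_homogeneous[OF F] by auto
    next
      case (Suc h)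
      then show ?thesis
        using k l \<phi>_hom resolution_bdry_homogeneous[OF F] resolution_bdry_homogeneous[OF P]
        by (auto simp: homogeneous_uminus)
    qed
  next
    fix p
    obtain v where "p - (\<Sum>k\<in>basis F 0. aug F k * v k) \<in> J" using resolution_surj[OF F] by blast
    then have "p - (\<Sum>k\<in>basis (cone F P \<phi> d) 0. aug (cone F P \<phi> d) k * interleave v 0 k) \<in> I"
      by (simp add: sum_cone_basis JI del: cone_simps(1))
    then show "\<exists>v. p - (\<Sum>k\<in>basis (cone F P \<phi> d) 0. aug (cone F P \<phi> d) k * v k) \<in> I"
      by blast
  next
    fix i and w :: "nat \<Rightarrow> ('v, 'k) poly_ring"
    let ?u = "evens w" and ?w = "odds w"
    show "cycle (cone F P \<phi> d) I i w = boundary (cone F P \<phi> d) i w"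
    proof (cases i)
      case 0
      show ?thesis
      proof
        assume "cycle (cone F P \<phi> d) I i w"
        then have "cycle F I 0 ?u" by (simp only: 0 cycle_cone(1)[OF fin])
        then obtain q where q: "(\<Sum>k\<in>basis F 0. aug F k * ?u k) - q * f \<in> J"
          by (auto simp: cycle_def I)
        obtain b where "q - (\<Sum>k\<in>basis P 0. aug P k * b k) \<in> Q"
          using resolution_surj[OF P] by blast
        then have b: "f * (q - (\<Sum>k\<in>basis P 0. aug P k * b k)) \<in> J" by (simp add: Q)
        have "(\<Sum>k\<in>basis F 0. aug F k * (?u k - apply_chain P \<phi> 0 b k))
            = ((\<Sum>k\<in>basis F 0. aug F k * ?u k) - q * f)
              + (f * (q - (\<Sum>k\<in>basis P 0. aug P k * b k))
              + (f * (\<Sum>m\<in>basis P 0. aug P m * b m)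
                  - (\<Sum>k\<in>basis F 0. aug F k * apply_chain P \<phi> 0 b k)))"
          by (simp add: sum_subtractf algebra_simps)
        also have "\<dots> \<in> J"
          by (intro graded_idealD(2)[OF J] q b aug_apply_chain[OF \<phi> J])
        finally have "cycle F J 0 (\<lambda>k. ?u k - apply_chain P \<phi> 0 b k)" by (simp add: cycle_def)
        then obtain a where "\<forall>k\<in>basis F 0. ?u k - apply_chain P \<phi> 0 b k = apply_bdry F 0 a k"
          by (auto simp: resolution_exact[OF F] boundary_apply)
        then have "\<forall>k\<in>basis F 0. ?u k = apply_bdry F 0 a k + apply_chain P \<phi> 0 b k"
          by (simp add: algebra_simps)
        then show "boundary (cone F P \<phi> d) i w"
          unfolding boundary_cone[OF fin] by (auto simp: 0)
      next
        assume "boundary (cone F P \<phi> d) i w"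
        then obtain a b where u: "\<forall>k\<in>basis F 0. ?u k = apply_bdry F 0 a k + apply_chain P \<phi> 0 b k"
          by (auto simp: boundary_cone[OF fin] 0)
        define q where "q = (\<Sum>m\<in>basis P 0. aug P m * b m)"
        have "(\<Sum>k\<in>basis F 0. aug F k * ?u k) - q * f
            = (\<Sum>k\<in>basis F 0. aug F k * apply_bdry F 0 a k)
              - (f * q - (\<Sum>k\<in>basis F 0. aug F k * apply_chain P \<phi> 0 b k))"
          using u by (simp add: sum.distrib algebra_simps)
        also have "\<dots> \<in> J"
          unfolding q_def
          by (intro graded_idealD(6)[OF J] aug_apply_bdry[OF F] aug_apply_chain[OF \<phi> J])
        finally have "cycle F I 0 ?u" by (auto simp: cycle_def I)
        then show "cycle (cone F P \<phi> d) I i w" by (simp only: 0 cycle_cone(1)[OF fin])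
      qed
    next
      case (Suc n)
      show ?thesis
      proof
        assume "cycle (cone F P \<phi> d) I i w"
        then have u: "\<And>k. k\<in>basis F n \<Longrightarrow> apply_bdry F n ?u k + apply_chain P \<phi> n ?w k = 0"
          and w: "\<And>h k. n = Suc h \<Longrightarrow> k\<in>basis P h \<Longrightarrow> apply_bdry P h ?w k = 0"
          by (auto simp: Suc cycle_cone[OF fin])
        have "cycle P Q n ?w"
        proof (cases n)
          case 0
          have "f * (\<Sum>k\<in>basis P 0. aug P k * ?w k)
              = (f * (\<Sum>k\<in>basis P 0. aug P k * ?w k)
                  - (\<Sum>k\<in>basis F 0. aug F k * apply_chain P \<phi> 0 ?w k))
                - (\<Sum>k\<in>basis F 0. aug F k * apply_bdry F 0 ?u k)"
          proof -
            have "(\<Sum>k\<in>basis F 0. aug F k * apply_chain P \<phi> 0 ?w k)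
                + (\<Sum>k\<in>basis F 0. aug F k * apply_bdry F 0 ?u k)
              = (\<Sum>k\<in>basis F 0. aug F k * (apply_bdry F 0 ?u k + apply_chain P \<phi> 0 ?w k))"
              by (simp add: distrib_left sum.distrib)
            also have "\<dots> = 0" using u 0 by simp
            finally show ?thesis by (simp add: algebra_simps)
          qed
          also have "\<dots> \<in> J"
            by (intro graded_idealD(6)[OF J] aug_apply_bdry[OF F] aug_apply_chain[OF \<phi> J])
          finally show ?thesis by (simp add: 0 cycle_def Q)
        next
          case (Suc h)
          then show ?thesis using w by (simp add: cycle_apply)
        qed
        then obtain b where b: "\<And>k. k\<in>basis P n \<Longrightarrow> ?w k = apply_bdry P n b k"
          by (auto simp: resolution_exact[OF P] boundary_apply)
        define y where "y k = ?u k + apply_chain P \<phi> (Suc n) b k" for k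
        have "apply_bdry F n y k = 0" if k: "k \<in> basis F n" for k
        proof -
          have "apply_bdry F n y k = apply_bdry F n ?u k + apply_chain P \<phi> n (apply_bdry P n b) k"
            unfolding y_def apply_linear by (simp add: apply_bdry_chain[OF \<phi> k])
          also have "apply_chain P \<phi> n (apply_bdry P n b) k = apply_chain P \<phi> n ?w k"
            by (rule apply_cong) (simp add: b)
          finally show ?thesis using u[OF k] by simp
        qed
        then have "cycle F J (Suc n) y" by (simp add: cycle_apply)
        then obtain a where a: "\<forall>k\<in>basis F (Suc n). y k = apply_bdry F (Suc n) a k"
          by (auto simp: resolution_exact[OF F] boundary_apply)
        have "?u k = apply_bdry F (Suc n) a k + apply_chain P \<phi> (Suc n) (\<lambda>m. - b m) k"
          if "k \<in> basis F (Suc n)" for k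
          using a that by (auto simp: y_def apply_linear algebra_simps dest: bspec)
        moreover have "?w k = - apply_bdry P n (\<lambda>m. - b m) k" if "k \<in> basis P n" for k
          using b[OF that] by (simp add: apply_linear)
        ultimately show "boundary (cone F P \<phi> d) i w"
          unfolding Suc boundary_cone[OF fin]
          by (intro exI[of _ a] exI[of _ "\<lambda>m. - b m"]) simp
      next
        assume "boundary (cone F P \<phi> d) i w"
        then obtain a b where
          u: "\<And>k. k\<in>basis F (Suc n) \<Longrightarrow> ?u k = apply_bdry F (Suc n) a k + apply_chain P \<phi> (Suc n) b k"
          and w: "\<And>k. k\<in>basis P n \<Longrightarrow> ?w k = - apply_bdry P n b k"
          by (auto simp: Suc boundary_cone[OF fin])
        have "apply_bdry F n ?u k + apply_chain P \<phi> n ?w k = 0" if k: "k \<in> basis F n" for k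
        proof -
          have "apply_bdry F n ?u k
              = apply_bdry F n (\<lambda>m. apply_bdry F (Suc n) a m + apply_chain P \<phi> (Suc n) b m) k"
            by (rule apply_cong) (rule u)
          also have "\<dots> = apply_chain P \<phi> n (apply_bdry P n b) k"
            unfolding apply_linear by (simp add: apply_bdry_bdry[OF F k] apply_bdry_chain[OF \<phi> k])
          finally have 1: "apply_bdry F n ?u k = apply_chain P \<phi> n (apply_bdry P n b) k" .
          have "apply_chain P \<phi> n ?w k = apply_chain P \<phi> n (\<lambda>m. - apply_bdry P n b m) k"
            by (rule apply_cong) (rule w)
          with 1 show ?thesis by (simp add: apply_linear)
        qed
        moreover have "apply_bdry P h ?w k = 0" if h: "n = Suc h" and k: "k \<in> basis P h" for h k
        proof -
          have "apply_bdry P h ?w k = apply_bdry P h (\<lambda>m. - apply_bdry P n b m) k"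
            by (rule apply_cong) (simp add: w h)
          then show ?thesis by (simp add: apply_linear h apply_bdry_bdry[OF P k])
        qed
        ultimately show "cycle (cone F P \<phi> d) I i w"
          by (simp add: Suc cycle_cone[OF fin])
      qed
    qed
  qed
qed

lemma fin_space_0: "fin_space {0}"
  unfolding fin_space_def by (auto simp: coord_subspace_iff intro!: exI[of _ "{}"])

lemma tensor_mod_cone:
  "tensor_mod (cone F P \<phi> d) i j
     = dsum (tensor_mod F i j) (case i of 0 \<Rightarrow> {0} | Suc h \<Rightarrow> tensor_mod P h (j - d))"
proof -
  have split: "(\<forall>k. R k) \<longleftrightarrow> (\<forall>k. R (2 * k)) \<and> (\<forall>k. R (Suc (2 * k)))" for R :: "nat \<Rightarrow> bool"
    by (metis evenE oddE Suc_eq_plus1)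
  have mem: "2 * k \<in> (\<lambda>k. 2 * k) ` A \<longleftrightarrow> k \<in> A" "Suc (2 * k) \<in> (\<lambda>k. Suc (2 * k)) ` A \<longleftrightarrow> k \<in> A"
    "2 * k \<notin> (\<lambda>k. Suc (2 * k)) ` A" "Suc (2 * k) \<notin> (\<lambda>k. 2 * k) ` A" for k :: nat and A
    by (auto, presburger+)
  show ?thesis
  proof (cases i)
    case 0
    show ?thesis unfolding tensor_mod_def dsum_def 0
      by (subst split) (auto simp: mem evens_def odds_def fun_eq_iff)
  next
    case (Suc h)
    have "twist P h k + d = j \<longleftrightarrow> twist P h k = j - d" for k by auto
    then show ?thesis unfolding tensor_mod_def dsum_def Suc
      by (subst split) (simp add: mem evens_def odds_def)
  qed
qed

lemma tensor_bdry_cone: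
  fixes F P :: "('v, 'k::field) free_complex"
  assumes fin: "\<And>i. finite (basis F i)" "\<And>i. finite (basis P i)"
    and \<phi>: "\<And>i k l. k \<in> basis F i \<Longrightarrow> l \<in> basis P i \<Longrightarrow> const_coeff (\<phi> i k l) = 0"
  shows "tensor_bdry (cone F P \<phi> d) i v = interleave (tensor_bdry F i (evens v))
           (case i of 0 \<Rightarrow> 0 | Suc h \<Rightarrow> - tensor_bdry P h (odds v))"
proof
  fix k
  have mem: "2 * k \<in> (\<lambda>k. 2 * k) ` A \<longleftrightarrow> k \<in> A" "Suc (2 * k) \<in> (\<lambda>k. Suc (2 * k)) ` A \<longleftrightarrow> k \<in> A"
    "2 * k \<notin> (\<lambda>k. Suc (2 * k)) ` A" "Suc (2 * k) \<notin> (\<lambda>k. 2 * k) ` A" for k :: nat and A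
    by (auto, presburger+)
  show "tensor_bdry (cone F P \<phi> d) i v k = interleave (tensor_bdry F i (evens v))
           (case i of 0 \<Rightarrow> 0 | Suc h \<Rightarrow> - tensor_bdry P h (odds v)) k"
  proof (cases "even k")
    case True
    then obtain l where k: "k = 2 * l" by (rule evenE)
    have "2 * l \<in> basis (cone F P \<phi> d) i \<longleftrightarrow> l \<in> basis F i" by (cases i) (simp_all add: mem)
    then show ?thesis
      using \<phi> by (simp add: k tensor_bdry_mat_app mat_app_def sum_cone_basis fin evens_def
          del: cone_simps(1,2) cong: sum.cong)
  next
    case False
    then obtain l where k: "k = Suc (2 * l)" by (metis oddE Suc_eq_plus1)
    show ?thesis
    proof (cases i)
      case 0
      then show ?thesis by (simp add: k tensor_bdry_def mem)
    next
      case (Suc h)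
      have "Suc (2 * l) \<in> basis (cone F P \<phi> d) i \<longleftrightarrow> l \<in> basis P h" by (simp add: Suc mem)
      then show ?thesis
        by (simp add: k Suc tensor_bdry_mat_app mat_app_def sum_cone_basis fin odds_def sum_negf
          del: cone_simps(1,2) cong: sum.cong)
    qed
  qed
qed

text \<open>If the connecting map vanishes modulo the variables, the tensored cone is the direct sum of
  the two tensored complexes, the second one shifted in position and in degree.\<close>

theorem tor_dim_cone:
  fixes F P :: "('v::finite, 'k::field) free_complex"
  assumes F: "graded_free_resolution F J" and P: "graded_free_resolution P Q"
    and C: "graded_free_resolution (cone F P \<phi> d) I"
    and \<phi>: "\<And>i k l. k \<in> basis F i \<Longrightarrow> l \<in> basis P i \<Longrightarrow> const_coeff (\<phi> i k l) = 0"
  shows "tor_dim (cone F P \<phi> d) i j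
     = tor_dim F i j + (case i of 0 \<Rightarrow> 0 | Suc h \<Rightarrow> tor_dim P h (j - d))"
proof -
  let ?C = "cone F P \<phi> d"
  have fin: "finite (basis F i)" "finite (basis P i)" for i
    by (rule resolution_finite[OF F] resolution_finite[OF P])+
  note bd = tensor_bdry_cone[OF fin \<phi>]
  define Z where "Z = (case i of 0 \<Rightarrow> {0} | Suc h \<Rightarrow> tor_cycles P h (j - d))"
  define B where "B = (case i of 0 \<Rightarrow> {0} | Suc h \<Rightarrow> tor_boundaries P h (j - d))"
  have fs: "fin_space Z" "fin_space B"
    using fin_space_tor_cycles[OF P] fin_space_tor_boundaries[OF P] fin_space_0
    by (auto simp: Z_def B_def split: nat.split)
  have interleave_0: "interleave u w = 0 \<longleftrightarrow> u = 0 \<and> w = 0" for u w :: "nat \<Rightarrow> 'k"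
    by (metis evens_odds_simps(1,2) interleave_simps)
  have cyc: "tor_cycles ?C i j = dsum (tor_cycles F i j) Z"
  proof (cases i)
    case 0
    then show ?thesis by (simp add: Z_def tor_cycles_def tensor_mod_cone)
  next
    case (Suc h)
    then show ?thesis
      by (cases h) (auto simp: Z_def tor_cycles_def tensor_mod_cone dsum_def bd interleave_0)
  qed
  have bdr: "tor_boundaries ?C i j = dsum (tor_boundaries F i j) B"
  proof (rule set_eqI)
    fix x
    let ?d = "\<lambda>w. case i of 0 \<Rightarrow> 0 | Suc h \<Rightarrow> - tensor_bdry P h w"
    have mod: "v \<in> tensor_mod ?C (Suc i) j \<longleftrightarrow>
        evens v \<in> tensor_mod F (Suc i) j \<and> odds v \<in> tensor_mod P i (j - d)" for v
      by (simp add: tensor_mod_cone dsum_def)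
    have "x \<in> tor_boundaries ?C i j \<longleftrightarrow>
        evens x \<in> tor_boundaries F i j \<and> (\<exists>w\<in>tensor_mod P i (j - d). odds x = ?d w)"
    proof
      assume "x \<in> tor_boundaries ?C i j"
      then obtain v where v: "v \<in> tensor_mod ?C (Suc i) j" "x = tensor_bdry ?C i v"
        by (auto simp: tor_boundaries_def)
      then have "evens x = tensor_bdry F i (evens v)" "odds x = ?d (odds v)" by (simp_all add: bd)
      with v(1) show "evens x \<in> tor_boundaries F i j \<and> (\<exists>w\<in>tensor_mod P i (j - d). odds x = ?d w)"
        unfolding mod tor_boundaries_def by blast
    next
      assume "evens x \<in> tor_boundaries F i j \<and> (\<exists>w\<in>tensor_mod P i (j - d). odds x = ?d w)"
      then obtain u w where uw: "u \<in> tensor_mod F (Suc i) j" "evens x = tensor_bdry F i u"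
        "w \<in> tensor_mod P i (j - d)" "odds x = ?d w"
        by (auto simp: tor_boundaries_def)
      have "x = interleave (evens x) (odds x)" by simp
      also have "\<dots> = tensor_bdry ?C i (interleave u w)"
        by (simp add: uw bd split: nat.split)
      finally show "x \<in> tor_boundaries ?C i j"
        using uw mod[of "interleave u w"] by (auto simp: tor_boundaries_def)
    qed
    also have "(\<exists>w\<in>tensor_mod P i (j - d). odds x = ?d w) \<longleftrightarrow> odds x \<in> B"
    proof (cases i)
      case 0
      have "0 \<in> tensor_mod P 0 (j - d)" by (simp add: tensor_mod_def)
      with 0 show ?thesis by (auto simp: B_def)
    next
      case (Suc h)
      have neg: "odds x = - y \<longleftrightarrow> - odds x = y" for y
        by (metis minus_minus)
      have "(\<exists>w\<in>tensor_mod P (Suc h) (j - d). odds x = - tensor_bdry P h w)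
          \<longleftrightarrow> - odds x \<in> tor_boundaries P h (j - d)"
        by (simp only: tor_boundaries_def image_iff neg)
      also have "\<dots> \<longleftrightarrow> odds x \<in> tor_boundaries P h (j - d)"
        using fin_space_uminus[OF fin_space_tor_boundaries[OF P], of "odds x" h "j - d"]
          fin_space_uminus[OF fin_space_tor_boundaries[OF P], of "- odds x" h "j - d"]
        by auto
      finally show ?thesis by (simp add: Suc B_def)
    qed
    finally show "x \<in> tor_boundaries ?C i j \<longleftrightarrow> x \<in> dsum (tor_boundaries F i j) B"
      by (simp add: dsum_def)
  qed
  have "vec_dim (tor_cycles ?C i j) = vec_dim (tor_cycles F i j) + vec_dim Z"
    unfolding cyc by (rule vec_dim_dsum[OF fin_space_tor_cycles[OF F] fs(1)])
  moreover have "vec_dim (tor_boundaries ?C i j) = vec_dim (tor_boundaries F i j) + vec_dim B"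
    unfolding bdr by (rule vec_dim_dsum[OF fin_space_tor_boundaries[OF F] fs(2)])
  moreover have "vec_dim Z = (case i of 0 \<Rightarrow> 0 | Suc h \<Rightarrow> tor_dim P h (j - d)) + vec_dim B"
    using tor_dim_eq[OF P] by (auto simp: Z_def B_def split: nat.split)
  ultimately show ?thesis
    using tor_dim_eq[OF F, of i j] tor_dim_eq[OF C, of i j] by simp
qed

section \<open>Betti numbers of squarefree monomial ideals\<close>

lemma graded_ideal_sqfree: "graded_ideal (sqfree_ideal S)"
  unfolding graded_ideal_def using sqfree_ideal_closed by blast

text \<open>The resolution of \<open>R\<close> itself by a single free module of rank one.\<close>

definition rank_one_complex :: "('v, 'k::comm_ring_1) free_complex" where
  "rank_one_complex = \<lparr>basis = (\<lambda>i. if i = 0 then {0} else {}), twist = (\<lambda>i k. 0),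
     aug = (\<lambda>k. 1), bdry = (\<lambda>i k l. 0)\<rparr>"

lemma rank_one_complex_resolution: "graded_free_resolution rank_one_complex {0}"
  unfolding graded_free_resolution_iff
proof (intro conjI allI ballI)
  fix p :: "('a, 'b) poly_ring"
  show "\<exists>v. p - (\<Sum>k\<in>basis rank_one_complex 0. aug rank_one_complex k * v k) \<in> {0}"
    by (intro exI[of _ "\<lambda>_. p"]) (simp add: rank_one_complex_def)
next
  fix i and w :: "nat \<Rightarrow> ('a, 'b) poly_ring"
  show "cycle rank_one_complex {0} i w = boundary rank_one_complex i w"
    by (cases i) (auto simp: cycle_def boundary_def rank_one_complex_def)
qed (auto simp: rank_one_complex_def split: if_splits)

lemma tor_dim_empty_basis:
  assumes "graded_free_resolution F I" "basis F i = {}"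
  shows "tor_dim F i j = 0"
proof -
  have "tor_cycles F i j \<subseteq> {0}"
    using assms(2) by (auto simp: tor_cycles_def tensor_mod_def fun_eq_iff)
  moreover have "0 \<in> tor_cycles F i j"
    using fin_space_tor_cycles[OF assms(1)] by (simp add: fin_space_def coord.subspace_0)
  ultimately have "tor_cycles F i j = {0}" by blast
  then show ?thesis using tor_dim_eq[OF assms(1), of i j] by simp
qed

lemma tor_dim_rank_one_complex:
  "tor_dim (rank_one_complex :: ('v, 'k::field) free_complex) i j = (if i = 0 \<and> j = 0 then 1 else 0)"
proof -
  let ?F = "rank_one_complex :: ('v, 'k) free_complex"
  note res = rank_one_complex_resolution[where 'a = 'v and 'b = 'k]
  consider "i \<noteq> 0" | "i = 0" "j \<noteq> 0" | "i = 0" "j = 0" by blast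
  then show ?thesis
  proof cases
    case 1
    then show ?thesis using tor_dim_empty_basis[OF res] by (simp add: rank_one_complex_def)
  next
    case 2
    then have "tor_cycles ?F i j = {0}"
      by (auto simp: tor_cycles_def tensor_mod_def rank_one_complex_def fun_eq_iff)
    then show ?thesis using tor_dim_eq[OF res, of i j] 2 by simp
  next
    case 3
    let ?e = "\<lambda>k::nat. if k = 0 then 1 else 0 :: 'k"
    have cyc: "tor_cycles ?F 0 0 = {v. \<forall>k. k \<noteq> 0 \<longrightarrow> v k = 0}"
      by (auto simp: tor_cycles_def tensor_mod_def rank_one_complex_def)
    have "vec_dim (tor_cycles ?F 0 0) = 1"
    proof (rule coord.dim_unique)
      show "{?e} \<subseteq> tor_cycles ?F 0 0" by (auto simp: cyc)
      show "tor_cycles ?F 0 0 \<subseteq> coord.span {?e}"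
      proof
        fix v assume "v \<in> tor_cycles ?F 0 0"
        then have "v = (\<lambda>k. v 0 * ?e k)" by (auto simp: cyc fun_eq_iff)
        then show "v \<in> coord.span {?e}" by (metis coord.span_base coord.span_scale singletonI)
      qed
      have "?e \<noteq> 0" by (auto simp: fun_eq_iff)
      then show "coord.independent {?e}" by simp
    qed simp
    moreover have "tor_boundaries ?F 0 0 = {0}"
    proof -
      have "tensor_bdry ?F 0 v = 0" for v
        by (auto simp: tensor_bdry_def rank_one_complex_def fun_eq_iff)
      moreover have "0 \<in> tensor_mod ?F (Suc 0) 0" by (simp add: tensor_mod_def)
      ultimately show ?thesis by (auto simp: tor_boundaries_def)
    qed
    ultimately show ?thesis using tor_dim_eq[OF res, of 0 0] 3 by simp
  qed
qed

lemma cone_sqfree_resolution: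
  fixes F P :: "('v::finite, 'k::comm_ring_1) free_complex"
  assumes "graded_free_resolution F (sqfree_ideal S)"
    and "graded_free_resolution P (sqfree_ideal ((\<lambda>B. B - A) ` S))"
    and "chain_map P F (sqfree_ideal S) (sqfree_monomial A) d \<phi>"
  shows "graded_free_resolution (cone F P \<phi> d) (sqfree_ideal (insert A S))"
  by (rule cone_resolution[OF assms(1,2) graded_ideal_sqfree assms(3)])
    (simp_all add: sqfree_ideal_colon sqfree_ideal_insert)

text \<open>Generators are added one by one by cones. The colon ideal needed for the cone is again
  generated by squarefree monomials, and by no more of them than the ideal before the generator
  was added, so the induction on the number of generators covers it. This replaces the syzygy
  theorem.\<close>

lemma sqfree_resolution_exists:
  "\<exists>(F :: ('v::finite, 'k::comm_ring_1) free_complex) n.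
     graded_free_resolution F (sqfree_ideal S) \<and> (\<forall>i\<ge>n. basis F i = {})"
proof (induction "card S" arbitrary: S rule: less_induct)
  case less
  have fin: "finite S" by simp
  show ?case
  proof (cases "S = {}")
    case True
    have "graded_free_resolution (rank_one_complex :: ('v, 'k) free_complex) (sqfree_ideal S)"
      using rank_one_complex_resolution by (simp add: True sqfree_ideal_empty)
    moreover have "\<forall>i\<ge>1. basis (rank_one_complex :: ('v, 'k) free_complex) i = {}"
      by (simp add: rank_one_complex_def)
    ultimately show ?thesis by blast
  next
    case False
    then obtain A T where S: "S = insert A T" "A \<notin> T" by (meson Set.set_insert ex_in_conv)
    have "card T < card S" by (simp add: S card_insert_if)
    moreover have "card ((\<lambda>B. B - A) ` T) < card S"
      using card_image_le[of T "\<lambda>B. B - A"] \<open>card T < card S\<close> by simp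
    ultimately obtain F P :: "('v, 'k) free_complex" and n m where
      F: "graded_free_resolution F (sqfree_ideal T)" "\<forall>i\<ge>n. basis F i = {}"
      and P: "graded_free_resolution P (sqfree_ideal ((\<lambda>B. B - A) ` T))" "\<forall>i\<ge>m. basis P i = {}"
      using less.hyps[of T] less.hyps[of "(\<lambda>B. B - A) ` T"] by auto
    obtain \<phi> where \<phi>: "chain_map P F (sqfree_ideal T) (sqfree_monomial A) (int (card A)) \<phi>"
      using chain_map_exists[OF F(1) P(1) graded_ideal_sqfree homogeneous_sqfree_monomial[of A]]
      by (auto simp: sqfree_ideal_colon)
    have "basis (cone F P \<phi> (int (card A))) i = {}" if "i \<ge> max n (Suc m)" for i
      using that F(2) P(2) by (cases i) simp_all
    then show ?thesis
      using cone_sqfree_resolution[OF F(1) P(1) \<phi>] unfolding S(1) by blast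
  qed
qed

lemma betti_bounded:
  "\<exists>n. \<forall>i\<ge>n. \<forall>j. betti (sqfree_ideal S :: ('v::finite, 'k::field) poly_ring set) i j = 0"
proof -
  obtain F :: "('v, 'k) free_complex" and n where
    F: "graded_free_resolution F (sqfree_ideal S)" "\<forall>i\<ge>n. basis F i = {}"
    using sqfree_resolution_exists by blast
  then show ?thesis
    using betti_eq_tor_dim[OF F(1) graded_ideal_sqfree] tor_dim_empty_basis[OF F(1)]
    by (intro exI[of _ n]) simp
qed

lemma betti_no_generators:
  "betti (sqfree_ideal {} :: ('v::finite, 'k::field) poly_ring set) i j = (if i = 0 \<and> j = 0 then 1 else 0)"
proof -
  have "graded_free_resolution (rank_one_complex :: ('v, 'k) free_complex) (sqfree_ideal {})"
    using rank_one_complex_resolution by (simp add: sqfree_ideal_empty)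
  from betti_eq_tor_dim[OF this graded_ideal_sqfree] show ?thesis
    by (simp add: tor_dim_rank_one_complex)
qed

text \<open>If \<open>x\<close> is a variable, the entries of the new lift lie in the maximal ideal generated by the
  variables; this is how connecting maps that vanish modulo the variables arise.\<close>

lemma chain_map_times:
  fixes F P :: "('v::finite, 'k::comm_ring_1) free_complex"
  assumes \<phi>: "chain_map P F J g e \<phi>" and J: "graded_ideal J" and x: "homogeneous c x"
  shows "chain_map P F J (x * g) (c + e) (\<lambda>i k l. x * \<phi> i k l)"
  unfolding chain_map_def
proof (intro conjI allI ballI)
  fix i k l assume "k \<in> basis F i" "l \<in> basis P i"
  then have "homogeneous (twist P i l + e - twist F i k) (\<phi> i k l)"
    using \<phi> by (simp add: chain_map_def)
  from homogeneous_mult[OF x this]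
  show "homogeneous (twist P i l + (c + e) - twist F i k) (x * \<phi> i k l)"
    by (simp add: algebra_simps)
next
  fix l assume "l \<in> basis P 0"
  then have "x * (g * aug P l - (\<Sum>k\<in>basis F 0. aug F k * \<phi> 0 k l)) \<in> J"
    using \<phi> by (intro graded_idealD(3)[OF J]) (simp add: chain_map_def)
  then show "x * g * aug P l - (\<Sum>k\<in>basis F 0. aug F k * (x * \<phi> 0 k l)) \<in> J"
    by (simp add: right_diff_distrib sum_distrib_left mult.assoc mult.left_commute)
next
  fix i k l assume "k \<in> basis F i" "l \<in> basis P (Suc i)"
  then have "(\<Sum>m\<in>basis F (Suc i). bdry F i k m * \<phi> (Suc i) m l) = (\<Sum>m\<in>basis P i. \<phi> i k m * bdry P i m l)"
    using \<phi> by (simp add: chain_map_def)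
  then have "x * (\<Sum>m\<in>basis F (Suc i). bdry F i k m * \<phi> (Suc i) m l) = x * (\<Sum>m\<in>basis P i. \<phi> i k m * bdry P i m l)"
    by simp
  then show "(\<Sum>m\<in>basis F (Suc i). bdry F i k m * (x * \<phi> (Suc i) m l)) = (\<Sum>m\<in>basis P i. x * \<phi> i k m * bdry P i m l)"
    by (simp add: sum_distrib_left mult.assoc mult.left_commute)
qed

text \<open>Since no member of \<open>S\<close> contains the free vertex \<open>x\<close>, the monomials of \<open>A\<close> and of \<open>A - {x}\<close> have
  the same colon ideal. Hence the cone can be formed with \<open>x\<close> times a lift of \<open>x\<^sup>A\<^sup>-\<^sup>{\<^sup>x\<^sup>}\<close>, and
  \<open>tor_dim_cone\<close> applies. In other words, the mapping cone of a leaf creates no cancellation.\<close>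

theorem betti_insert:
  fixes S :: "'v::finite set set"
  assumes x: "x \<in> A" "\<forall>B\<in>S. x \<notin> B"
  shows "betti (sqfree_ideal (insert A S) :: ('v, 'k::field) poly_ring set) i j
    = betti (sqfree_ideal S :: ('v, 'k) poly_ring set) i j
      + (case i of 0 \<Rightarrow> 0 | Suc h \<Rightarrow>
          betti (sqfree_ideal ((\<lambda>B. B - A) ` S) :: ('v, 'k) poly_ring set) h (j - int (card A)))"
proof -
  let ?T = "(\<lambda>B. B - A) ` S" and ?A = "A - {x}"
  have T: "(\<lambda>B. B - ?A) ` S = ?T"
    using x(2) by (intro image_cong refl) auto
  obtain F :: "('v, 'k) free_complex" where F: "graded_free_resolution F (sqfree_ideal S)"
    using sqfree_resolution_exists by blast
  obtain P :: "('v, 'k) free_complex" where P: "graded_free_resolution P (sqfree_ideal ?T)"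
    using sqfree_resolution_exists by blast
  have "sqfree_monomial ?A * q \<in> sqfree_ideal S"
    if "q \<in> sqfree_ideal ?T" for q :: "('v, 'k) poly_ring"
    using that by (simp only: sqfree_ideal_colon T)
  then obtain \<phi> where "chain_map P F (sqfree_ideal S) (sqfree_monomial ?A) (int (card ?A)) \<phi>"
    using chain_map_exists[OF F P graded_ideal_sqfree homogeneous_sqfree_monomial] by blast
  from chain_map_times[OF this graded_ideal_sqfree homogeneous_sqfree_monomial[of "{x}"]]
  have \<psi>: "chain_map P F (sqfree_ideal S) (sqfree_monomial A) (int (card A))
      (\<lambda>i k l. sqfree_monomial {x} * \<phi> i k l)"
  proof -
    have "{x} \<union> ?A = A" using x(1) by blast
    then have "sqfree_monomial A = (sqfree_monomial {x} * sqfree_monomial ?A :: ('v, 'k) poly_ring)"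
      using sqfree_monomial_Un[of "{x}" ?A] by simp
    moreover have "int (card A) = int (card {x}) + int (card ?A)"
      using card_Suc_Diff1[of A x] x(1) by simp
    ultimately show ?thesis
      using \<open>chain_map P F _ (sqfree_monomial {x} * sqfree_monomial ?A) _ _\<close> by simp
  qed
  let ?C = "cone F P (\<lambda>i k l. sqfree_monomial {x} * \<phi> i k l) (int (card A))"
  have C: "graded_free_resolution ?C (sqfree_ideal (insert A S))"
    by (rule cone_sqfree_resolution[OF F P \<psi>])
  have "tor_dim ?C i j = tor_dim F i j + (case i of 0 \<Rightarrow> 0 | Suc h \<Rightarrow> tor_dim P h (j - int (card A)))"
    by (rule tor_dim_cone[OF F P C]) (simp add: const_coeff_mult const_coeff_sqfree_monomial)
  then show ?thesis
    using betti_eq_tor_dim[OF F graded_ideal_sqfree] betti_eq_tor_dim[OF P graded_ideal_sqfree]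
      betti_eq_tor_dim[OF C graded_ideal_sqfree] by (simp split: nat.split)
qed


section \<open>Dismantling a tree one leaf at a time\<close>

text \<open>From here on a complex is represented by the antichain of its facets. Removing a facet from
  such a family gives the family of a subcomplex; \<open>leaf_in\<close>, \<open>forest\<close> and \<open>codim1_connected\<close> express
  leaves, the leaf condition on all subcomplexes and connectedness in codimension one in terms of
  facets alone.\<close>

definition leaf_in :: "'v set \<Rightarrow> 'v set set \<Rightarrow> bool" where
  "leaf_in F S \<longleftrightarrow> F \<in> S \<and> (S = {F} \<or> (\<exists>G\<in>S. G \<noteq> F \<and> (\<forall>H\<in>S. H \<noteq> F \<longrightarrow> F \<inter> H \<subseteq> G)))"

definition forest :: "'v set set \<Rightarrow> bool" where
  "forest S \<longleftrightarrow> (\<forall>T. T \<subseteq> S \<longrightarrow> T \<noteq> {} \<longrightarrow> (\<exists>F. leaf_in F T))"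

definition antichain :: "'v set set \<Rightarrow> bool" where
  "antichain S \<longleftrightarrow> (\<forall>F\<in>S. \<forall>G\<in>S. F \<subseteq> G \<longrightarrow> F = G)"

text \<open>For facets \<open>F\<close> and \<open>G\<close> this is one step of a proper chain: the intersection has codimension
  one in \<open>G\<close>. Steps never raise the dimension between members of an antichain.\<close>

definition codim1_step :: "'v set \<Rightarrow> 'v set \<Rightarrow> bool" where
  "codim1_step F G \<longleftrightarrow> card (G - F) = 1 \<and> F \<inter> G \<noteq> {}"

inductive codim1_path :: "'v set set \<Rightarrow> 'v set \<Rightarrow> 'v set \<Rightarrow> bool" for S where
  refl: "F \<in> S \<Longrightarrow> codim1_path S F F"
| step: "F \<in> S \<Longrightarrow> codim1_step F G \<Longrightarrow> codim1_path S G H \<Longrightarrow> codim1_path S F H"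

definition codim1_connected :: "'v set set \<Rightarrow> bool" where
  "codim1_connected S \<longleftrightarrow> (\<forall>F\<in>S. \<forall>G\<in>S. card G \<le> card F \<longrightarrow> codim1_path S F G)"

text \<open>The facet \<open>F\<close> meets \<open>L\<close> inside the joint \<open>G\<close> of \<open>F\<close>, hence inside the joint of \<open>L\<close> that was found
  without \<open>F\<close>.\<close>

lemma leaf_extends:
  assumes F: "leaf_in F S" and L: "leaf_in L (S - {F})" and G: "L \<noteq> G"
    and FG: "G \<in> S" "G \<noteq> F" "\<forall>H\<in>S. H \<noteq> F \<longrightarrow> F \<inter> H \<subseteq> G"
  shows "leaf_in L S"
proof -
  have "S - {F} \<noteq> {L}" using FG G by auto
  then obtain H where H: "H \<in> S - {F}" "H \<noteq> L" "\<forall>H'\<in>S - {F}. H' \<noteq> L \<longrightarrow> L \<inter> H' \<subseteq> H"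
    using L unfolding leaf_in_def by metis
  have "L \<inter> F \<subseteq> L \<inter> G" using L FG(3) unfolding leaf_in_def by blast
  also have "\<dots> \<subseteq> H" using H(3) FG(1,2) G by blast
  finally have "\<forall>H'\<in>S. H' \<noteq> L \<longrightarrow> L \<inter> H' \<subseteq> H" using H(3) by blast
  then show ?thesis
    using H(1,2) L unfolding leaf_in_def by (metis DiffD1)
qed

text \<open>Any leaf other than \<open>F0\<close> will do. If the leaf \<open>F\<close> that is found first happens to be \<open>F0\<close>, remove it.
  What remains is a single facet, which is then a leaf of the pair, or has by induction a leaf
  different from the joint of \<open>F\<close>, and that is a leaf of the whole.\<close>

lemma forest_two_leaves:
  assumes "finite S" "forest S" "F0 \<in> S" "S \<noteq> {F0}"
  shows "\<exists>L. leaf_in L S \<and> L \<noteq> F0"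
  using assms
proof (induction "card S" arbitrary: S F0 rule: less_induct)
  case less
  obtain F where F: "leaf_in F S" using less.prems by (auto simp: forest_def)
  show ?case
  proof (cases "F = F0")
    case True
    then obtain G where G: "G \<in> S" "G \<noteq> F" "\<forall>H\<in>S. H \<noteq> F \<longrightarrow> F \<inter> H \<subseteq> G"
      using F less.prems(4) unfolding leaf_in_def by metis
    show ?thesis
    proof (cases "S - {F} = {G}")
      case True
      moreover have "F \<in> S" using F by (simp add: leaf_in_def)
      ultimately have "S = {F, G}" by blast
      then have "leaf_in G S" unfolding leaf_in_def using G(2) by blast
      with G(2) \<open>F = F0\<close> show ?thesis by auto
    next
      case False
      have "card (S - {F}) < card S"
        using F less.prems(1) by (intro card_Diff1_less) (simp_all add: leaf_in_def)
      moreover have "forest (S - {F})"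
        using less.prems(2) unfolding forest_def by blast
      ultimately obtain L where L: "leaf_in L (S - {F})" "L \<noteq> G"
        using less.hyps[of "S - {F}" G] less.prems(1) G(1,2) False by blast
      have "L \<noteq> F" using L by (simp add: leaf_in_def)
      with leaf_extends[OF F L(1) L(2) G] \<open>F = F0\<close> show ?thesis by auto
    qed
  qed (use F in auto)
qed

lemma leaf_has_free_vertex:
  assumes "leaf_in F S" "antichain S" "S \<noteq> {F}"
  obtains x G where "x \<in> F" "G \<in> S" "G \<noteq> F" "x \<notin> G" "\<forall>H\<in>S. H \<noteq> F \<longrightarrow> F \<inter> H \<subseteq> G - {x}"
proof -
  obtain G where G: "F \<in> S" "G \<in> S" "G \<noteq> F" "\<forall>H\<in>S. H \<noteq> F \<longrightarrow> F \<inter> H \<subseteq> G"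
    using assms unfolding leaf_in_def by metis
  have "\<not> F \<subseteq> G" using assms(2) G(1-3) unfolding antichain_def by metis
  then obtain x where x: "x \<in> F" "x \<notin> G" by blast
  have "\<forall>H\<in>S. H \<noteq> F \<longrightarrow> F \<inter> H \<subseteq> G - {x}" using G(4) x by blast
  with x G(2,3) show ?thesis using that by blast
qed

text \<open>A step into the leaf \<open>F\<close> comes from a facet containing \<open>F\<close> minus its free vertex, and a
  step out of \<open>F\<close> uses only vertices of \<open>F\<close> other than the free one. So the detour through \<open>F\<close>
  can be replaced by a direct step, or by no step at all.\<close>

lemma codim1_path_avoids_leaf:
  assumes x: "x \<in> F" "\<forall>H\<in>S. H \<noteq> F \<longrightarrow> x \<notin> H"
    and anti: "antichain S"
    and path: "codim1_path S A B" "A \<noteq> F" "B \<noteq> F"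
  shows "codim1_path (S - {F}) A B"
proof -
  have start: "A \<in> S" if "codim1_path S A B" for A B
    using that by (rule codim1_path.cases) auto
  \<comment> \<open>The second conjunct handles paths that start in \<open>F\<close>, seen from the facet before \<open>F\<close>.\<close>
  have "(A \<noteq> F \<longrightarrow> codim1_path (S - {F}) A B) \<and>
     (A = F \<longrightarrow> (\<forall>A'\<in>S - {F}. codim1_step A' F \<longrightarrow> codim1_path (S - {F}) A' B))"
    using path(1,3)
  proof (induction rule: codim1_path.induct)
    case (refl A)
    then show ?case by (auto intro: codim1_path.refl)
  next
    case (step A G B)
    show ?case
    proof (intro conjI impI ballI)
      assume "A \<noteq> F"
      then show "codim1_path (S - {F}) A B"
        using step.hyps(1,2) step.IH step.prems
        by (cases "G = F") (auto intro: codim1_path.step)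
    next
      fix A' assume "A = F" and A': "A' \<in> S - {F}" "codim1_step A' F"
      have "G \<noteq> F" using step.hyps(2) \<open>A = F\<close> by (auto simp: codim1_step_def)
      have G: "G \<in> S" using start step.hyps(3) by blast
      have path: "codim1_path (S - {F}) G B" using step.IH step.prems \<open>G \<noteq> F\<close> by blast
      have xn: "x \<notin> A'" "x \<notin> G" using x(2) A'(1) G \<open>G \<noteq> F\<close> by blast+
      \<comment> \<open>The step from \<open>A'\<close> into \<open>F\<close> misses one vertex of \<open>F\<close>, which can only be the free one.\<close>
      have FA': "F - A' = {x}"
        using A'(2) x(1) xn unfolding codim1_step_def
        by (metis DiffI card_1_singletonE singletonD)
      have sub: "G - A' \<subseteq> G - F" using FA' xn by auto
      obtain g where g: "G - F = {g}"
        using step.hyps(2) \<open>A = F\<close> unfolding codim1_step_def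
        by (metis card_1_singletonE)
      show "codim1_path (S - {F}) A' B"
      proof (cases "G \<subseteq> A'")
        case True
        then have "G = A'" using anti G A'(1) unfolding antichain_def by blast
        with path show ?thesis by simp
      next
        case False
        then have "G - A' = {g}" using sub unfolding g
          by (metis Diff_eq_empty_iff subset_singletonD)
        moreover have "A' \<inter> G \<noteq> {}"
        proof -
          obtain z where z: "z \<in> F" "z \<in> G"
            using step.hyps(2) \<open>A = F\<close> unfolding codim1_step_def by blast
          then have "z \<notin> F - A'" using FA' xn by auto
          with z show ?thesis by blast
        qed
        ultimately have "codim1_step A' G" by (simp add: codim1_step_def)
        with path A' show ?thesis by (auto intro: codim1_path.step)
      qed
    qed
  qed
  with path show ?thesis by auto
qed

lemma codim1_connected_remove_leaf:
  assumes "antichain S" "codim1_connected S" "leaf_in F S"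
  shows "codim1_connected (S - {F})"
proof (cases "S = {F}")
  case False
  then obtain x G where x: "x \<in> F" and G: "x \<notin> G" "\<forall>H\<in>S. H \<noteq> F \<longrightarrow> F \<inter> H \<subseteq> G - {x}"
    using leaf_has_free_vertex[OF assms(3,1)] by metis
  then have free: "\<forall>H\<in>S. H \<noteq> F \<longrightarrow> x \<notin> H" by blast
  show ?thesis
    unfolding codim1_connected_def
  proof (intro ballI impI)
    fix A B assume "A \<in> S - {F}" "B \<in> S - {F}" "card B \<le> card A"
    then show "codim1_path (S - {F}) A B"
      using assms(2) codim1_path_avoids_leaf[OF x free assms(1)]
      by (simp add: codim1_connected_def)
  qed
qed (simp add: codim1_connected_def)

section \<open>From complexes to families of facets\<close>

lemma antichain_facets: "antichain (facets \<Delta>)"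
  by (auto simp: antichain_def facets_def)

lemma facets_of_generated_complex:
  assumes "antichain T"
  shows "facets {A. \<exists>F\<in>T. A \<subseteq> F} = T"
proof
  show "facets {A. \<exists>F\<in>T. A \<subseteq> F} \<subseteq> T"
    by (auto simp: facets_def)
  show "T \<subseteq> facets {A. \<exists>F\<in>T. A \<subseteq> F}"
  proof
    fix F assume F: "F \<in> T"
    have "F = A" if "F \<subseteq> A" "A \<subseteq> G" "G \<in> T" for A G
      using assms F that unfolding antichain_def by (metis order_trans order_antisym)
    with F show "F \<in> facets {A. \<exists>F\<in>T. A \<subseteq> F}"
      unfolding facets_def by blast
  qed
qed

text \<open>A subfamily of the facets is the set of facets of the subcomplex that it generates.\<close>

lemma forest_facets:
  assumes "simplicial_complex V \<Delta>" "is_tree \<Delta>"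
  shows "forest (facets \<Delta>)"
  unfolding forest_def
proof (intro allI impI)
  fix T assume T: "T \<subseteq> facets \<Delta>" "T \<noteq> {}"
  define \<Gamma> where "\<Gamma> = {A. \<exists>F\<in>T. A \<subseteq> F}"
  have anti: "antichain T" using T antichain_facets[of \<Delta>] by (auto simp: antichain_def)
  have fac: "facets \<Gamma> = T" unfolding \<Gamma>_def by (rule facets_of_generated_complex[OF anti])
  have "\<Union>\<Gamma> \<subseteq> V"
    using T assms(1) by (force simp: \<Gamma>_def facets_def simplicial_complex_def)
  then have "finite (\<Union>\<Gamma>)" using assms(1) finite_subset by (auto simp: simplicial_complex_def)
  then have "simplicial_complex (\<Union>\<Gamma>) \<Gamma>"
    unfolding simplicial_complex_def \<Gamma>_def by (intro conjI) (assumption | blast)+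
  then have "subcomplex \<Gamma> \<Delta>" by (simp add: subcomplex_def fac T)
  moreover have "\<Gamma> \<noteq> {}" using T by (auto simp: \<Gamma>_def)
  ultimately obtain F where "is_leaf F \<Gamma>" using assms(2) by (auto simp: is_tree_def)
  then show "\<exists>F. leaf_in F T" unfolding is_leaf_def fac leaf_in_def
    by (metis le_inf_iff)
qed

lemma codim1_path_of_proper_chain:
  assumes "\<forall>F\<in>facets \<Delta>. finite F" "proper_chain \<Delta> F G q C"
  shows "codim1_path (facets \<Delta>) F G"
proof -
  have C: "C i \<in> facets \<Delta>" if "i \<le> q" for i
    using assms that by (auto simp: proper_chain_def facet_chain_def)
  have step: "codim1_step (C i) (C (Suc i))" if "i < q" for i
  proof -
    have "finite (C (Suc i))" using assms C[of "Suc i"] that by auto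
    moreover have "card (C i \<inter> C (Suc i)) + 1 = card (C (Suc i))"
      using assms that by (auto simp: proper_chain_def face_dim_def)
    ultimately have "card (C (Suc i) - C i) = 1"
      by (simp add: card_Diff_subset_Int Int_commute)
    then show ?thesis
      using assms that by (auto simp: codim1_step_def proper_chain_def facet_chain_def)
  qed
  have "codim1_path (facets \<Delta>) (C (q - n)) (C q)" if "n \<le> q" for n
    using that
  proof (induction n)
    case 0
    show ?case using C by (simp add: codim1_path.refl)
  next
    case (Suc n)
    then have "Suc (q - Suc n) = q - n" by simp
    with Suc step[of "q - Suc n"] C[of "q - Suc n"] show ?case
      by (auto intro: codim1_path.step)
  qed
  from this[of q] show ?thesis
    using assms by (auto simp: proper_chain_def facet_chain_def)
qed

lemma codim1_connected_facets:
  assumes "\<forall>F\<in>facets \<Delta>. finite F" "connected_in_codim_1 \<Delta>"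
  shows "codim1_connected (facets \<Delta>)"
  using assms codim1_path_of_proper_chain[OF assms(1)]
  by (force simp: codim1_connected_def connected_in_codim_1_def face_dim_def)

lemma facets_nonempty:
  assumes "finite \<Delta>" "{v} \<in> \<Delta>"
  shows "facets \<Delta> \<noteq> {}"
  using finite_has_maximal[OF assms(1)] assms(2) by (force simp: facets_def)

section \<open>Alternating sums of Betti numbers\<close>

text \<open>The sum starts at homological position \<open>0\<close> and stops before \<open>n\<close>. Betti numbers vanish in high
  positions, so it is independent of \<open>n\<close> for large \<open>n\<close>.\<close>

definition alt_sum :: "('v, 'k::field) poly_ring set \<Rightarrow> nat \<Rightarrow> int \<Rightarrow> int" where
  "alt_sum I n c = (\<Sum>i<n. (- 1) ^ i * int (betti I i (int i + c)))"

definition alternating_vanishing :: "('v, 'k::field) poly_ring set \<Rightarrow> bool" where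
  "alternating_vanishing I \<longleftrightarrow> (\<exists>n0. \<forall>n\<ge>n0. \<forall>c. alt_sum I n c = 0)"

lemma alt_sum_insert:
  fixes S :: "'v::finite set set"
  assumes x: "x \<in> A" "\<forall>B\<in>S. x \<notin> B"
  shows "alt_sum (sqfree_ideal (insert A S) :: ('v, 'k::field) poly_ring set) (Suc n) c
    = alt_sum (sqfree_ideal S :: ('v, 'k) poly_ring set) (Suc n) c
      - alt_sum (sqfree_ideal ((\<lambda>B. B - A) ` S) :: ('v, 'k) poly_ring set) n (c + 1 - int (card A))"
proof -
  let ?b = "\<lambda>S i j. betti (sqfree_ideal S :: ('v, 'k) poly_ring set) i j"
  let ?T = "(\<lambda>B. B - A) ` S"
  have "(\<Sum>i<Suc n. (- 1) ^ i * int (case i of 0 \<Rightarrow> 0 | Suc h \<Rightarrow> ?b ?T h (int i + c - int (card A))))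
      = (\<Sum>h<n. (- 1) ^ Suc h * int (?b ?T h (int (Suc h) + c - int (card A))))"
    by (subst sum.lessThan_Suc_shift) simp
  also have "\<dots> = - alt_sum (sqfree_ideal ?T :: ('v, 'k) poly_ring set) n (c + 1 - int (card A))"
    by (simp add: alt_sum_def sum_negf algebra_simps)
  finally show ?thesis
    unfolding alt_sum_def[of _ "Suc n"] betti_insert[OF x, where 'k = 'k]
    by (simp add: distrib_left sum.distrib)
qed

text \<open>If the variable \<open>y\<close> is among the generators, those without \<open>y\<close> generate an ideal \<open>I'\<close> that
  equals its own colon ideal by \<open>y\<close>. So \<open>betti_insert\<close> counts every Betti number of \<open>R/I'\<close> twice, in
  neighbouring homological positions of the same strand.\<close>

lemma alternating_vanishing_of_variable:
  fixes S :: "'v::finite set set"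
  assumes "{y} \<in> S"
  shows "alternating_vanishing (sqfree_ideal S :: ('v, 'k::field) poly_ring set)"
proof -
  define L where "L = {B \<in> S. y \<notin> B}"
  have eq: "(sqfree_ideal S :: ('v, 'k) poly_ring set) = sqfree_ideal (insert {y} L)"
  proof -
    have "(\<exists>A\<in>S. A \<subseteq> X) \<longleftrightarrow> (\<exists>A\<in>insert {y} L. A \<subseteq> X)" for X
    proof
      assume "\<exists>A\<in>S. A \<subseteq> X"
      then obtain A where "A \<in> S" "A \<subseteq> X" by blast
      then show "\<exists>A\<in>insert {y} L. A \<subseteq> X" by (cases "y \<in> A") (auto simp: L_def)
    next
      assume "\<exists>A\<in>insert {y} L. A \<subseteq> X"
      then obtain A where "A \<in> insert {y} L" "A \<subseteq> X" by blast
      then show "\<exists>A\<in>S. A \<subseteq> X" using assms by (auto simp: L_def)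
    qed
    then show ?thesis by (simp only: sqfree_ideal_def)
  qed
  have diff: "(\<lambda>B. B - {y}) ` L = L" by (auto simp: L_def image_iff)
  obtain n0 where n0: "\<forall>i\<ge>n0. \<forall>j. betti (sqfree_ideal L :: ('v, 'k) poly_ring set) i j = 0"
    using betti_bounded by blast
  have "alt_sum (sqfree_ideal S :: ('v, 'k) poly_ring set) n c = 0" if n: "n \<ge> Suc n0" for n c
  proof -
    obtain m where m: "n = Suc m" "m \<ge> n0" using n by (cases n) auto
    have "alt_sum (sqfree_ideal S :: ('v, 'k) poly_ring set) (Suc m) c
        = alt_sum (sqfree_ideal L :: ('v, 'k) poly_ring set) (Suc m) c
          - alt_sum (sqfree_ideal L :: ('v, 'k) poly_ring set) m c"
      unfolding eq using alt_sum_insert[of y "{y}" L m c, where 'k = 'k] by (simp add: diff L_def)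
    then show ?thesis using m n0 by (simp add: alt_sum_def)
  qed
  then show ?thesis unfolding alternating_vanishing_def by blast
qed

lemma alternating_betti_sum_iff:
  fixes I :: "('v, 'k::field) poly_ring set"
  assumes "\<forall>i\<ge>n. \<forall>j. betti I i j = 0"
  shows "alternating_betti_sum I j c \<longleftrightarrow> alt_sum I (Suc n) j - int (betti I 0 j) = c"
proof -
  let ?A = "{i. 1 \<le> i \<and> betti I i (int i + j) \<noteq> 0}"
  have sub: "?A \<subseteq> {1..n}" using assms by (auto simp: not_less_eq_eq intro: ccontr)
  have "(\<Sum>i\<in>?A. (- 1) ^ i * int (betti I i (int i + j))) = (\<Sum>i=1..n. (- 1) ^ i * int (betti I i (int i + j)))"
    by (rule sum.mono_neutral_left) (use sub in auto)
  also have "\<dots> = alt_sum I (Suc n) j - int (betti I 0 j)"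
    unfolding alt_sum_def sum.lessThan_Suc_shift by (simp add: sum.atLeast1_atMost_eq)
  finally show ?thesis
    using finite_subset[OF sub] by (simp add: alternating_betti_sum_def)
qed

text \<open>The facet \<open>G\<close> is reached by the first step of a proper chain from \<open>F\<close> to \<open>F0\<close>, which
  exists because \<open>F0\<close> is not larger than \<open>F\<close>.\<close>

lemma codim1_neighbour:
  assumes "codim1_connected S" "F \<in> S" "F0 \<in> S" "F0 \<noteq> F" "card F0 \<le> card F"
  obtains G y where "G \<in> S" "G \<noteq> F" "G - F = {y}"
proof -
  have start: "G \<in> S" if "codim1_path S G H" for G H
    using that by (rule codim1_path.cases) auto
  have "codim1_path S F F0" using assms by (auto simp: codim1_connected_def)
  then obtain G where "codim1_step F G" "codim1_path S G F0"
    by (rule codim1_path.cases) (use assms(4) in auto)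
  then have "G \<in> S" "card (G - F) = 1" using start by (auto simp: codim1_step_def)
  moreover from this have "G \<noteq> F" by auto
  ultimately show ?thesis using that by (metis card_1_singletonE)
qed

text \<open>The term at \<open>c = 0\<close> is the Betti number of \<open>R/I\<close> in position \<open>0\<close>, which the alternating sum
  property leaves out. The family is dismantled leaf by leaf down to \<open>F0\<close>: removing a leaf other than
  \<open>F0\<close> changes no alternating sum.\<close>

theorem forest_alternating_sums:
  fixes S :: "'v::finite set set"
  assumes "forest S" "antichain S" "codim1_connected S"
    and "F0 \<in> S" "F0 \<noteq> {}" "\<forall>F\<in>S. card F0 \<le> card F"
  shows "\<exists>n0. \<forall>n\<ge>n0. \<forall>c. alt_sum (sqfree_ideal S :: ('v, 'k::field) poly_ring set) n c
      = (if c = 0 then 1 else 0) - (if c = int (card F0) - 1 then 1 else 0)"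
  using assms
proof (induction "card S" arbitrary: S rule: less_induct)
  case less
  have free_sum: "alt_sum (sqfree_ideal {} :: ('v, 'k) poly_ring set) n c = (if c = 0 then 1 else 0)"
    if n: "n \<ge> 1" for n c
  proof -
    obtain m where m: "n = Suc m" using n by (cases n) auto
    show ?thesis unfolding m alt_sum_def sum.lessThan_Suc_shift by (simp add: betti_no_generators)
  qed
  show ?case
  proof (cases "S = {F0}")
    case True
    obtain x where x: "x \<in> F0" using less.prems(5) by blast
    have "alt_sum (sqfree_ideal S :: ('v, 'k) poly_ring set) n c
      = (if c = 0 then 1 else 0) - (if c = int (card F0) - 1 then 1 else 0)" if n: "n \<ge> 2" for n c
    proof -
      obtain m where m: "n = Suc m" "m \<ge> 1" using n by (cases n) auto
      show ?thesis
        unfolding True m(1) using alt_sum_insert[OF x, of "{}" m c, where 'k = 'k] m(2)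
        by (auto simp: free_sum)
    qed
    then show ?thesis by blast
  next
    case False
    obtain F where F: "leaf_in F S" "F \<noteq> F0"
      using forest_two_leaves[of S F0] less.prems False by auto
    have FS: "F \<in> S" using F(1) by (simp add: leaf_in_def)
    have ne: "S \<noteq> {F}" using F(2) less.prems(4) by blast
    obtain x G' where x: "x \<in> F" and G': "x \<notin> G'" "\<forall>H\<in>S. H \<noteq> F \<longrightarrow> F \<inter> H \<subseteq> G' - {x}"
      using leaf_has_free_vertex[OF F(1) less.prems(2) ne] by metis
    let ?S = "S - {F}"
    have free: "\<forall>B\<in>?S. x \<notin> B" using x G' by blast
    obtain G y where G: "G \<in> S" "G \<noteq> F" "G - F = {y}"
      using codim1_neighbour[OF less.prems(3) FS less.prems(4)] F(2) less.prems(6) FS by metis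
    then have "{y} \<in> (\<lambda>B. B - F) ` ?S" by blast
    then obtain n1 where n1: "\<forall>n\<ge>n1. \<forall>c.
        alt_sum (sqfree_ideal ((\<lambda>B. B - F) ` ?S) :: ('v, 'k) poly_ring set) n c = 0"
      using alternating_vanishing_of_variable[where 'k = 'k] unfolding alternating_vanishing_def by metis
    have "card ?S < card S" using FS by (intro card_Diff1_less) auto
    moreover have "forest ?S" using less.prems(1) unfolding forest_def by blast
    moreover have "antichain ?S" using less.prems(2) unfolding antichain_def by blast
    moreover have "codim1_connected ?S"
      by (rule codim1_connected_remove_leaf[OF less.prems(2,3) F(1)])
    ultimately obtain n2 where n2: "\<forall>n\<ge>n2. \<forall>c. alt_sum (sqfree_ideal ?S :: ('v, 'k) poly_ring set) n c
      = (if c = 0 then 1 else 0) - (if c = int (card F0) - 1 then 1 else 0)"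
      using less.hyps[of ?S] less.prems(4,5,6) F(2) by auto
    have "insert F ?S = S" using FS by blast
    then have "alt_sum (sqfree_ideal S :: ('v, 'k) poly_ring set) n c
      = (if c = 0 then 1 else 0) - (if c = int (card F0) - 1 then 1 else 0)"
      if n: "n \<ge> Suc (max n1 n2)" for n c
    proof -
      obtain m where m: "n = Suc m" "m \<ge> n1" "m \<ge> n2" using n by (cases n) auto
      show ?thesis
        using alt_sum_insert[OF x free, of m c, where 'k = 'k] m n1 n2 \<open>insert F ?S = S\<close> by simp
    qed
    then show ?thesis by blast
  qed
qed

text \<open>The formula of \<open>betti_insert\<close> has no second summand in position \<open>0\<close>, so removing leaves down
  to the empty family reduces the claim to \<open>R\<close> itself.\<close>

lemma betti_0_sqfree:
  fixes S :: "'v::finite set set"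
  assumes "forest S" "antichain S" "\<forall>F\<in>S. F \<noteq> {}"
  shows "betti (sqfree_ideal S :: ('v, 'k::field) poly_ring set) 0 j = (if j = 0 then 1 else 0)"
  using assms
proof (induction "card S" arbitrary: S rule: less_induct)
  case less
  show ?case
  proof (cases "S = {}")
    case True
    then show ?thesis by (simp add: betti_no_generators)
  next
    case False
    then obtain F where F: "leaf_in F S" using less.prems(1) by (auto simp: forest_def)
    then have FS: "F \<in> S" by (simp add: leaf_in_def)
    let ?S = "S - {F}"
    obtain x where x: "x \<in> F" "\<forall>B\<in>?S. x \<notin> B"
    proof (cases "S = {F}")
      case True
      obtain x where "x \<in> F" using less.prems(3) FS by blast
      then show ?thesis using that True by blast
    next
      case False
      then obtain x G where x: "x \<in> F" and G: "\<forall>H\<in>S. H \<noteq> F \<longrightarrow> F \<inter> H \<subseteq> G - {x}"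
        using leaf_has_free_vertex[OF F less.prems(2)] by metis
      then have "\<forall>B\<in>?S. x \<notin> B" by blast
      with x show ?thesis by (rule that)
    qed
    have "card ?S < card S" using FS by (intro card_Diff1_less) auto
    moreover have "forest ?S" using less.prems(1) unfolding forest_def by blast
    moreover have "antichain ?S" using less.prems(2) unfolding antichain_def by blast
    ultimately have "betti (sqfree_ideal ?S :: ('v, 'k) poly_ring set) 0 j = (if j = 0 then 1 else 0)"
      using less.hyps[of ?S] less.prems(3) by auto
    moreover have "insert F ?S = S" using FS by blast
    ultimately show ?thesis using betti_insert[OF x, of 0 j, where 'k = 'k] by simp
  qed
qed

lemma facet_ideal_sqfree:
  "facet_ideal \<Delta> = (sqfree_ideal (facets \<Delta>) :: ('v::finite, 'k::comm_ring_1) poly_ring set)"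
  unfolding facet_ideal_def gen_ideal_sqfree_monomials[symmetric]
  by (simp add: sqfree_monomial_prod)

lemma minimal_generators_antichain:
  assumes "antichain S"
  shows "minimal_monomial_generators (sqfree_exp ` S)
    (sqfree_ideal S :: ('v::finite, 'k::comm_ring_1) poly_ring set)"
  unfolding minimal_monomial_generators_def
proof (intro conjI allI impI)
  have gen: "gen_ideal (monomial ` sqfree_exp ` T) = (sqfree_ideal T :: ('v, 'k) poly_ring set)" for T
    using gen_ideal_sqfree_monomials[of T, where 'k = 'k] by (simp add: image_image sqfree_monomial_def)
  then show "gen_ideal (monomial ` sqfree_exp ` S) = (sqfree_ideal S :: ('v, 'k) poly_ring set)" .
  fix H :: "('v \<Rightarrow>\<^sub>0 nat) set" assume H: "H \<subset> sqfree_exp ` S"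
  then obtain T where T: "T \<subseteq> S" "H = sqfree_exp ` T" by (meson psubsetE subset_image_iff)
  then obtain A where A: "A \<in> S" "A \<notin> T" using H by blast
  have "(sqfree_monomial A :: ('v, 'k) poly_ring) \<notin> sqfree_ideal T"
  proof
    assume "(sqfree_monomial A :: ('v, 'k) poly_ring) \<in> sqfree_ideal T"
    then obtain B where "B \<in> T" "B \<subseteq> A"
      by (auto simp: sqfree_ideal_def sqfree_monomial_def monomial_def)
    then show False using assms A T(1) unfolding antichain_def by blast
  qed
  moreover have "(sqfree_monomial A :: ('v, 'k) poly_ring) \<in> sqfree_ideal S"
    by (rule sqfree_monomial_in_ideal[OF A(1)])
  ultimately show "gen_ideal (monomial ` H) \<noteq> (sqfree_ideal S :: ('v, 'k) poly_ring set)"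
    unfolding T(2) gen by metis
qed

theorem theorem4p6:
  fixes \<Delta> :: "'v::finite set set"
  assumes "simplicial_complex UNIV \<Delta>"
    and "is_tree \<Delta>"
    and "connected_in_codim_1 \<Delta>"
  shows "alternating_sum_property (facet_ideal \<Delta> :: ('v, 'k::field) poly_ring set)"
proof -
  let ?S = "facets \<Delta>" and ?I = "facet_ideal \<Delta> :: ('v, 'k) poly_ring set"
  have I: "?I = sqfree_ideal ?S" by (rule facet_ideal_sqfree)
  have ne: "?S \<noteq> {}"
    using assms(1) by (intro facets_nonempty[of _ undefined]) (auto simp: simplicial_complex_def)
  have nonempty_facets: "\<forall>F\<in>?S. F \<noteq> {}"
  proof
    fix F assume "F \<in> ?S"
    moreover have "{undefined} \<in> \<Delta>" using assms(1) by (auto simp: simplicial_complex_def)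
    ultimately show "F \<noteq> {}" by (auto simp: facets_def)
  qed
  have S: "forest ?S" "antichain ?S" "codim1_connected ?S"
    by (rule forest_facets[OF assms(1,2)] antichain_facets)+
      (rule codim1_connected_facets[OF _ assms(3)], simp)
  obtain F0 where F0: "F0 \<in> ?S" "\<forall>F\<in>?S. card F0 \<le> card F"
  proof -
    obtain G where "G \<in> ?S" using ne by blast
    from ex_has_least_nat[of "\<lambda>F. F \<in> ?S", OF this, of card] show ?thesis using that by blast
  qed
  obtain n0 where n0: "\<forall>n\<ge>n0. \<forall>c. alt_sum ?I n c
      = (if c = 0 then 1 else 0) - (if c = int (card F0) - 1 then 1 else 0)"
    using forest_alternating_sums[OF S F0(1) _ F0(2), where 'k = 'k] nonempty_facets F0(1)
    unfolding I by blast
  obtain n1 where n1: "\<forall>i\<ge>n1. \<forall>j. betti ?I i j = 0"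
    using betti_bounded[of ?S, where 'k = 'k] unfolding I by blast
  have sum: "alternating_betti_sum ?I j c \<longleftrightarrow> (if j = int (card F0) - 1 then - 1 else 0) = c" for j c
  proof -
    have "\<forall>i\<ge>max n0 n1. \<forall>j. betti ?I i j = 0" using n1 by simp
    from alternating_betti_sum_iff[OF this, of j c] show ?thesis
      using n0 betti_0_sqfree[OF S(1,2) nonempty_facets, where 'k = 'k] by (auto simp: I)
  qed
  have "minimal_monomial_generators (sqfree_exp ` ?S) ?I"
    unfolding I by (rule minimal_generators_antichain[OF S(2)])
  moreover have "Min (mono_degree ` sqfree_exp ` ?S) = card F0"
    by (rule Min_eqI) (use F0 in \<open>auto simp: mono_degree_sqfree_exp image_image\<close>)
  ultimately show ?thesis
    unfolding alternating_sum_property_def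
    by (intro exI[of _ "sqfree_exp ` ?S"] exI[of _ "int (card F0)"]) (simp add: sum ne)
qed

end
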